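(* Let $I=(-1,1)$, $y_d\in L_2(I)$, $\beta>0$, and assume that $f\in H^1(I)$, $\psi\in H^2(I)$ and $\psi(1)\geq 0$. Let $V=\{v\in H^2(I): v(-1)=v'(1)=0\}$, let $\bar y$ be the solution of the continuous problem and, for each mesh $\mathcal{T}_h$ in a quasi-uniform family of partitions of $I$, let $\bar y_h$ be the solution of the discrete problem (both defined in the context), and put $\bar u=-\bar y''-f$, $\bar u_h=-\bar y_h''-f$. Then there is a positive constant $C$, independent of the mesh size $h$, such that $$|\bar y-\bar y_h|_{H^1(I)}+\|\bar u-\bar u_h\|_{L_2(I)}\leq C h.$$
   Context: $H^s(I)$ denotes the $L_2$-based Sobolev space; $|v|_{H^1(I)}=\|v'\|_{L_2(I)}$. Continuous problem: let $K=\{y\in V: y'\leq\psi \text{ on } I\}$. Then $\bar y\in K$ is the unique minimizer over $y\in K$ of $\frac12\big[\|y-y_d\|_{L_2(I)}^2+\beta\|y''+f\|_{L_2(I)}^2\big]$. Discrete problem: $\mathcal{T}_h$ is a partition of $I$ (into subintervals, with grid points including $-1$ and $1$) with mesh size $h$ (maximal subinterval length); the family is quasi-uniform, i.e. the ratio of $h$ to the minimal subinterval length is bounded uniformly over the family. $V_h\subset V$ is the cubic Hermite finite element space associated with $\mathcal{T}_h$, i.e. the space of $C^1$ functions on $[-1,1]$ that belong to $V$ and are cubic polynomials on each subinterval of $\mathcal{T}_h$. $P_h$ is the nodal interpolation operator for the continuous piecewise linear ($P_1$) finite element space associated with $\mathcal{T}_h$. Let $K_h=\{y\in V_h: P_hy'\leq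 P_h\psi \text{ on } [-1,1]\}$, i.e. the constraint $y'\le\psi$ is imposed only at the grid points. Then $\bar y_h\in K_h$ is the unique minimizer over $y_h\in K_h$ of $\frac12\big[\|y_h-y_d\|_{L_2(I)}^2+\beta\|y_h''+f\|_{L_2(I)}^2\big]$. The constant $C$ may depend on the data $y_d,\beta,f,\psi$ and the quasi-uniformity constant, but not on $h$. *)

theory Defs
  imports "HOL-Analysis.Analysis" "HOL-Computational_Algebra.Polynomial"
begin

abbreviation Iv :: "real set" where
  "Iv \<equiv> {-1<..<1}"

text \<open>Elements of the Lebesgue and Sobolev spaces are represented by functions on the reals, of
  which only the values on the interval matter, and these only up to a null set.\<close>

definition L2 :: "(real \<Rightarrow> real) set" where
  "L2 = {v. v \<in> borel_measurable (lebesgue_on Iv) \<and> integrable (lebesgue_on Iv) (\<lambda>x. (v x)\<^sup>2)}"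

definition L2_norm :: "(real \<Rightarrow> real) \<Rightarrow> real" where
  "L2_norm v = sqrt (LINT x|lebesgue_on Iv. (v x)\<^sup>2)"

text \<open>Smooth functions with compact support in the open interval.\<close>

definition test_function :: "(real \<Rightarrow> real) \<Rightarrow> bool" where
  "test_function \<phi> \<longleftrightarrow>
     (\<forall>k x. (deriv ^^ k) \<phi> differentiable (at x)) \<and> closure {x. \<phi> x \<noteq> 0} \<subseteq> Iv"

definition has_weak_deriv :: "(real \<Rightarrow> real) \<Rightarrow> (real \<Rightarrow> real) \<Rightarrow> bool" where
  "has_weak_deriv v g \<longleftrightarrow> v \<in> L2 \<and> g \<in> L2 \<and>
     (\<forall>\<phi>. test_function \<phi> \<longrightarrow>
        (LINT x|lebesgue_on Iv. v x * deriv \<phi> x) = - (LINT x|lebesgue_on Iv. g x * \<phi> x))"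

text \<open>Weak derivatives are unique up to null sets, so the choice is immaterial.\<close>

definition weak_deriv :: "(real \<Rightarrow> real) \<Rightarrow> (real \<Rightarrow> real)" where
  "weak_deriv v = (SOME g. has_weak_deriv v g)"

fun Sobolev_H :: "nat \<Rightarrow> (real \<Rightarrow> real) set" where
  "Sobolev_H 0 = L2"
| "Sobolev_H (Suc k) = {v. \<exists>g \<in> Sobolev_H k. has_weak_deriv v g}"

definition H1_seminorm :: "(real \<Rightarrow> real) \<Rightarrow> real" where
  "H1_seminorm v = L2_norm (weak_deriv v)"

text \<open>Pointwise values of a function in \<open>Sobolev_H 1\<close> are those of its representative that is
  continuous up to the end points; this representative is unique on \<open>{-1..1}\<close> and should not be
  evaluated elsewhere.\<close>

definition cont_rep :: "(real \<Rightarrow> real) \<Rightarrow> (real \<Rightarrow> real)" where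
  "cont_rep v = (SOME w. continuous_on {-1..1} w \<and> (AE x in lebesgue_on Iv. w x = v x))"

definition V_space :: "(real \<Rightarrow> real) set" where
  "V_space = {v \<in> Sobolev_H 2. cont_rep v (-1) = 0 \<and> cont_rep (weak_deriv v) 1 = 0}"

definition K_set :: "(real \<Rightarrow> real) \<Rightarrow> (real \<Rightarrow> real) set" where
  "K_set \<psi> = {y \<in> V_space. \<forall>x\<in>Iv. cont_rep (weak_deriv y) x \<le> cont_rep \<psi> x}"

definition cost :: "(real \<Rightarrow> real) \<Rightarrow> real \<Rightarrow> (real \<Rightarrow> real) \<Rightarrow> (real \<Rightarrow> real) \<Rightarrow> real" where
  "cost y\<^sub>d \<beta> f y =
     1/2 * ((L2_norm (\<lambda>x. y x - y\<^sub>d x))\<^sup>2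
            + \<beta> * (L2_norm (\<lambda>x. weak_deriv (weak_deriv y) x + f x))\<^sup>2)"

definition continuous_solution ::
    "(real \<Rightarrow> real) \<Rightarrow> real \<Rightarrow> (real \<Rightarrow> real) \<Rightarrow> (real \<Rightarrow> real) \<Rightarrow> (real \<Rightarrow> real) \<Rightarrow> bool" where
  "continuous_solution y\<^sub>d \<beta> f \<psi> y \<longleftrightarrow> is_arg_min (cost y\<^sub>d \<beta> f) (\<lambda>z. z \<in> K_set \<psi>) y"

text \<open>A partition is given by the increasing list of its grid points.\<close>

definition is_mesh :: "real list \<Rightarrow> bool" where
  "is_mesh T \<longleftrightarrow> T \<noteq> [] \<and> sorted_wrt (<) T \<and> hd T = -1 \<and> last T = 1"

definition mesh_lengths :: "real list \<Rightarrow> real set" where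
  "mesh_lengths T = {T ! Suc i - T ! i | i. Suc i < length T}"

definition mesh_size :: "real list \<Rightarrow> real" where
  "mesh_size T = Max (mesh_lengths T)"

definition quasi_uniform_family :: "real \<Rightarrow> real list set \<Rightarrow> bool" where
  "quasi_uniform_family \<rho> F \<longleftrightarrow>
     (\<forall>T\<in>F. is_mesh T \<and> mesh_size T / Min (mesh_lengths T) \<le> \<rho>)"

definition piecewise_poly :: "nat \<Rightarrow> real list \<Rightarrow> (real \<Rightarrow> real) \<Rightarrow> bool" where
  "piecewise_poly k T v \<longleftrightarrow>
     (\<forall>i. Suc i < length T \<longrightarrow>
        (\<exists>p::real poly. degree p \<le> k \<and> (\<forall>x\<in>{T ! i..T ! Suc i}. v x = poly p x)))"

text \<open>One-sided derivatives at the end points, in contrast to \<open>C1_differentiable_on\<close>.\<close>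

definition C1_closed :: "(real \<Rightarrow> real) \<Rightarrow> bool" where
  "C1_closed v \<longleftrightarrow>
     (\<exists>v'. continuous_on {-1..1} v' \<and>
        (\<forall>x\<in>{-1..1}. (v has_real_derivative v' x) (at x within {-1..1})))"

definition V_h :: "real list \<Rightarrow> (real \<Rightarrow> real) set" where
  "V_h T = {v \<in> V_space. C1_closed v \<and> piecewise_poly 3 T v}"

definition P1_space :: "real list \<Rightarrow> (real \<Rightarrow> real) set" where
  "P1_space T = {v. continuous_on {-1..1} v \<and> piecewise_poly 1 T v}"

text \<open>Nodal interpolation; the interpolant is unique on \<open>{-1..1}\<close>.\<close>

definition P_h :: "real list \<Rightarrow> (real \<Rightarrow> real) \<Rightarrow> (real \<Rightarrow> real)" where
  "P_h T w = (SOME p. p \<in> P1_space T \<and> (\<forall>t\<in>set T. p t = w t))"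

definition K_h :: "real list \<Rightarrow> (real \<Rightarrow> real) \<Rightarrow> (real \<Rightarrow> real) set" where
  "K_h T \<psi> = {y \<in> V_h T. \<forall>x\<in>{-1..1}.
     P_h T (cont_rep (weak_deriv y)) x \<le> P_h T (cont_rep \<psi>) x}"

definition discrete_solution ::
    "(real \<Rightarrow> real) \<Rightarrow> real \<Rightarrow> (real \<Rightarrow> real) \<Rightarrow> (real \<Rightarrow> real) \<Rightarrow> real list \<Rightarrow> (real \<Rightarrow> real) \<Rightarrow> bool" where
  "discrete_solution y\<^sub>d \<beta> f \<psi> T y \<longleftrightarrow> is_arg_min (cost y\<^sub>d \<beta> f) (\<lambda>z. z \<in> K_h T \<psi>) y"

definition control :: "(real \<Rightarrow> real) \<Rightarrow> (real \<Rightarrow> real) \<Rightarrow> (real \<Rightarrow> real)" where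
  "control f y = (\<lambda>x. - weak_deriv (weak_deriv y) x - f x)"

end

theory Submission imports Defs begin

text \<open>The problem becomes a one-dimensional obstacle problem when it is written in terms of
  \<open>r = y''\<close>. The boundary conditions of \<open>V\<close> turn \<open>r\<close> into \<open>y' = slope r\<close> and \<open>y = state r\<close>, so \<open>V\<close>
  is a copy of \<open>L2\<close>, the cost is a quadratic functional of \<open>r\<close>, and the constraint says that
  \<open>slope r\<close> stays below \<open>\<psi>\<close>. Testing the weak derivative against bump functions gives this
  dictionary (\<open>du_Bois_Reymond\<close>, \<open>V_space_representation\<close>).

  The derivative of the cost at the minimizer is \<open>d \<mapsto> ip m d\<close> for an \<open>L2\<close> function \<open>m\<close>, and \<open>m\<close>
  differs from \<open>\<beta> r\<close> by a function with square-integrable derivative. The variational inequality,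
  tested with hat functions, says that the primitive \<open>N\<close> of \<open>m\<close> is convex, lies below an obstacle
  with derivative \<open>k\<close> in \<open>H1\<close>, and is affine wherever it does not touch the obstacle. A convex
  function that touches a differentiable one from below is differentiable there, with the same
  derivative. Hence \<open>N'\<close> exists in the open interval, equals \<open>k\<close> on the contact set and is
  constant off it, and its increments are increments of \<open>k\<close> over smaller intervals
  (\<open>obstacle_regularity\<close>). So \<open>m\<close> and therefore \<open>r\<close> inherit the \<open>H1\<close> modulus of continuity of \<open>k\<close>
  (\<open>minimizer_regularity\<close>). This is the regularity \<open>ybar \<in> H3\<close> in disguise, and the modulus is the
  form in which it enters the estimates.

  Let \<open>Q\<close> average a function over each cell of the mesh. Nodal interpolation of \<open>y'\<close> is the same
  as averaging \<open>y''\<close>, and \<open>Q\<close> is the \<open>L2\<close> projection onto piecewise constants, so \<open>v - Q v\<close> is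
  \<open>O(h)\<close> for \<open>v\<close> with an \<open>H1\<close> modulus and \<open>ip m (v - Q v)\<close> gains a second factor \<open>h\<close> because \<open>m\<close>
  may be replaced by \<open>m - Q m\<close>. The two variational inequalities are tested against each other:
  the discrete one with \<open>Q r\<close>, whose slope interpolates that of \<open>r\<close>, and the continuous one with
  the function whose slope is \<open>\<psi>\<close> minus the interpolant of \<open>\<psi> - y_h'\<close>. The latter is admissible
  exactly because \<open>y_h'\<close> respects the constraint at the nodes. With \<open>E = L2_norm (r - r_h)\<close> this
  yields \<open>\<beta> E\<^sup>2 \<le> A h E + B h\<^sup>2\<close>, hence \<open>E = O(h)\<close> (\<open>error_estimate\<close>), and \<open>E\<close> controls both terms
  of the theorem.\<close>

section \<open>Square-integrable functions on the interval\<close>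

abbreviation IM :: "real measure" where "IM \<equiv> lebesgue_on Iv"

definition ip :: "(real \<Rightarrow> real) \<Rightarrow> (real \<Rightarrow> real) \<Rightarrow> real" where
  "ip f g = (LINT x|IM. f x * g x)"

lemma finite_measure_IM: "finite_measure IM"
  by (intro finite_measureI) (auto simp: emeasure_restrict_space)

lemma integrable_IM_bounded:
  fixes f :: "real \<Rightarrow> real"
  assumes "f \<in> borel_measurable IM" "\<And>x. x \<in> Iv \<Longrightarrow> \<bar>f x\<bar> \<le> B"
  shows "integrable IM f"
  by (rule finite_measure.integrable_const_bound[OF finite_measure_IM, where B=B])
     (use assms in \<open>auto\<close>)

lemma L2_measurable: "f \<in> L2 \<Longrightarrow> f \<in> borel_measurable IM"
  by (simp add: L2_def)

lemma L2_sq_integrable: "f \<in> L2 \<Longrightarrow> integrable IM (\<lambda>x. (f x)\<^sup>2)"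
  by (simp add: L2_def)

lemma L2_bounded:
  assumes "f \<in> borel_measurable IM" "\<And>x. x \<in> Iv \<Longrightarrow> \<bar>f x\<bar> \<le> B"
  shows "f \<in> L2"
proof -
  have "integrable IM (\<lambda>x. (f x)\<^sup>2)"
  proof (rule integrable_IM_bounded[where B="B\<^sup>2"])
    show "\<bar>(f x)\<^sup>2\<bar> \<le> B\<^sup>2" if "x \<in> Iv" for x
      using power_mono[OF assms(2)[OF that], of 2] by simp
  qed (use assms in measurable)
  then show ?thesis using assms by (simp add: L2_def)
qed

lemma L2_const [simp]: "(\<lambda>x. c) \<in> L2"
  by (rule L2_bounded[where B="\<bar>c\<bar>"]) auto

lemma measurable_IM_interval: "indicator {a..b} \<in> borel_measurable IM"
  by (intro measurable_restrict_space1 borel_measurable_indicator) auto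

lemma L2_indicator [simp]: "indicator {a..b::real} \<in> L2"
  by (rule L2_bounded[where B=1]) (auto simp: measurable_IM_interval indicator_def)

lemma continuous_imp_measurable_IM:
  assumes "continuous_on {-1..1} (f::real\<Rightarrow>real)"
  shows "f \<in> borel_measurable IM"
  by (rule continuous_imp_measurable_on_sets_lebesgue) (auto intro: continuous_on_subset[OF assms])

lemma L2_continuous:
  assumes "continuous_on {-1..1} (f::real\<Rightarrow>real)" shows "f \<in> L2"
proof -
  have "bounded (f ` {-1..1})" by (intro compact_imp_bounded compact_continuous_image assms) auto
  then obtain B where "\<And>x. x \<in> {-1..1} \<Longrightarrow> \<bar>f x\<bar> \<le> B"
    unfolding bounded_iff by fastforce
  then show ?thesis by (intro L2_bounded[where B=B] continuous_imp_measurable_IM assms) auto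
qed

text \<open>Pointwise, a product is dominated by the sum of the squares of its factors.\<close>
lemma L2_mult_integrable:
  assumes "f \<in> L2" "g \<in> L2" shows "integrable IM (\<lambda>x. f x * g x)"
proof (rule Bochner_Integration.integrable_bound)
  show "integrable IM (\<lambda>x. (f x)\<^sup>2 + (g x)\<^sup>2)"
    using assms by (intro Bochner_Integration.integrable_add L2_sq_integrable)
  show "(\<lambda>x. f x * g x) \<in> borel_measurable IM"
    using assms by (intro borel_measurable_times L2_measurable)
  have "\<bar>u * v\<bar> \<le> u\<^sup>2 + v\<^sup>2" for u v :: real
  proof -
    have "2 * \<bar>u\<bar> * \<bar>v\<bar> \<le> u\<^sup>2 + v\<^sup>2" using sum_squares_bound[of "\<bar>u\<bar>" "\<bar>v\<bar>"] by simp
    moreover have "0 \<le> \<bar>u\<bar> * \<bar>v\<bar>" by simp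
    ultimately show ?thesis unfolding abs_mult by linarith
  qed
  then show "AE x in IM. norm (f x * g x) \<le> norm ((f x)\<^sup>2 + (g x)\<^sup>2)" by auto
qed

lemma L2_integrable: "f \<in> L2 \<Longrightarrow> integrable IM f"
  using L2_mult_integrable[of f "\<lambda>x. 1"] by simp

lemma L2_add [intro]: assumes "f \<in> L2" "g \<in> L2" shows "(\<lambda>x. f x + g x) \<in> L2"
proof -
  have "integrable IM (\<lambda>x. (f x)\<^sup>2 + (g x)\<^sup>2 + 2 * (f x * g x))"
    by (intro Bochner_Integration.integrable_add integrable_mult_right L2_sq_integrable L2_mult_integrable assms)
  also have "(\<lambda>x. (f x)\<^sup>2 + (g x)\<^sup>2 + 2 * (f x * g x)) = (\<lambda>x. (f x + g x)\<^sup>2)"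
    by (simp add: power2_sum mult.assoc)
  finally have "integrable IM (\<lambda>x. (f x + g x)\<^sup>2)" .
  moreover have "(\<lambda>x. f x + g x) \<in> borel_measurable IM"
    by (intro borel_measurable_add L2_measurable assms)
  ultimately show ?thesis by (simp add: L2_def)
qed

lemma L2_scale [intro]: assumes "f \<in> L2" shows "(\<lambda>x. c * f x) \<in> L2"
  using assms by (auto simp: L2_def power_mult_distrib intro: borel_measurable_times)

lemma L2_minus [intro]: "f \<in> L2 \<Longrightarrow> (\<lambda>x. - f x) \<in> L2"
  using L2_scale[of f "-1"] by simp

lemma L2_diff [intro]: assumes "f \<in> L2" "g \<in> L2" shows "(\<lambda>x. f x - g x) \<in> L2"
  using L2_add[OF assms(1) L2_minus[OF assms(2)]] by simp

lemma L2_sum [intro]: "(\<And>i. i \<in> S \<Longrightarrow> f i \<in> L2) \<Longrightarrow> (\<lambda>x. \<Sum>i\<in>S. f i x) \<in> L2"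
  by (induction S rule: infinite_finite_induct) auto

lemma ip_commute: "ip f g = ip g f" by (simp add: ip_def mult.commute)

lemma ip_add_left: "f \<in> L2 \<Longrightarrow> g \<in> L2 \<Longrightarrow> h \<in> L2 \<Longrightarrow> ip (\<lambda>x. f x + g x) h = ip f h + ip g h"
  by (simp add: ip_def distrib_right Bochner_Integration.integral_add L2_mult_integrable)

lemma ip_diff_left: "f \<in> L2 \<Longrightarrow> g \<in> L2 \<Longrightarrow> h \<in> L2 \<Longrightarrow> ip (\<lambda>x. f x - g x) h = ip f h - ip g h"
  by (simp add: ip_def left_diff_distrib Bochner_Integration.integral_diff L2_mult_integrable)

lemma ip_scale_left: "ip (\<lambda>x. c * f x) h = c * ip f h"
  by (simp add: ip_def mult.assoc)

lemma ip_minus_left: "ip (\<lambda>x. - f x) h = - ip f h"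
  by (simp add: ip_def)

lemma ip_add_right: "f \<in> L2 \<Longrightarrow> g \<in> L2 \<Longrightarrow> h \<in> L2 \<Longrightarrow> ip h (\<lambda>x. f x + g x) = ip h f + ip h g"
  unfolding ip_commute[of h] by (rule ip_add_left)

lemma ip_diff_right: "f \<in> L2 \<Longrightarrow> g \<in> L2 \<Longrightarrow> h \<in> L2 \<Longrightarrow> ip h (\<lambda>x. f x - g x) = ip h f - ip h g"
  unfolding ip_commute[of h] by (rule ip_diff_left)

lemma ip_scale_right: "ip h (\<lambda>x. c * f x) = c * ip h f"
  unfolding ip_commute[of h] by (rule ip_scale_left)

lemma ip_minus_right: "ip h (\<lambda>x. - f x) = - ip h f"
  unfolding ip_commute[of h] by (rule ip_minus_left)

lemma ip_sum_left:
  "h \<in> L2 \<Longrightarrow> (\<And>i. i \<in> S \<Longrightarrow> f i \<in> L2) \<Longrightarrow> ip (\<lambda>x. \<Sum>i\<in>S. f i x) h = (\<Sum>i\<in>S. ip (f i) h)"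
proof (induction S rule: infinite_finite_induct)
  case (insert x S) then show ?case by (simp add: ip_add_left L2_sum)
qed (simp_all add: ip_def)

lemmas ip_linear = ip_add_left ip_diff_left ip_scale_left ip_minus_left
  ip_add_right ip_diff_right ip_scale_right ip_minus_right

lemma ip_cong_AE:
  assumes "AE x in IM. f x = f' x" "AE x in IM. g x = g' x"
    "f \<in> borel_measurable IM" "f' \<in> borel_measurable IM"
    "g \<in> borel_measurable IM" "g' \<in> borel_measurable IM"
  shows "ip f g = ip f' g'"
  unfolding ip_def by (rule integral_cong_AE) (use assms in auto)

lemma L2_norm_sq: "(L2_norm f)\<^sup>2 = ip f f"
  by (simp add: L2_norm_def ip_def flip: power2_eq_square)

lemma L2_norm_nonneg [simp]: "L2_norm f \<ge> 0" by (simp add: L2_norm_def)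

lemma ip_self_nonneg [simp]: "ip f f \<ge> 0" by (simp flip: L2_norm_sq)

lemma L2_norm_cong_AE:
  assumes "AE x in IM. f x = g x" "f \<in> borel_measurable IM" "g \<in> borel_measurable IM"
  shows "L2_norm f = L2_norm g"
  using ip_cong_AE[OF assms(1,1,2,3,2,3)] by (metis L2_norm_nonneg L2_norm_sq power2_eq_iff_nonneg)

lemma L2_norm_minus: "L2_norm (\<lambda>x. - f x) = L2_norm f" by (simp add: L2_norm_def)

text \<open>The quadratic form of \<open>s f - t g\<close> is nonnegative for all \<open>s\<close> and \<open>t\<close>.\<close>
lemma ip_Cauchy_Schwarz:
  assumes f: "f \<in> L2" and g: "g \<in> L2"
  shows "\<bar>ip f g\<bar> \<le> L2_norm f * L2_norm g"
proof -
  let ?a = "L2_norm f" and ?b = "L2_norm g"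
  have key: "2 * s * t * ip f g \<le> s\<^sup>2 * ?a\<^sup>2 + t\<^sup>2 * ?b\<^sup>2" for s t
  proof -
    have "0 \<le> ip (\<lambda>x. s * f x - t * g x) (\<lambda>x. s * f x - t * g x)" by simp
    also have "\<dots> = s\<^sup>2 * ?a\<^sup>2 + t\<^sup>2 * ?b\<^sup>2 - 2 * s * t * ip f g"
      using f g by (simp add: ip_linear L2_scale L2_diff L2_norm_sq ip_commute[of g f]
        algebra_simps) (simp add: power2_eq_square L2_norm_sq[unfolded power2_eq_square])
    finally show ?thesis by simp
  qed
  have 0: "ip f g = 0" if "?a * ?b = 0"
  proof (rule ccontr)
    assume nz: "ip f g \<noteq> 0"
    from that consider "?a = 0" | "?b = 0" by auto
    then show False
    proof cases
      case 1
      have "2 * ((?b\<^sup>2 + 1) / ip f g) * 1 * ip f g \<le> ?b\<^sup>2" using key[of "(?b\<^sup>2 + 1) / ip f g" 1] 1 by simp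
      with nz show False using zero_le_power2[of ?b] by simp
    next
      case 2
      have "2 * ((?a\<^sup>2 + 1) / ip f g) * 1 * ip f g \<le> ?a\<^sup>2" using key[of 1 "(?a\<^sup>2 + 1) / ip f g"] 2 by simp
      with nz show False using zero_le_power2[of ?a] by simp
    qed
  qed
  show ?thesis
  proof (cases "?a * ?b = 0")
    case True then show ?thesis using 0 by simp
  next
    case False
    then have pos: "?a > 0" "?b > 0" using L2_norm_nonneg[of f] L2_norm_nonneg[of g] by (auto simp: order_less_le)
    have "?a * ?b * ip f g \<le> ?a * ?b * (?a * ?b)" "?a * ?b * (- ip f g) \<le> ?a * ?b * (?a * ?b)"
      using key[of ?b ?a] key[of ?b "- ?a"] by (auto simp: power2_eq_square algebra_simps)
    then have "ip f g \<le> ?a * ?b" "- ip f g \<le> ?a * ?b"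
      using pos mult_le_cancel_left_pos[of "?a * ?b"] by (blast intro: mult_pos_pos)+
    then show ?thesis by simp
  qed
qed

lemma L2_norm_triangle:
  assumes f: "f \<in> L2" and g: "g \<in> L2"
  shows "L2_norm (\<lambda>x. f x + g x) \<le> L2_norm f + L2_norm g"
proof (rule power2_le_imp_le)
  have "(L2_norm (\<lambda>x. f x + g x))\<^sup>2 = (L2_norm f)\<^sup>2 + (L2_norm g)\<^sup>2 + 2 * ip f g"
    using f g by (simp add: L2_norm_sq ip_linear L2_add ip_commute[of g f])
  also have "\<dots> \<le> (L2_norm f + L2_norm g)\<^sup>2"
    using ip_Cauchy_Schwarz[OF f g] by (simp add: power2_sum)
  finally show "(L2_norm (\<lambda>x. f x + g x))\<^sup>2 \<le> (L2_norm f + L2_norm g)\<^sup>2" .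
qed simp

lemma L2_norm_triangle_diff:
  assumes f: "f \<in> L2" and g: "g \<in> L2"
  shows "L2_norm (\<lambda>x. f x - g x) \<le> L2_norm f + L2_norm g"
  using L2_norm_triangle[OF f L2_minus[OF g]] by (simp add: L2_norm_minus)

section \<open>Primitives of square-integrable functions\<close>

lemma integrable_IM_absolutely:
  fixes f :: "real \<Rightarrow> real"
  assumes "integrable IM f" shows "f absolutely_integrable_on {-1..1}"
proof -
  have "f absolutely_integrable_on Iv"
    using assms by (simp add: integrable_restrict_space set_integrable_def)
  then show ?thesis by (simp add: absolutely_integrable_on_Icc_iff_Ioo)
qed

lemmas L2_absolutely_integrable = integrable_IM_absolutely[OF L2_integrable]

lemma L2_integrable_on: "f \<in> L2 \<Longrightarrow> -1 \<le> a \<Longrightarrow> b \<le> 1 \<Longrightarrow> f integrable_on {a..b}"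
  by (meson L2_absolutely_integrable atLeastatMost_subset_iff integrable_subinterval_real set_lebesgue_integral_eq_integral(1))

lemma integral_IM_eq':
  fixes f :: "real \<Rightarrow> real"
  shows "integrable IM f \<Longrightarrow> (LINT x|IM. f x) = integral {-1..1} f"
  by (simp add: lebesgue_integral_eq_integral integral_open_interval_real)

lemma integral_IM_eq: "f \<in> L2 \<Longrightarrow> (LINT x|IM. f x) = integral {-1..1} f"
  by (simp add: lebesgue_integral_eq_integral L2_integrable integral_open_interval_real)

lemma L2_mult_indicator: assumes "f \<in> L2" shows "(\<lambda>x. f x * indicator {a..b} x) \<in> L2"
proof -
  have m: "(\<lambda>x. f x * indicator {a..b} x) \<in> borel_measurable IM"
    using assms measurable_IM_interval L2_measurable by (intro borel_measurable_times) auto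
  have "integrable IM (\<lambda>x. (f x * indicator {a..b} x)\<^sup>2)"
    by (rule Bochner_Integration.integrable_bound[OF L2_sq_integrable[OF assms]])
       (use m in \<open>auto simp: indicator_def\<close>)
  with m show ?thesis by (simp add: L2_def)
qed

lemma integral_restrict_Icc:
  assumes "-1 \<le> a" "b \<le> (1::real)"
  shows "integral {-1..1} (\<lambda>x. if x \<in> {a..b} then f x else (0::real)) = integral {a..b} f"
  using assms by (simp only: integral_restrict_Int) (simp add: Int_absorb2)

lemma integral_indicator_interval:
  fixes a b p q :: real
  shows "integral {p..q} (indicator {a..b}) = max 0 (min q b - max p a)"
proof -
  have "integral {p..q} (indicator {a..b} :: real \<Rightarrow> real) = integral {p..q} (\<lambda>t. if t \<in> {a..b} then 1 else 0)"
    by (rule Henstock_Kurzweil_Integration.integral_cong) simp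
  also have "\<dots> = integral ({a..b} \<inter> {p..q}) (\<lambda>t. 1)" by (rule integral_restrict_Int)
  also have "{a..b} \<inter> {p..q} = {max p a..min q b}" by auto
  also have "integral {max p a..min q b} (\<lambda>t. 1::real) = max 0 (min q b - max p a)"
    by (cases "max p a \<le> min q b") auto
  finally show ?thesis .
qed

lemma ip_indicator:
  assumes "f \<in> L2" "-1 \<le> a" "b \<le> 1"
  shows "ip f (indicator {a..b}) = integral {a..b} f"
proof -
  have "ip f (indicator {a..b}) = integral {-1..1} (\<lambda>x. f x * indicator {a..b} x)"
    unfolding ip_def using L2_mult_indicator[OF assms(1)] by (rule integral_IM_eq)
  also have "\<dots> = integral {-1..1} (\<lambda>x. if x \<in> {a..b} then f x else 0)"
    by (rule integral_cong) auto
  also have "\<dots> = integral {a..b} f"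
    using assms by (simp only: integral_restrict_Icc)
  finally show ?thesis .
qed

lemma integral_split:
  "f \<in> L2 \<Longrightarrow> -1 \<le> a \<Longrightarrow> a \<le> b \<Longrightarrow> b \<le> c \<Longrightarrow> c \<le> 1 \<Longrightarrow>
     integral {a..b} f + integral {b..c} f = integral {a..c} f"
  by (simp add: Henstock_Kurzweil_Integration.integral_combine L2_integrable_on)

text \<open>The estimate behind the \<open>H1\<close> modulus below: it bounds increments of a primitive of \<open>f\<close> by
  increments of a primitive of the square of \<open>f\<close>.\<close>
lemma integral_Cauchy_Schwarz:
  assumes "f \<in> L2" "-1 \<le> a" "a \<le> b" "b \<le> 1"
  shows "(integral {a..b} f)\<^sup>2 \<le> (b - a) * integral {a..b} (\<lambda>x. (f x)\<^sup>2)"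
proof -
  let ?i = "indicator {a..b} :: real \<Rightarrow> real"
  have "\<bar>ip (\<lambda>x. f x * ?i x) ?i\<bar> \<le> L2_norm (\<lambda>x. f x * ?i x) * L2_norm ?i"
    by (intro ip_Cauchy_Schwarz L2_mult_indicator assms) auto
  moreover have "ip (\<lambda>x. f x * ?i x) ?i = integral {a..b} f"
    using ip_indicator[OF assms(1,2,4)] by (simp add: ip_def mult.assoc flip: indicator_inter_arith)
  moreover have "(L2_norm ?i)\<^sup>2 = b - a"
  proof -
    have "ip ?i ?i = integral {a..b} ?i"
      using assms by (subst ip_indicator) auto
    also have "\<dots> = integral {a..b} (\<lambda>x. 1::real)"
      by (rule Henstock_Kurzweil_Integration.integral_cong) simp
    also have "\<dots> = b - a" using assms by simp
    finally show ?thesis by (simp add: L2_norm_sq)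
  qed
  moreover have "(L2_norm (\<lambda>x. f x * ?i x))\<^sup>2 = integral {a..b} (\<lambda>x. (f x)\<^sup>2)"
  proof -
    have "(L2_norm (\<lambda>x. f x * ?i x))\<^sup>2 = (LINT x|IM. (if x \<in> {a..b} then (f x)\<^sup>2 else 0))"
      unfolding L2_norm_sq ip_def by (intro Bochner_Integration.integral_cong) (auto simp: power2_eq_square)
    also have "\<dots> = integral {-1..1} (\<lambda>x. if x \<in> {a..b} then (f x)\<^sup>2 else 0)"
    proof -
      have "integrable IM (\<lambda>x. (f x * ?i x)\<^sup>2)" using L2_mult_indicator assms by (simp add: L2_sq_integrable)
      also have "(\<lambda>x. (f x * ?i x)\<^sup>2) = (\<lambda>x. if x \<in> {a..b} then (f x)\<^sup>2 else 0)" by (auto simp: fun_eq_iff)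
      finally show ?thesis by (rule integral_IM_eq')
    qed
    also have "\<dots> = integral {a..b} (\<lambda>x. (f x)\<^sup>2)"
      using assms by (simp only: integral_restrict_Icc)
    finally show ?thesis .
  qed
  ultimately show ?thesis
    using power_mono[of "\<bar>integral {a..b} f\<bar>" "L2_norm (\<lambda>x. f x * ?i x) * L2_norm ?i" 2]
    by (simp add: power_mult_distrib mult.commute)
qed

lemma enn2real_inj_finite:
  "enn2real a = enn2real b \<Longrightarrow> a < \<infinity> \<Longrightarrow> b < \<infinity> \<Longrightarrow> a = b"
  by (cases a; cases b) auto

text \<open>The positive and the negative part of \<open>u\<close> are densities of two finite measures that agree
  on all half-lines, hence are equal.\<close>
lemma AE_zero_if_primitive_zero:
  assumes u: "u \<in> L2" and zero: "\<And>x. x \<in> {-1..1} \<Longrightarrow> integral {-1..x} u = 0"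
  shows "AE x in IM. u x = 0"
proof -
  define u0 where "u0 x = (if x \<in> Iv then u x else 0)" for x
  have int0: "integrable lebesgue u0"
  proof -
    have "integrable lebesgue (\<lambda>x. indicator Iv x *\<^sub>R u x)"
      using L2_integrable[OF u] by (simp add: integrable_restrict_space)
    also have "(\<lambda>x. indicator Iv x *\<^sub>R u x) = u0" by (auto simp: u0_def fun_eq_iff)
    finally show ?thesis .
  qed
  \<comment> \<open>The uniqueness theorem for measures is about Borel sets, so \<open>u\<close> is replaced by a Borel version.\<close>
  then obtain g where g: "g \<in> borel_measurable lborel" and eq: "AE x in lborel. u0 x = g x"
    using completion_ex_borel_measurable_real[of u0 lborel] by auto
  have eqc: "AE x in lebesgue. u0 x = g x" using eq by (rule AE_completion)
  have gint: "integrable lborel g"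
  proof -
    have "integrable lebesgue g"
      using integrable_cong_AE[of u0 lebesgue g] int0 eqc g by (simp add: measurable_completion borel_measurable_integrable)
    then show ?thesis using g integrable_completion by blast
  qed
  have ray: "{x<..} \<in> sets borel" for x :: real
    by (rule borel_open) simp
  note ray [simp]
  have half: "(LINT y|lborel. g y * indicator {x<..} y) = 0" for x
  proof -
    have N: "negligible {y. u0 y \<noteq> g y}"
    proof -
      from eqc obtain N where "negligible N" "{y. u0 y \<noteq> g y} \<subseteq> N"
        by (auto simp: eventually_ae_filter_negligible)
      then show ?thesis by (rule negligible_subset)
    qed
    have "(LINT y|lborel. g y * indicator {x<..} y) = (LINT y:{x<..}|lborel. g y)"
      by (simp add: set_lebesgue_integral_def mult.commute)
    also have "\<dots> = integral {x<..} g"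
      using integrable_mult_indicator[of "{x<..}" lborel g] gint
      by (intro set_borel_integral_eq_integral(2)) (simp add: set_integrable_def)
    also have "\<dots> = integral {x<..} u0"
      by (rule integral_spike[OF N]) auto
    also have "\<dots> = integral ({x<..} \<inter> Iv) u"
      unfolding u0_def integral_restrict_Int by (simp add: Int_commute)
    also have "\<dots> = 0"
    proof (cases "x < 1")
      case False
      then have "{x<..} \<inter> Iv = {}" by auto
      then show ?thesis by simp
    next
      case True
      let ?z = "max x (-1)"
      have "{x<..} \<inter> Iv = {?z<..<1}" by auto
      then have "integral ({x<..} \<inter> Iv) u = integral {?z..1} u" by (simp add: integral_open_interval_real)
      also have "\<dots> = 0"
        using integral_split[OF u, of "-1" ?z 1] zero[of ?z] zero[of 1] True by simp
      finally show ?thesis .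
    qed
    finally show ?thesis .
  qed
  let ?M = "density lborel (\<lambda>x. ennreal (g x))" and ?N = "density lborel (\<lambda>x. ennreal (- g x))"
  have em: "emeasure (density lborel (\<lambda>x. ennreal (h x))) {x<..} = (\<integral>\<^sup>+y. ennreal (h y * indicator {x<..} y) \<partial>lborel)"
    if "h \<in> borel_measurable lborel" for h and x :: real
    using that ray by (subst emeasure_density)
      (auto intro!: nn_integral_cong simp: indicator_def)
  have fin: "(\<integral>\<^sup>+y. ennreal (h y * indicator {x<..} y) \<partial>lborel) < \<infinity>"
    if "integrable lborel h" for h and x :: real
  proof -
    have "integrable lborel (\<lambda>y. h y * indicator {x<..} y)"
      using that ray by (intro integrable_real_mult_indicator) auto
    then show ?thesis using real_integrable_def[of lborel "\<lambda>y. h y * indicator {x<..} y"] by (simp add: less_top)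
  qed
  have "?M = ?N"
  proof (rule measure_eqI_lessThan)
    fix x
    show "emeasure ?M {x<..} < \<infinity>" using em[OF g] fin[OF gint] by simp
    have int: "integrable lborel (\<lambda>y. g y * indicator {x<..} y)"
      using gint ray by (intro integrable_real_mult_indicator) auto
    have "enn2real (\<integral>\<^sup>+y. ennreal (g y * indicator {x<..} y) \<partial>lborel)
        = enn2real (\<integral>\<^sup>+y. ennreal (- g y * indicator {x<..} y) \<partial>lborel)"
      using real_lebesgue_integral_def[OF int] half[of x] by simp
    moreover have "(\<integral>\<^sup>+y. ennreal (g y * indicator {x<..} y) \<partial>lborel) < \<infinity>"
      "(\<integral>\<^sup>+y. ennreal (- g y * indicator {x<..} y) \<partial>lborel) < \<infinity>"
      using fin[OF gint] fin[of "\<lambda>y. - g y"] gint by auto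
    ultimately have "(\<integral>\<^sup>+y. ennreal (g y * indicator {x<..} y) \<partial>lborel)
        = (\<integral>\<^sup>+y. ennreal (- g y * indicator {x<..} y) \<partial>lborel)"
      by (rule enn2real_inj_finite)
    then show "emeasure ?M {x<..} = emeasure ?N {x<..}"
      using em[OF g, of x] em[of "\<lambda>y. - g y" x] g by simp
  qed auto
  then have "AE x in lborel. ennreal (g x) = ennreal (- g x)"
    using g by (intro sigma_finite_measure.density_unique[OF sigma_finite_lborel]) auto
  then have "AE x in lborel. g x = 0"
  proof eventually_elim
    case (elim x)
    then show ?case
      by (cases "0 \<le> g x") (simp_all add: ennreal_neg ennreal_eq_0_iff eq_commute[of "0::ennreal"])
  qed
  with eq have "AE x in lborel. u0 x = 0" by eventually_elim simp
  then have "AE x in lebesgue. u0 x = 0" by (rule AE_completion)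
  then have "AE x in IM. u0 x = 0"
    by (subst AE_restrict_space_iff) auto
  then show ?thesis
    by (rule AE_mp) (auto simp: u0_def intro!: AE_I2)
qed

lemma prim_continuous: "g \<in> L2 \<Longrightarrow> continuous_on {-1..1} (\<lambda>x. integral {-1..x} g)"
  by (intro indefinite_integral_continuous_1 L2_integrable_on) auto

text \<open>The difference quotient at \<open>x\<close> is bounded by a multiple of \<open>A y - A x\<close>, so the derivative
  of \<open>D\<close> vanishes everywhere.\<close>
lemma constant_if_increments_small:
  fixes D A :: "real \<Rightarrow> real"
  assumes A: "continuous_on {a..b} A"
    and D: "\<And>x y. a \<le> x \<Longrightarrow> x \<le> y \<Longrightarrow> y \<le> b \<Longrightarrow> \<bar>D y - D x\<bar> \<le> C * (y - x) * (A y - A x)"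
    and ab: "a \<le> b"
  shows "D b = D a"
proof -
  have "(D has_field_derivative 0) (at x within {a..b})" if x: "x \<in> {a..b}" for x
  proof -
    have "((\<lambda>y. (D y - D x) / (y - x)) \<longlongrightarrow> 0) (at x within {a..b})"
    proof (rule Lim_null_comparison)
      have "\<bar>(D y - D x) / (y - x)\<bar> \<le> \<bar>C\<bar> * \<bar>A y - A x\<bar>" if y: "y \<in> {a..b}" "y \<noteq> x" for y
      proof -
        have "\<bar>D y - D x\<bar> \<le> \<bar>C\<bar> * \<bar>A y - A x\<bar> * \<bar>y - x\<bar>"
        proof (cases "x \<le> y")
          case True
          have "\<bar>D y - D x\<bar> \<le> \<bar>C * (y - x) * (A y - A x)\<bar>" using D[of x y] True x y by fastforce
          then show ?thesis by (simp add: abs_mult ac_simps)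
        next
          case False
          have "\<bar>D x - D y\<bar> \<le> \<bar>C * (x - y) * (A x - A y)\<bar>" using D[of y x] False x y by fastforce
          then show ?thesis by (simp add: abs_mult ac_simps abs_minus_commute)
        qed
        then show ?thesis using y by (simp add: abs_divide pos_divide_le_eq)
      qed
      then show "\<forall>\<^sub>F y in at x within {a..b}. norm ((D y - D x) / (y - x)) \<le> \<bar>C\<bar> * \<bar>A y - A x\<bar>"
        by (auto simp: eventually_at_filter intro!: always_eventually)
      have "(A \<longlongrightarrow> A x) (at x within {a..b})" using A x by (auto simp: continuous_on)
      then have "((\<lambda>y. \<bar>C\<bar> * \<bar>A y - A x\<bar>) \<longlongrightarrow> \<bar>C\<bar> * \<bar>A x - A x\<bar>) (at x within {a..b})"
        by (intro tendsto_intros)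
      then show "((\<lambda>y. \<bar>C\<bar> * \<bar>A y - A x\<bar>) \<longlongrightarrow> 0) (at x within {a..b})" by simp
    qed
    then show ?thesis by (simp add: has_field_derivative_iff)
  qed
  then obtain c where "\<forall>x\<in>{a..b}. D x = c"
    using has_field_derivative_zero_constant[of "{a..b}" D] by auto
  then show ?thesis using ab by simp
qed

text \<open>Integration by parts when only one factor is continuously differentiable and the other is
  merely a primitive. The defect of the formula over a subinterval is a sum of integrals of
  products of two increments, hence of size \<open>(y - x) * (A y - A x)\<close> with \<open>A\<close> a primitive of \<open>\<bar>g\<bar>\<close>,
  and such a defect vanishes by the preceding lemma.\<close>
lemma prim_by_parts:
  fixes \<phi> \<phi>' :: "real \<Rightarrow> real"
  assumes g: "g \<in> L2"
    and G: "\<And>x. x \<in> {-1..1} \<Longrightarrow> G x = c + integral {-1..x} g"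
    and \<phi>: "\<And>x. x \<in> {-1..1} \<Longrightarrow> (\<phi> has_real_derivative \<phi>' x) (at x within {-1..1})"
    and \<phi>': "continuous_on {-1..1} \<phi>'"
  shows "ip G \<phi>' + ip g \<phi> = G 1 * \<phi> 1 - G (-1) * \<phi> (-1)"
proof -
  have cG: "continuous_on {-1..1} G"
    using continuous_on_eq[OF continuous_on_add[OF continuous_on_const prim_continuous[OF g]], of c G] G by auto
  have c\<phi>: "continuous_on {-1..1} \<phi>"
    by (rule DERIV_continuous_on[OF \<phi>])
  have L2s: "G \<in> L2" "\<phi> \<in> L2" "\<phi>' \<in> L2" by (intro L2_continuous cG c\<phi> \<phi>')+
  have "bounded (\<phi>' ` {-1..1})" by (intro compact_imp_bounded compact_continuous_image \<phi>') auto
  then obtain L where L: "\<And>x. x \<in> {-1..1} \<Longrightarrow> \<bar>\<phi>' x\<bar> \<le> L"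
    unfolding bounded_iff by fastforce
  have L0: "L \<ge> 0" using L[of 0] by auto
  have mvt: "\<bar>\<phi> y - \<phi> x\<bar> \<le> L * (y - x)" if "-1 \<le> x" "x \<le> y" "y \<le> 1" for x y
  proof -
    have "norm (\<phi> y - \<phi> x) \<le> L * norm (y - x)"
      by (rule field_differentiable_bound[where S="{-1..1}" and f'=\<phi>']) (use that \<phi> L in auto)
    then show ?thesis using that by simp
  qed
  define h where "h t = G t * \<phi>' t + g t * \<phi> t" for t
  define D where "D x = integral {-1..x} h - G x * \<phi> x" for x
  define A where "A x = integral {-1..x} (\<lambda>t. \<bar>g t\<bar>)" for x
  have absg: "(\<lambda>t. \<bar>g t\<bar>) \<in> L2"
    using g by (auto simp: L2_def intro: borel_measurable_abs)
  have G\<phi>'L2: "(\<lambda>t. G t * \<phi>' t) \<in> L2"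
    by (intro L2_continuous continuous_on_mult cG \<phi>')
  have int_g\<phi>: "(\<lambda>t. g t * \<phi> t) integrable_on {-1..1}"
  proof -
    have "(\<lambda>t. g t * \<phi> t) absolutely_integrable_on {-1..1}"
      by (intro integrable_IM_absolutely L2_mult_integrable g \<open>\<phi> \<in> L2\<close>)
    then show ?thesis by (rule set_lebesgue_integral_eq_integral(1))
  qed
  have int_h: "h integrable_on {-1..1}"
    unfolding h_def using int_g\<phi> L2_integrable_on[OF G\<phi>'L2] by (intro integrable_add) auto
  have inc: "\<bar>D y - D x\<bar> \<le> 2 * L * (y - x) * (A y - A x)" if xy: "-1 \<le> x" "x \<le> y" "y \<le> 1" for x y
  proof -
    have Adiff: "A v - A u = integral {u..v} (\<lambda>t. \<bar>g t\<bar>)" if "x \<le> u" "u \<le> v" "v \<le> y" for u v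
      using integral_split[OF absg, of "-1" u v] that xy by (simp add: A_def)
    have Gdiff: "G v - G u = integral {u..v} g" if "x \<le> u" "u \<le> v" "v \<le> y" for u v
      using integral_split[OF g, of "-1" u v] that xy by (simp add: G)
    have mono: "\<bar>G y - G t\<bar> \<le> A y - A x" if "t \<in> {x..y}" for t
    proof -
      have "\<bar>integral {t..y} g\<bar> \<le> integral {t..y} (\<lambda>t. \<bar>g t\<bar>)"
        using that xy integral_norm_bound_integral[of g "{t..y}" "\<lambda>t. \<bar>g t\<bar>"]
        by (simp add: L2_integrable_on g absg)
      moreover have "0 \<le> integral {x..t} (\<lambda>t. \<bar>g t\<bar>)"
        using that xy by (intro Henstock_Kurzweil_Integration.integral_nonneg L2_integrable_on absg) auto
      ultimately show ?thesis
        using that Adiff[of x t] Adiff[of t y] Gdiff[of t y] by simp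
    qed
    have ihxy: "h integrable_on {x..y}" by (rule integrable_subinterval_real[OF int_h]) (use xy in auto)
    have "D y - D x = integral {x..y} h - (G y * \<phi> y - G x * \<phi> x)"
      using Henstock_Kurzweil_Integration.integral_combine[of "-1" x y h] xy
        integrable_subinterval_real[OF int_h, of "-1" y] by (simp add: D_def)
    also have "G y * \<phi> y - G x * \<phi> x = integral {x..y} (\<lambda>t. G y * \<phi>' t + \<phi> x * g t)"
    proof -
      have "(\<phi>' has_integral (\<phi> y - \<phi> x)) {x..y}"
      proof (rule fundamental_theorem_of_calculus)
        fix t assume "t \<in> {x..y}"
        then have "(\<phi> has_real_derivative \<phi>' t) (at t within {x..y})"
          using xy by (intro DERIV_subset[OF \<phi>]) auto
        then show "(\<phi> has_vector_derivative \<phi>' t) (at t within {x..y})"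
          by (simp add: has_real_derivative_iff_has_vector_derivative)
      qed (use xy in simp)
      moreover have "(g has_integral (G y - G x)) {x..y}"
        using xy L2_integrable_on[OF g, of x y] by (simp add: Gdiff integrable_integral)
      ultimately have "((\<lambda>t. G y * \<phi>' t + \<phi> x * g t) has_integral (G y * (\<phi> y - \<phi> x) + \<phi> x * (G y - G x))) {x..y}"
        by (intro has_integral_add has_integral_mult_right)
      then show ?thesis by (simp add: integral_unique algebra_simps)
    qed
    also have "integral {x..y} h - integral {x..y} (\<lambda>t. G y * \<phi>' t + \<phi> x * g t)
       = integral {x..y} (\<lambda>t. h t - (G y * \<phi>' t + \<phi> x * g t))"
      using xy by (intro Henstock_Kurzweil_Integration.integral_diff[symmetric] ihxy integrable_add
        integrable_on_mult_right L2_integrable_on g \<open>\<phi>' \<in> L2\<close>) auto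
    finally have e1: "D y - D x = integral {x..y} (\<lambda>t. h t - (G y * \<phi>' t + \<phi> x * g t))" .
    have e2: "norm (integral {x..y} (\<lambda>t. h t - (G y * \<phi>' t + \<phi> x * g t)))
        \<le> integral {x..y} (\<lambda>t. L * (A y - A x) + L * (y - x) * \<bar>g t\<bar>)"
      proof (rule integral_norm_bound_integral)
        show "(\<lambda>t. h t - (G y * \<phi>' t + \<phi> x * g t)) integrable_on {x..y}"
          using xy by (intro integrable_diff ihxy integrable_add
            integrable_on_mult_right L2_integrable_on g \<open>\<phi>' \<in> L2\<close>) auto
        show "(\<lambda>t. L * (A y - A x) + L * (y - x) * \<bar>g t\<bar>) integrable_on {x..y}"
          using xy by (intro L2_integrable_on L2_add L2_scale absg L2_const) auto
        fix t assume t: "t \<in> {x..y}"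
        have "h t - (G y * \<phi>' t + \<phi> x * g t) = (G t - G y) * \<phi>' t + g t * (\<phi> t - \<phi> x)"
          by (simp add: h_def algebra_simps)
        also have "norm \<dots> \<le> \<bar>G t - G y\<bar> * \<bar>\<phi>' t\<bar> + \<bar>g t\<bar> * \<bar>\<phi> t - \<phi> x\<bar>"
          by (simp flip: abs_mult)
        also have "\<dots> \<le> (A y - A x) * L + \<bar>g t\<bar> * (L * (y - x))"
        proof (intro add_mono mult_mono)
          show "\<bar>G t - G y\<bar> \<le> A y - A x" using mono[OF t] by simp
          show "\<bar>\<phi>' t\<bar> \<le> L" using L t xy by simp
          have "\<bar>\<phi> t - \<phi> x\<bar> \<le> L * (t - x)" using mvt[of x t] t xy by simp
          also have "\<dots> \<le> L * (y - x)" using t L0 by (intro mult_left_mono) auto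
          finally show "\<bar>\<phi> t - \<phi> x\<bar> \<le> L * (y - x)" .
          show "0 \<le> A y - A x" using mono[OF t] by linarith
        qed auto
        finally show "norm (h t - (G y * \<phi>' t + \<phi> x * g t)) \<le> L * (A y - A x) + L * (y - x) * \<bar>g t\<bar>"
          by (simp add: mult.commute)
      qed
    have e3: "integral {x..y} (\<lambda>t. L * (A y - A x) + L * (y - x) * \<bar>g t\<bar>) = 2 * L * (y - x) * (A y - A x)"
    proof -
      have "((\<lambda>t. L * (A y - A x) + L * (y - x) * \<bar>g t\<bar>) has_integral
              (y - x) * (L * (A y - A x)) + L * (y - x) * (A y - A x)) {x..y}"
      proof (intro has_integral_add has_integral_mult_right)
        show "((\<lambda>t. L * (A y - A x)) has_integral (y - x) * (L * (A y - A x))) {x..y}"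
          using has_integral_const_real[of "L * (A y - A x)" x y] xy by simp
        show "((\<lambda>t. \<bar>g t\<bar>) has_integral (A y - A x)) {x..y}"
          using xy L2_integrable_on[OF absg, of x y] by (simp add: Adiff integrable_integral)
      qed
      then show ?thesis by (simp add: integral_unique algebra_simps)
    qed
    show ?thesis using e2 unfolding e1 e3 by simp
  qed
  have "D 1 = D (-1)"
    by (rule constant_if_increments_small[where A=A and C="2*L"])
       (use inc prim_continuous[OF absg] in \<open>auto simp: A_def[abs_def]\<close>)
  then have "integral {-1..1} h = G 1 * \<phi> 1 - G (-1) * \<phi> (-1)" by (simp add: D_def)
  moreover have "ip G \<phi>' + ip g \<phi> = integral {-1..1} h"
    unfolding ip_def h_def
    using Henstock_Kurzweil_Integration.integral_add[OF L2_integrable_on[OF G\<phi>'L2, of "-1" 1] int_g\<phi>]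
    by (simp add: integral_IM_eq' L2_mult_integrable L2s g)
  ultimately show ?thesis by simp
qed

section \<open>Smooth bump functions\<close>

text \<open>The function \<open>exp (- r / ((x - a) * (b - x)))\<close>, cut off outside the interval, with the
  factors that its derivatives produce. The factors have this form because the derivative of
  \<open>1 / ((x - a) * (b - x))\<close> is a polynomial times its own square, which makes the family closed
  under differentiation.\<close>
definition bump_poly :: "real \<Rightarrow> real \<Rightarrow> real \<Rightarrow> real poly \<Rightarrow> nat \<Rightarrow> real \<Rightarrow> real" where
  "bump_poly a b r p n x = (if a < x \<and> x < b
     then poly p x * inverse ((x - a) * (b - x)) ^ n * exp (- r * inverse ((x - a) * (b - x))) else 0)"

text \<open>From \<open>u \<le> exp u\<close> at \<open>u = r * s / k\<close>, raised to the power \<open>k\<close>.\<close>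
lemma power_times_exp_bound:
  fixes s r :: real
  assumes "s > 0" "r > 0" "k > 0"
  shows "s ^ k * exp (- r * s) \<le> (real k / r) ^ k"
proof -
  have "r * s / real k \<le> exp (r * s / real k)" using exp_ge_add_one_self[of "r * s / real k"] by linarith
  then have "(r * s / real k) ^ k \<le> exp (r * s / real k) ^ k"
    using assms by (intro power_mono) auto
  also have "\<dots> = exp (r * s)" using assms by (simp flip: exp_of_nat_mult)
  finally have "(r * s / real k) ^ k * exp (- r * s) \<le> 1"
    using assms by (simp add: exp_minus field_simps)
  then have "(real k / r) ^ k * ((r * s / real k) ^ k * exp (- r * s)) \<le> (real k / r) ^ k * 1"
    using assms by (intro mult_left_mono) auto
  moreover have "(real k / r) ^ k * (r * s / real k) ^ k = s ^ k"
    using assms by (simp flip: power_mult_distrib)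
  ultimately show ?thesis by (simp add: mult.assoc[symmetric])
qed

text \<open>The exponential beats \<open>n + 2\<close> powers of \<open>1 / ((x - a) * (b - x))\<close>, two more than are
  present; the two spare powers give a quadratic zero at both end points, hence derivative zero
  there.\<close>
lemma bump_poly_bound:
  assumes "r > 0"
  obtains C where "C \<ge> 0" "\<And>x. a < x \<Longrightarrow> x < b \<Longrightarrow> \<bar>bump_poly a b r p n x\<bar> \<le> C * ((x - a) * (b - x))\<^sup>2"
proof -
  have "bounded (poly p ` {a..b})" by (intro compact_imp_bounded compact_continuous_image continuous_intros) auto
  then obtain B where B: "\<And>x. x \<in> {a..b} \<Longrightarrow> \<bar>poly p x\<bar> \<le> B" unfolding bounded_iff by fastforce
  define K where "K = (real (n + 2) / r) ^ (n + 2)"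
  have K: "K \<ge> 0" using assms by (simp add: K_def)
  show ?thesis
  proof (rule that[of "\<bar>B\<bar> * K"])
    show "\<bar>B\<bar> * K \<ge> 0" using K by simp
    fix x assume x: "a < x" "x < b"
    define D where "D = (x - a) * (b - x)"
    define s where "s = inverse D"
    have D: "D > 0" using x by (simp add: D_def)
    then have s: "s > 0" "s * D = 1" by (auto simp: s_def)
    have "s ^ n = s ^ (n + 2) * D\<^sup>2"
    proof -
      have "s ^ (n + 2) * D\<^sup>2 = s ^ n * (s * D)\<^sup>2" by (simp add: power_add power_mult_distrib power2_eq_square)
      then show ?thesis using s(2) by simp
    qed
    then have "s ^ n * exp (- r * s) = (s ^ (n + 2) * exp (- r * s)) * D\<^sup>2" by simp
    also have "\<dots> \<le> K * D\<^sup>2"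
      using power_times_exp_bound[OF s(1) assms, of "n + 2"] unfolding K_def by (intro mult_right_mono) auto
    finally have k: "s ^ n * exp (- r * s) \<le> K * D\<^sup>2" .
    have "\<bar>poly p x\<bar> \<le> \<bar>B\<bar>" using B[of x] x by simp
    then have "\<bar>poly p x\<bar> * (s ^ n * exp (- r * s)) \<le> \<bar>B\<bar> * (K * D\<^sup>2)"
      by (rule mult_mono[OF _ k]) (use s in auto)
    moreover have "\<bar>bump_poly a b r p n x\<bar> = \<bar>poly p x\<bar> * (s ^ n * exp (- r * s))"
      using x s by (simp add: bump_poly_def abs_mult D_def[symmetric] s_def[symmetric])
    ultimately show "\<bar>bump_poly a b r p n x\<bar> \<le> \<bar>B\<bar> * K * ((x - a) * (b - x))\<^sup>2"
      by (simp add: D_def mult.assoc)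
  qed
qed

lemma derivative_zero_if_quadratic_bound:
  fixes f :: "real \<Rightarrow> real"
  assumes "\<And>y. \<bar>f y\<bar> \<le> C * (y - x)\<^sup>2"
  shows "(f has_real_derivative 0) (at x)"
proof -
  have f0: "f x = 0" using assms[of x] by simp
  have "((\<lambda>y. (f y - f x) / (y - x)) \<longlongrightarrow> 0) (at x)"
  proof (rule Lim_null_comparison)
    have "\<bar>(f y - f x) / (y - x)\<bar> \<le> \<bar>C\<bar> * \<bar>y - x\<bar>" if "y \<noteq> x" for y
    proof -
      have "\<bar>f y\<bar> \<le> \<bar>C\<bar> * (y - x)\<^sup>2"
        using assms[of y] by (smt (verit) abs_ge_self mult_right_mono zero_le_power2)
      also have "\<dots> = \<bar>C\<bar> * \<bar>y - x\<bar> * \<bar>y - x\<bar>" by (simp add: power2_eq_square)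
      finally show ?thesis using that by (simp add: f0 abs_divide pos_divide_le_eq)
    qed
    then show "\<forall>\<^sub>F y in at x. norm ((f y - f x) / (y - x)) \<le> \<bar>C\<bar> * \<bar>y - x\<bar>"
      by (auto simp: eventually_at_filter)
    have "((\<lambda>y. \<bar>C\<bar> * \<bar>y - x\<bar>) \<longlongrightarrow> \<bar>C\<bar> * \<bar>x - x\<bar>) (at x)" by (intro tendsto_intros)
    then show "((\<lambda>y. \<bar>C\<bar> * \<bar>y - x\<bar>) \<longlongrightarrow> 0) (at x)" by simp
  qed
  then show ?thesis by (simp add: has_field_derivative_iff)
qed

definition bump_poly_deriv :: "real \<Rightarrow> real \<Rightarrow> real \<Rightarrow> real poly \<Rightarrow> nat \<Rightarrow> real poly" where
  "bump_poly_deriv a b r p n =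
     (let D = [:- a, 1:] * [:b, - 1:]; q = [:- (a + b), 2:]
      in pderiv p * D\<^sup>2 + smult (of_nat n) (p * q * D) - smult r (p * q))"

lemma bump_poly_has_derivative:
  assumes r: "r > 0"
  shows "(bump_poly a b r p n has_real_derivative bump_poly a b r (bump_poly_deriv a b r p n) (n + 2) x) (at x)"
proof -
  obtain C where C: "C \<ge> 0" "\<And>x. a < x \<Longrightarrow> x < b \<Longrightarrow> \<bar>bump_poly a b r p n x\<bar> \<le> C * ((x - a) * (b - x))\<^sup>2"
    using bump_poly_bound[OF r] by blast
  have Ca: "\<bar>bump_poly a b r p n y\<bar> \<le> C * (b - a)\<^sup>2 * (y - a)\<^sup>2"
   and Cb: "\<bar>bump_poly a b r p n y\<bar> \<le> C * (b - a)\<^sup>2 * (y - b)\<^sup>2" for y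
  proof -
    have "\<bar>bump_poly a b r p n y\<bar> \<le> C * (b - a)\<^sup>2 * (y - a)\<^sup>2 \<and> \<bar>bump_poly a b r p n y\<bar> \<le> C * (b - a)\<^sup>2 * (y - b)\<^sup>2"
    proof (cases "a < y \<and> y < b")
      case True
      have "((y - a) * (b - y))\<^sup>2 \<le> ((y - a) * (b - a))\<^sup>2"
        using True by (intro power_mono mult_left_mono) auto
      moreover have "((y - a) * (b - y))\<^sup>2 \<le> ((b - a) * (b - y))\<^sup>2"
        using True by (intro power_mono mult_right_mono) auto
      ultimately have "C * ((y - a) * (b - y))\<^sup>2 \<le> C * ((y - a) * (b - a))\<^sup>2"
         "C * ((y - a) * (b - y))\<^sup>2 \<le> C * ((b - a) * (b - y))\<^sup>2"
        using C(1) by (auto intro: mult_left_mono)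
      then show ?thesis using C(2)[of y] True
        by (simp add: power_mult_distrib mult.assoc power2_commute[of y b] mult.commute[of "(y-a)\<^sup>2"])
    next
      case False then show ?thesis using C(1) by (auto simp: bump_poly_def)
    qed
    then show "\<bar>bump_poly a b r p n y\<bar> \<le> C * (b - a)\<^sup>2 * (y - a)\<^sup>2" "\<bar>bump_poly a b r p n y\<bar> \<le> C * (b - a)\<^sup>2 * (y - b)\<^sup>2" by auto
  qed
  consider "x < a \<or> x > b" | "x = a" | "x = b" | "a < x \<and> x < b" by linarith
  then show ?thesis
  proof cases
    case 1
    have "open ({..<a} \<union> {b<..})" by auto
    moreover have "((\<lambda>_. 0) has_real_derivative 0) (at x)" by simp
    ultimately have "(bump_poly a b r p n has_real_derivative 0) (at x)"
      using 1 by (elim has_field_derivative_transform_within_open) (auto simp: bump_poly_def)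
    then show ?thesis using 1 by (auto simp: bump_poly_def)
  next
    case 2
    then have "bump_poly a b r q m x = 0" for q m by (simp add: bump_poly_def)
    then show ?thesis using derivative_zero_if_quadratic_bound[OF Ca] 2 by simp
  next
    case 3
    then have "bump_poly a b r q m x = 0" for q m by (simp add: bump_poly_def)
    then show ?thesis using derivative_zero_if_quadratic_bound[OF Cb] 3 by simp
  next
    case 4
    define D where "D = (\<lambda>x. (x - a) * (b - x))"
    define s where "s = (\<lambda>x. inverse (D x))"
    have Dx: "D x > 0" using 4 by (simp add: D_def)
    have sD: "s x * D x = 1" using Dx by (simp add: s_def)
    let ?q = "2 * x - a - b"
    have "(D has_real_derivative - ?q) (at x)"
      unfolding D_def by (auto intro!: derivative_eq_intros)
    then have ds: "(s has_real_derivative ?q * (s x)\<^sup>2) (at x)"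
      unfolding s_def using Dx by (auto intro!: derivative_eq_intros simp: power2_eq_square algebra_simps)
    have de: "((\<lambda>x. exp (- r * s x)) has_real_derivative - r * ?q * (s x)\<^sup>2 * exp (- r * s x)) (at x)"
      by (auto intro!: derivative_eq_intros ds)
    have dn: "((\<lambda>x. s x ^ n) has_real_derivative real n * ?q * s x ^ (n + 1)) (at x)"
      by (rule DERIV_cong[OF DERIV_power[OF ds, of n]]) (cases n; simp add: power2_eq_square)
    have dp: "((\<lambda>x. poly p x * s x ^ n * exp (- r * s x)) has_real_derivative
        (poly (pderiv p) x * s x ^ n + real n * ?q * s x ^ (n + 1) * poly p x) * exp (- r * s x)
         + (- r * ?q * (s x)\<^sup>2 * exp (- r * s x)) * (poly p x * s x ^ n)) (at x)"
      by (intro DERIV_mult dn de poly_DERIV)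
    have e1: "s x ^ n = (D x)\<^sup>2 * s x ^ (n + 2)"
    proof -
      have "(D x)\<^sup>2 * s x ^ (n + 2) = s x ^ n * (s x * D x)\<^sup>2" by (simp add: power_add power_mult_distrib power2_eq_square)
      then show ?thesis using sD by simp
    qed
    have e2: "s x ^ (n + 1) = D x * s x ^ (n + 2)"
    proof -
      have "D x * s x ^ (n + 2) = s x ^ (n + 1) * (s x * D x)" by simp
      then show ?thesis using sD by simp
    qed
    have pd: "poly (bump_poly_deriv a b r p n) x =
        poly (pderiv p) x * (D x)\<^sup>2 + real n * (poly p x * ?q * D x) - r * (poly p x * ?q)"
      by (simp add: bump_poly_deriv_def Let_def D_def algebra_simps)
    have eq: "(poly (pderiv p) x * s x ^ n + real n * ?q * s x ^ (n + 1) * poly p x) * exp (- r * s x)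
         + (- r * ?q * (s x)\<^sup>2 * exp (- r * s x)) * (poly p x * s x ^ n)
       = poly (bump_poly_deriv a b r p n) x * s x ^ (n + 2) * exp (- r * s x)"
    proof -
      have "(s x)\<^sup>2 * s x ^ n = s x ^ (n + 2)" by (simp add: power_add power2_eq_square)
      then have "(poly (pderiv p) x * s x ^ n + real n * ?q * s x ^ (n + 1) * poly p x) * exp (- r * s x)
         + (- r * ?q * (s x)\<^sup>2 * exp (- r * s x)) * (poly p x * s x ^ n)
        = (poly (pderiv p) x * s x ^ n + real n * ?q * s x ^ (n + 1) * poly p x) * exp (- r * s x)
         + (- r * ?q * exp (- r * s x)) * poly p x * s x ^ (n + 2)" by (simp add: ac_simps power2_eq_square)
      also have "\<dots> = poly (bump_poly_deriv a b r p n) x * s x ^ (n + 2) * exp (- r * s x)"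
        unfolding e1 e2 pd by (simp add: algebra_simps)
      finally show ?thesis .
    qed
    have "open {a<..<b}" by simp
    then have "(bump_poly a b r p n has_real_derivative
        poly (bump_poly_deriv a b r p n) x * s x ^ (n + 2) * exp (- r * s x)) (at x)"
      by (rule has_field_derivative_transform_within_open[OF dp[unfolded eq]])
         (use 4 in \<open>auto simp: bump_poly_def s_def D_def\<close>)
    then show ?thesis using 4 by (simp add: bump_poly_def s_def D_def)
  qed
qed

text \<open>Reduces smoothness to a class of differentiable functions that is closed under \<open>deriv\<close>.\<close>
lemma higher_deriv_differentiable:
  fixes S :: "(real \<Rightarrow> real) set"
  assumes S: "\<And>f. f \<in> S \<Longrightarrow> deriv f \<in> S" "\<And>f x. f \<in> S \<Longrightarrow> f differentiable (at x)"
  shows "f \<in> S \<Longrightarrow> (deriv ^^ k) f differentiable (at x)"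
proof -
  assume "f \<in> S"
  then have "(deriv ^^ k) f \<in> S" by (induction k) (auto intro: S)
  then show ?thesis by (rule S)
qed

text \<open>Two summands suffice: a difference of two bumps is all that the fundamental lemma needs.\<close>
definition bump_class :: "(real \<Rightarrow> real) set" where
  "bump_class = {(\<lambda>x. c * bump_poly a b r p n x + d * bump_poly a' b' r' p' n' x) |
     c a b r p n d a' b' r' p' n'. r > 0 \<and> r' > 0}"

lemma bump_class_deriv:
  assumes "f \<in> bump_class"
  shows "\<exists>g\<in>bump_class. \<forall>x. (f has_real_derivative g x) (at x)"
proof -
  obtain c a b r p n d a' b' r' p' n' where
    f: "f = (\<lambda>x. c * bump_poly a b r p n x + d * bump_poly a' b' r' p' n' x)" and r: "r > 0" "r' > 0"
    using assms unfolding bump_class_def by blast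
  let ?g = "\<lambda>x. c * bump_poly a b r (bump_poly_deriv a b r p n) (n + 2) x
     + d * bump_poly a' b' r' (bump_poly_deriv a' b' r' p' n') (n' + 2) x"
  have "?g \<in> bump_class" unfolding bump_class_def using r by blast
  moreover have "(f has_real_derivative ?g x) (at x)" for x
    unfolding f by (intro DERIV_add DERIV_cmult bump_poly_has_derivative r)
  ultimately show ?thesis by (intro bexI[of _ ?g]) auto
qed

lemma bump_class_smooth:
  assumes "f \<in> bump_class" shows "(deriv ^^ k) f differentiable (at x)"
proof (rule higher_deriv_differentiable[OF _ _ assms])
  fix g assume g: "g \<in> bump_class"
  then obtain g' where g': "g' \<in> bump_class" "\<And>x. (g has_real_derivative g' x) (at x)"
    using bump_class_deriv by blast
  then have "deriv g = g'" by (auto simp: fun_eq_iff intro: DERIV_imp_deriv)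
  with g' show "deriv g \<in> bump_class" by simp
  show "g differentiable (at y)" for y using g'(2) real_differentiable_def by blast
qed

definition bump :: "real \<Rightarrow> real \<Rightarrow> real \<Rightarrow> real \<Rightarrow> real" where
  "bump a b r x = (if a < x \<and> x < b then exp (- r * inverse ((x - a) * (b - x))) else 0)"

lemma bump_eq: "bump a b r = bump_poly a b r 1 0"
  by (simp add: fun_eq_iff bump_def bump_poly_def)

lemma bump_comb_in_class:
  assumes "r > 0" "r' > 0"
  shows "(\<lambda>x. c * bump a b r x + d * bump a' b' r' x) \<in> bump_class"
  unfolding bump_eq bump_class_def using assms by blast

lemma bump_continuous: assumes "r > 0" shows "continuous_on S (bump a b r)"
  unfolding bump_eq
  by (rule DERIV_continuous_on, rule has_field_derivative_at_within, rule bump_poly_has_derivative[OF assms])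

lemma bump_range: assumes "r > 0" shows "0 \<le> bump a b r x" "bump a b r x \<le> 1"
  using assms by (auto simp: bump_def)

lemma bump_integral_pos:
  assumes "r > 0" "-1 \<le> a" "a < b" "b \<le> 1"
  shows "integral {-1..1} (bump a b r) > 0"
proof -
  have "integral {-1..1} (bump a b r) \<noteq> 0"
  proof
    assume "integral {-1..1} (bump a b r) = 0"
    then have "\<forall>x\<in>{-1..1}. bump a b r x = 0"
      using integral_eq_0_iff[of "-1" 1 "bump a b r"] bump_continuous[OF assms(1)] bump_range[OF assms(1)] by auto
    moreover have "bump a b r ((a + b) / 2) \<noteq> 0" using assms by (simp add: bump_def)
    ultimately show False using assms by auto
  qed
  moreover have "integral {-1..1} (bump a b r) \<ge> 0"
    using bump_range[OF assms(1)] bump_continuous[OF assms(1)]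
    by (intro Henstock_Kurzweil_Integration.integral_nonneg integrable_continuous_real) auto
  ultimately show ?thesis by simp
qed

section \<open>Test functions and the fundamental lemma\<close>

lemma test_functionD:
  assumes "test_function \<phi>"
  shows "(\<phi> has_real_derivative deriv \<phi> x) (at x)" "continuous_on S (deriv \<phi>)"
    "x \<notin> Iv \<Longrightarrow> \<phi> x = 0"
proof -
  have d: "(deriv ^^ k) \<phi> differentiable (at x)" for k x
    using assms by (simp add: test_function_def)
  show "(\<phi> has_real_derivative deriv \<phi> x) (at x)"
    using d[of 0 x] by (simp add: DERIV_deriv_iff_real_differentiable)
  have "deriv \<phi> differentiable (at x)" for x using d[of 1 x] by simp
  then show "continuous_on S (deriv \<phi>)"
    by (intro continuous_at_imp_continuous_on ballI differentiable_imp_continuous_within)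
  show "\<phi> x = 0" if "x \<notin> Iv"
  proof -
    have "x \<notin> closure {x. \<phi> x \<noteq> 0}" using that assms by (auto simp: test_function_def)
    then have "x \<notin> {x. \<phi> x \<noteq> 0}" using closure_subset by (rule contra_subsetD[rotated])
    then show ?thesis by simp
  qed
qed

lemma support_imp_closure:
  fixes f :: "real \<Rightarrow> real"
  assumes "\<And>x. x \<notin> {a..b} \<Longrightarrow> f x = 0" "-1 < a" "b < 1"
  shows "closure {x. f x \<noteq> 0} \<subseteq> Iv"
proof -
  have "closure {x. f x \<noteq> 0} \<subseteq> {a..b}"
  proof (rule closure_minimal)
    show "{x. f x \<noteq> 0} \<subseteq> {a..b}" using assms(1) by blast
  qed simp
  then show ?thesis using assms(2,3) by auto
qed

lemma bump_test_function:
  assumes "r > 0" "-1 < a" "b < 1"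
  shows "test_function (bump a b r)"
  unfolding test_function_def
proof (intro conjI allI)
  have "(\<lambda>x. 1 * bump a b r x + 0 * bump a b r x) \<in> bump_class"
    using assms(1) by (intro bump_comb_in_class)
  then show "(deriv ^^ k) (bump a b r) differentiable (at x)" for k x
    using bump_class_smooth by simp
  show "closure {x. bump a b r x \<noteq> 0} \<subseteq> Iv"
    by (rule support_imp_closure[of a b]) (use assms in \<open>auto simp: bump_def\<close>)
qed

text \<open>The vanishing integral makes the primitive vanish to the right of the support as well.\<close>
lemma test_function_antiderivative:
  assumes h: "h \<in> bump_class" and supp: "\<And>x. x \<notin> {a..b} \<Longrightarrow> h x = 0" and ab: "-1 < a" "a \<le> b" "b < 1"
    and zero: "integral {-1..1} h = 0"
  obtains \<phi> where "test_function \<phi>" "deriv \<phi> = h"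
proof -
  define \<phi> where "\<phi> x = integral {-1..x} h" for x
  have cont: "continuous_on S h" for S
  proof -
    obtain g where "\<forall>x. (h has_real_derivative g x) (at x)" using bump_class_deriv[OF h] by (elim bexE)
    then have g: "(h has_real_derivative g x) (at x)" for x ..
    show ?thesis by (rule DERIV_continuous_on[OF has_field_derivative_at_within[OF g]])
  qed
  have "h integrable_on {a..b}" by (intro integrable_continuous_real cont)
  then have hi: "(h has_integral integral {a..b} h) {a..b}" by (rule integrable_integral)
  have hT: "(h has_integral integral {a..b} h) T" if "{a..b} \<subseteq> T" for T
    by (rule has_integral_on_superset[OF hi _ that]) (use supp in auto)
  have "integral {a..b} h = 0" using hT[of "{-1..1}"] zero ab by (simp add: integral_unique)
  then have right: "\<phi> x = 0" if "b < x" for x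
    using hT[of "{-1..x}"] that ab by (simp add: \<phi>_def integral_unique)
  have left: "\<phi> x = 0" if "x < a" for x
  proof -
    have "integral {-1..x} h = integral {-1..x} (\<lambda>_. 0)"
      by (rule Henstock_Kurzweil_Integration.integral_cong) (use that supp in auto)
    then show ?thesis by (simp add: \<phi>_def)
  qed
  have der: "(\<phi> has_real_derivative h x) (at x)" for x
  proof -
    consider "x < a" | "x > b" | "-1 < x" "x < 1" using ab by linarith
    then show ?thesis
    proof cases
      case 1
      then have "(\<phi> has_real_derivative 0) (at x)"
        by (intro has_field_derivative_transform_within_open[OF DERIV_const, of "{..<a}"]) (auto simp: left)
      then show ?thesis using supp[of x] 1 by simp
    next
      case 2
      then have "(\<phi> has_real_derivative 0) (at x)"
        by (intro has_field_derivative_transform_within_open[OF DERIV_const, of "{b<..}"]) (auto simp: right)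
      then show ?thesis using supp[of x] 2 by simp
    next
      case 3
      then have "((\<lambda>x. integral {-1..x} h) has_real_derivative h x) (at x within {-1..1})"
        by (intro integral_has_real_derivative[OF cont]) auto
      then show ?thesis using 3 by (simp add: \<phi>_def[abs_def] at_within_Icc_at)
    qed
  qed
  have dphi: "deriv \<phi> = h" using der by (auto simp: fun_eq_iff intro: DERIV_imp_deriv)
  have "(deriv ^^ k) \<phi> differentiable (at x)" for k x
  proof (cases k)
    case 0 then show ?thesis using der real_differentiable_def by auto
  next
    case (Suc j)
    then show ?thesis using bump_class_smooth[OF h, of j x] dphi by (simp add: funpow_swap1)
  qed
  moreover have "closure {x. \<phi> x \<noteq> 0} \<subseteq> Iv"
    by (rule support_imp_closure[of a b]) (use ab left right in auto)
  ultimately have "test_function \<phi>" by (simp add: test_function_def)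
  then show ?thesis using dphi by (rule that)
qed

lemma bump_L2: "r > 0 \<Longrightarrow> bump a b r \<in> L2"
  by (intro L2_continuous bump_continuous)

text \<open>The primitive is constant in the open interval and continuous up to the end points.\<close>
lemma AE_zero_if_integrals_zero:
  assumes u: "u \<in> L2" and int0: "\<And>a b. -1 < a \<Longrightarrow> a < b \<Longrightarrow> b < 1 \<Longrightarrow> integral {a..b} u = 0"
  shows "AE x in IM. u x = 0"
proof -
  let ?F = "\<lambda>x. integral {-1..x} u"
  have cF: "continuous_on (closure Iv) ?F" using prim_continuous[OF u] by simp
  have cst: "?F x = ?F 0" if x: "x \<in> Iv" for x
  proof (cases "x = 0")
    case False
    then show ?thesis
      using integral_split[OF u, of "-1" x 0] integral_split[OF u, of "-1" 0 x] int0[of x 0] int0[of 0 x] x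
      by (cases "x < 0") auto
  qed simp
  have e: "?F x = ?F 0" if "x \<in> {-1..1}" for x
    by (rule continuous_constant_on_closure[OF cF cst]) (use that in simp_all)
  have z: "?F 0 = 0" using e[of "-1"] by simp
  have "?F x = 0" if "x \<in> {-1..1}" for x using e[OF that] z by (rule trans)
  then show ?thesis by (rule AE_zero_if_primitive_zero[OF u])
qed

text \<open>As \<open>r\<close> tends to zero, the bumps increase to the indicator function of \<open>{a<..<b}\<close>.\<close>
lemma AE_zero_if_orthogonal_to_bumps:
  assumes u: "u \<in> L2"
    and orth: "\<And>a b r. -1 < a \<Longrightarrow> a < b \<Longrightarrow> b < 1 \<Longrightarrow> r > 0 \<Longrightarrow> ip u (bump a b r) = 0"
  shows "AE x in IM. u x = 0"
proof -
  have int0: "integral {a..b} u = 0" if ab: "-1 < a" "a < b" "b < 1" for a b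
  proof -
    have "(\<lambda>n. ip u (bump a b (inverse (real (Suc n))))) \<longlonglongrightarrow> ip u (indicator {a<..<b})"
      unfolding ip_def
    proof (rule integral_dominated_convergence[where w="\<lambda>x. \<bar>u x\<bar>"])
      have ind: "indicator {a<..<b} \<in> borel_measurable IM"
        by (intro measurable_restrict_space1 borel_measurable_indicator) auto
      then show "(\<lambda>x. u x * indicator {a<..<b} x) \<in> borel_measurable IM"
        by (rule borel_measurable_times[OF L2_measurable[OF u]])
      show "(\<lambda>x. u x * bump a b (inverse (real (Suc i))) x) \<in> borel_measurable IM" for i
        by (intro borel_measurable_times L2_measurable u bump_L2) auto
      show "integrable IM (\<lambda>x. \<bar>u x\<bar>)" using L2_integrable[OF u] by (rule integrable_abs)
      show "AE x in IM. norm (u x * bump a b (inverse (real (Suc i))) x) \<le> \<bar>u x\<bar>" for i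
      proof (rule AE_I2)
        fix x
        have "\<bar>u x\<bar> * \<bar>bump a b (inverse (real (Suc i))) x\<bar> \<le> \<bar>u x\<bar> * 1"
          using bump_range[of "inverse (real (Suc i))" a b x] by (intro mult_left_mono) auto
        then show "norm (u x * bump a b (inverse (real (Suc i))) x) \<le> \<bar>u x\<bar>" by (simp add: abs_mult)
      qed
      show "AE x in IM. (\<lambda>i. u x * bump a b (inverse (real (Suc i))) x) \<longlonglongrightarrow> u x * indicator {a<..<b} x"
      proof (rule AE_I2)
        fix x
        have "(\<lambda>i. bump a b (inverse (real (Suc i))) x) \<longlonglongrightarrow> indicator {a<..<b} x"
        proof (cases "a < x \<and> x < b")
          case True
          have "(\<lambda>i. exp (- inverse (real (Suc i)) * inverse ((x - a) * (b - x)))) \<longlonglongrightarrow> exp (- 0 * inverse ((x - a) * (b - x)))"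
            by (intro tendsto_intros LIMSEQ_inverse_real_of_nat)
          with True show ?thesis by (simp add: bump_def)
        next
          case False then show ?thesis by (auto simp: bump_def)
        qed
        then show "(\<lambda>i. u x * bump a b (inverse (real (Suc i))) x) \<longlonglongrightarrow> u x * indicator {a<..<b} x"
          by (rule tendsto_mult_left)
      qed
    qed
    moreover have "ip u (bump a b (inverse (real (Suc n)))) = 0" for n
      using ab by (intro orth) auto
    ultimately have "(\<lambda>n. 0) \<longlonglongrightarrow> ip u (indicator {a<..<b})" by simp
    then have "ip u (indicator {a<..<b}) = 0" by (simp add: LIMSEQ_const_iff)
    moreover have "ip u (indicator {a<..<b}) = integral {-1..1} (\<lambda>x. if x \<in> {a<..<b} then u x else 0)"
    proof -
      have "integrable IM (\<lambda>x. u x * indicator {a<..<b} x)"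
        using ab by (intro integrable_real_mult_indicator L2_integrable u) (auto simp: sets_restrict_space_iff)
      then have "ip u (indicator {a<..<b}) = integral {-1..1} (\<lambda>x. u x * indicator {a<..<b} x)"
        unfolding ip_def by (rule integral_IM_eq')
      also have "\<dots> = integral {-1..1} (\<lambda>x. if x \<in> {a<..<b} then u x else 0)"
        by (rule Henstock_Kurzweil_Integration.integral_cong) auto
      finally show ?thesis .
    qed
    moreover have "{a<..<b} \<inter> {-1..1} = {a<..<b}" using ab by auto
    ultimately show ?thesis
      by (simp only: integral_restrict_Int) (simp add: integral_open_interval_real)
  qed
  show ?thesis by (rule AE_zero_if_integrals_zero[OF u int0])
qed

text \<open>A combination of a bump with a fixed bump \<open>b0\<close> that has integral zero is the derivative of
  a test function. So \<open>u\<close> gives the same mean to all bumps, and \<open>u\<close> minus that mean is orthogonal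
  to them.\<close>
lemma du_Bois_Reymond:
  assumes u: "u \<in> L2" and orth: "\<And>\<phi>. test_function \<phi> \<Longrightarrow> ip u (deriv \<phi>) = 0"
  shows "\<exists>c. AE x in IM. u x = c"
proof -
  define b0 where "b0 = bump (-1/2) (1/2) 1"
  have b0L2: "b0 \<in> L2" unfolding b0_def by (rule bump_L2) simp
  have I0: "integral {-1..1} b0 > 0" unfolding b0_def by (rule bump_integral_pos) auto
  define c where "c = ip u b0 / integral {-1..1} b0"
  have one: "ip (\<lambda>x. k) f = k * integral {-1..1} f" if "f \<in> L2" for k f
    using integral_IM_eq[OF that] by (simp add: ip_def)
  have "AE x in IM. u x - c = 0"
  proof (rule AE_zero_if_orthogonal_to_bumps)
    show "(\<lambda>x. u x - c) \<in> L2" using u by (intro L2_diff) auto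
    fix a b r :: real assume *: "-1 < a" "a < b" "b < 1" "r > 0"
    define b1 where "b1 = bump a b r"
    have b1L2: "b1 \<in> L2" unfolding b1_def by (rule bump_L2) fact
    define h where "h x = integral {-1..1} b1 * b0 x + (- integral {-1..1} b0) * b1 x" for x
    have hc: "h \<in> bump_class" unfolding h_def[abs_def] b0_def b1_def using * by (intro bump_comb_in_class) auto
    have "ip (\<lambda>x. 1) h = 0"
      unfolding h_def[abs_def]
      by (subst ip_add_right) (simp_all add: ip_scale_right one b0L2 b1L2 L2_scale ip_minus_right L2_minus)
    moreover have hL2: "h \<in> L2" unfolding h_def[abs_def] by (intro L2_add L2_scale b0L2 b1L2)
    ultimately have zero: "integral {-1..1} h = 0" using one[OF hL2, of 1] by simp
    have supp: "h x = 0" if "x \<notin> {min a (-1/2)..max b (1/2)}" for x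
      using that by (auto simp: h_def b0_def b1_def bump_def min_def max_def split: if_splits)
    have "-1 < min a (-1/2)" "min a (-1/2) \<le> max b (1/2)" "max b (1/2) < 1" using * by auto
    then obtain \<phi> where "test_function \<phi>" "deriv \<phi> = h"
      using test_function_antiderivative[OF hc supp _ _ _ zero] by blast
    then have "ip u h = 0" using orth by blast
    then have "integral {-1..1} b1 * ip u b0 = integral {-1..1} b0 * ip u b1"
      unfolding h_def[abs_def] by (subst (asm) ip_add_right) (simp_all add: ip_scale_right ip_minus_right b0L2 b1L2 L2_scale L2_minus u)
    then have "ip u b1 = c * integral {-1..1} b1" using I0 by (simp add: c_def field_simps)
    then show "ip (\<lambda>x. u x - c) (bump a b r) = 0"
      by (subst ip_diff_left) (use one[OF b1L2, of c] u b1L2 in \<open>simp_all add: b1_def\<close>)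
  qed
  then show ?thesis by auto
qed

section \<open>Weak derivatives and continuous representatives\<close>

lemma has_weak_derivI:
  assumes "v \<in> L2" "g \<in> L2" "AE x in IM. v x = c + integral {-1..x} g"
  shows "has_weak_deriv v g"
  unfolding has_weak_deriv_def
proof (intro conjI allI impI assms)
  fix \<phi> assume t: "test_function \<phi>"
  let ?G = "\<lambda>x. c + integral {-1..x} g"
  have cG: "continuous_on {-1..1} ?G" by (intro continuous_on_add continuous_on_const prim_continuous assms)
  have d: "deriv \<phi> \<in> borel_measurable IM"
    by (intro continuous_imp_measurable_IM test_functionD[OF t])
  have "ip ?G (deriv \<phi>) + ip g \<phi> = ?G 1 * \<phi> 1 - ?G (-1) * \<phi> (-1)"
    by (rule prim_by_parts[OF assms(2) refl])
       (auto intro: has_field_derivative_at_within test_functionD[OF t])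
  moreover have "\<phi> 1 = 0" "\<phi> (-1) = 0" by (auto intro: test_functionD(3)[OF t])
  moreover have "ip v (deriv \<phi>) = ip ?G (deriv \<phi>)"
    using assms(3) by (rule ip_cong_AE) (auto intro: d continuous_imp_measurable_IM cG L2_measurable assms)
  ultimately show "(LINT x|IM. v x * deriv \<phi> x) = - (LINT x|IM. g x * \<phi> x)"
    by (simp add: ip_def)
qed

text \<open>Subtracting the primitive of \<open>g\<close> leaves a function with weak derivative zero.\<close>
lemma has_weak_derivD:
  assumes "has_weak_deriv v g"
  shows "\<exists>c. AE x in IM. v x = c + integral {-1..x} g"
proof -
  have L2s: "v \<in> L2" "g \<in> L2" using assms by (auto simp: has_weak_deriv_def)
  let ?G = "\<lambda>x. integral {-1..x} g"
  have GL2: "?G \<in> L2" by (intro L2_continuous prim_continuous L2s)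
  have "\<exists>c. AE x in IM. v x - ?G x = c"
  proof (rule du_Bois_Reymond)
    show "(\<lambda>x. v x - ?G x) \<in> L2" by (intro L2_diff L2s GL2)
    fix \<phi> assume t: "test_function \<phi>"
    have dL2: "deriv \<phi> \<in> L2" by (intro L2_continuous test_functionD[OF t])
    have "has_weak_deriv ?G g" by (rule has_weak_derivI[where c=0]) (use GL2 L2s in auto)
    then have "ip ?G (deriv \<phi>) = - ip g \<phi>" using t by (simp add: has_weak_deriv_def ip_def)
    moreover have "ip v (deriv \<phi>) = - ip g \<phi>" using assms t by (simp add: has_weak_deriv_def ip_def)
    ultimately show "ip (\<lambda>x. v x - ?G x) (deriv \<phi>) = 0"
      by (simp add: ip_diff_left L2s GL2 dL2)
  qed
  then obtain c where "AE x in IM. v x - ?G x = c" ..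
  then have "AE x in IM. v x = c + ?G x" by eventually_elim simp
  then show ?thesis ..
qed

lemma has_weak_deriv_unique:
  assumes "has_weak_deriv v g" "has_weak_deriv v g'"
  shows "AE x in IM. g x = g' x"
proof -
  have L2s: "g \<in> L2" "g' \<in> L2" using assms by (auto simp: has_weak_deriv_def)
  have "AE x in IM. g x - g' x = 0"
  proof (rule AE_zero_if_orthogonal_to_bumps)
    show "(\<lambda>x. g x - g' x) \<in> L2" by (intro L2_diff L2s)
    fix a b r :: real assume *: "-1 < a" "a < b" "b < 1" "r > 0"
    then have t: "test_function (bump a b r)" by (intro bump_test_function)
    have "ip g (bump a b r) = ip g' (bump a b r)"
      using assms t by (auto simp: has_weak_deriv_def ip_def)
    then show "ip (\<lambda>x. g x - g' x) (bump a b r) = 0"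
      using * by (simp add: ip_diff_left L2s bump_L2)
  qed
  then show ?thesis by eventually_elim simp
qed

lemma weak_deriv:
  assumes "has_weak_deriv v g"
  shows "has_weak_deriv v (weak_deriv v)" "AE x in IM. weak_deriv v x = g x"
proof -
  show *: "has_weak_deriv v (weak_deriv v)" unfolding weak_deriv_def using assms by (rule someI[of "has_weak_deriv v"])
  show "AE x in IM. weak_deriv v x = g x" using has_weak_deriv_unique[OF * assms] .
qed

text \<open>Two continuous functions that agree almost everywhere agree everywhere, since the integral
  of the absolute value of their difference is zero.\<close>
lemma cont_rep_eq:
  assumes w: "continuous_on {-1..1} w" and v: "AE x in IM. v x = w x" and x: "x \<in> {-1..1}"
  shows "cont_rep v x = w x"
proof -
  have "AE x in IM. w x = v x" using v by eventually_elim simp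
  with w have "\<exists>w. continuous_on {-1..1} w \<and> (AE x in IM. w x = v x)"
    by (intro exI[of _ w] conjI)
  then have "continuous_on {-1..1} (cont_rep v) \<and> (AE x in IM. cont_rep v x = v x)"
    unfolding cont_rep_def by (rule someI_ex)
  then have c: "continuous_on {-1..1} (cont_rep v)" and ae: "AE x in IM. cont_rep v x = v x" by auto
  let ?d = "\<lambda>x. \<bar>cont_rep v x - w x\<bar>"
  have cd: "continuous_on {-1..1} ?d" by (intro continuous_intros c w)
  have "AE x in IM. ?d x = 0" using ae v by eventually_elim simp
  then have "(LINT x|IM. ?d x) = (LINT x|IM. 0)"
    by (rule integral_cong_AE[OF continuous_imp_measurable_IM[OF cd], rotated]) simp
  then have "integral {-1..1} ?d = 0" using integral_IM_eq[OF L2_continuous[OF cd]] by simp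
  moreover have "integral {-1..1} ?d = 0 \<longleftrightarrow> (\<forall>x\<in>{-1..1}. ?d x = 0)"
    by (rule integral_eq_0_iff[OF cd]) simp_all
  ultimately have "?d x = 0" using x by blast
  then show ?thesis by simp
qed

lemma integral_cong_AE_IM:
  assumes "f \<in> L2" "g \<in> L2" "AE x in IM. f x = g x" "-1 \<le> a" "b \<le> 1"
  shows "integral {a..b} f = integral {a..b} g"
proof -
  have "ip f (indicator {a..b}) = ip g (indicator {a..b})"
    by (rule ip_cong_AE[OF assms(3)]) (simp_all add: L2_measurable assms(1,2))
  then show ?thesis using assms by (simp add: ip_indicator)
qed

section \<open>The space V parametrized by the second derivative\<close>

text \<open>The first derivative of the element of \<open>V\<close> with second derivative \<open>r\<close>; the condition at
  \<open>1\<close> fixes the constant of integration. Likewise \<open>state r\<close> is that element itself, normalized by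
  the condition at \<open>-1\<close>.\<close>
definition slope :: "(real \<Rightarrow> real) \<Rightarrow> real \<Rightarrow> real" where
  "slope r x = - integral {x..1} r"

definition state :: "(real \<Rightarrow> real) \<Rightarrow> real \<Rightarrow> real" where
  "state r x = integral {-1..x} (slope r)"

lemma slope_eq:
  assumes "r \<in> L2" "x \<in> {-1..1}"
  shows "slope r x = slope r (-1) + integral {-1..x} r"
  using integral_split[OF assms(1), of "-1" x 1] assms(2) by (simp add: slope_def)

lemma slope_1 [simp]: "slope r 1 = 0" by (simp add: slope_def)

lemma state_m1 [simp]: "state r (-1) = 0" by (simp add: state_def)

lemma slope_continuous: assumes "r \<in> L2" shows "continuous_on {-1..1} (slope r)"
proof -
  have "continuous_on {-1..1} (\<lambda>x. slope r (-1) + integral {-1..x} r)"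
    by (intro continuous_on_add continuous_on_const prim_continuous assms)
  then show ?thesis by (rule continuous_on_eq) (rule slope_eq[OF assms, symmetric])
qed

lemma slope_L2 [simp]: "r \<in> L2 \<Longrightarrow> slope r \<in> L2"
  by (rule L2_continuous[OF slope_continuous])

lemma state_derivative:
  assumes "r \<in> L2" "x \<in> {-1..1}"
  shows "(state r has_real_derivative slope r x) (at x within {-1..1})"
  unfolding state_def[abs_def] using assms by (intro integral_has_real_derivative slope_continuous)

lemma state_continuous: "r \<in> L2 \<Longrightarrow> continuous_on {-1..1} (state r)"
  unfolding state_def[abs_def] by (intro prim_continuous slope_L2)

lemma state_L2 [simp]: "r \<in> L2 \<Longrightarrow> state r \<in> L2"
  by (rule L2_continuous[OF state_continuous])

lemma ip_cong:
  assumes "f \<in> L2" "g \<in> L2" "\<And>x. x \<in> {-1..1} \<Longrightarrow> f x = g x" shows "ip f h = ip g h"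
  unfolding ip_def using assms(3) by (intro Bochner_Integration.integral_cong) auto

lemma slope_add: "r \<in> L2 \<Longrightarrow> s \<in> L2 \<Longrightarrow> x \<in> {-1..1} \<Longrightarrow> slope (\<lambda>x. r x + s x) x = slope r x + slope s x"
  by (simp add: slope_def L2_integrable_on Henstock_Kurzweil_Integration.integral_add)

lemma slope_diff: "r \<in> L2 \<Longrightarrow> s \<in> L2 \<Longrightarrow> x \<in> {-1..1} \<Longrightarrow> slope (\<lambda>x. r x - s x) x = slope r x - slope s x"
  by (simp add: slope_def L2_integrable_on Henstock_Kurzweil_Integration.integral_diff)

lemma slope_scale: "slope (\<lambda>x. c * r x) x = c * slope r x"
  by (simp add: slope_def)

lemma state_eq_integral:
  assumes "f \<in> L2" "\<And>x. x \<in> {-1..1} \<Longrightarrow> slope r x = f x" "x \<in> {-1..1}"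
  shows "state r x = integral {-1..x} f"
  unfolding state_def using assms by (intro Henstock_Kurzweil_Integration.integral_cong) auto

lemma state_add:
  assumes "r \<in> L2" "s \<in> L2" "x \<in> {-1..1}"
  shows "state (\<lambda>x. r x + s x) x = state r x + state s x"
proof -
  have "state (\<lambda>x. r x + s x) x = integral {-1..x} (\<lambda>x. slope r x + slope s x)"
    by (rule state_eq_integral) (use assms in \<open>auto simp: slope_add\<close>)
  then show ?thesis using assms
    by (simp add: state_def L2_integrable_on Henstock_Kurzweil_Integration.integral_add)
qed

lemma state_diff:
  assumes "r \<in> L2" "s \<in> L2" "x \<in> {-1..1}"
  shows "state (\<lambda>x. r x - s x) x = state r x - state s x"
proof -
  have "state (\<lambda>x. r x - s x) x = integral {-1..x} (\<lambda>x. slope r x - slope s x)"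
    by (rule state_eq_integral) (use assms in \<open>auto simp: slope_diff\<close>)
  then show ?thesis using assms
    by (simp add: state_def L2_integrable_on Henstock_Kurzweil_Integration.integral_diff)
qed

lemma state_scale: "state (\<lambda>x. c * r x) x = c * state r x"
  by (simp add: state_def slope_scale[abs_def])

text \<open>\<open>weak_deriv\<close> is chosen arbitrarily among functions that agree almost everywhere, so only
  \<open>cont_rep\<close> gives it values at points, and applying it twice involves a change of representative.\<close>
lemma weak_deriv_state:
  assumes r: "r \<in> L2" and y: "y \<in> L2" and ae: "AE x in IM. y x = state r x"
  shows "has_weak_deriv y (slope r)" "has_weak_deriv (slope r) r"
    "AE x in IM. weak_deriv y x = slope r x"
    "has_weak_deriv (weak_deriv y) r"
    "AE x in IM. weak_deriv (weak_deriv y) x = r x"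
    "x \<in> {-1..1} \<Longrightarrow> cont_rep (weak_deriv y) x = slope r x"
    "x \<in> {-1..1} \<Longrightarrow> cont_rep y x = state r x"
    "weak_deriv (weak_deriv y) \<in> L2"
proof -
  have inI: "AE x in IM. x \<in> Iv" by (rule AE_I2) simp
  have sl: "AE x in IM. slope r x = slope r (-1) + integral {-1..x} r"
    using inI by eventually_elim (rule slope_eq[OF r], auto)
  show 1: "has_weak_deriv y (slope r)"
    by (rule has_weak_derivI[where c=0]) (use ae r y in \<open>simp_all add: state_def\<close>)
  show "has_weak_deriv (slope r) r"
    by (rule has_weak_derivI[OF _ _ sl]) (use r in simp_all)
  show 2: "AE x in IM. weak_deriv y x = slope r x" by (rule weak_deriv(2)[OF 1])
  have wL2: "weak_deriv y \<in> L2" using weak_deriv(1)[OF 1] by (simp add: has_weak_deriv_def)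
  have "AE x in IM. weak_deriv y x = slope r (-1) + integral {-1..x} r"
    using sl 2 by eventually_elim simp
  then show 3: "has_weak_deriv (weak_deriv y) r"
    by (rule has_weak_derivI[OF wL2 r])
  show "AE x in IM. weak_deriv (weak_deriv y) x = r x" by (rule weak_deriv(2)[OF 3])
  show "weak_deriv (weak_deriv y) \<in> L2" using weak_deriv(1)[OF 3] by (simp add: has_weak_deriv_def)
  show "cont_rep (weak_deriv y) x = slope r x" if "x \<in> {-1..1}"
    by (rule cont_rep_eq[OF slope_continuous[OF r] 2 that])
  show "cont_rep y x = state r x" if "x \<in> {-1..1}"
    by (rule cont_rep_eq[OF state_continuous[OF r] ae that])
qed

lemma Sobolev_H_2: "v \<in> Sobolev_H 2 \<longleftrightarrow> (\<exists>g r. has_weak_deriv v g \<and> has_weak_deriv g r)"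
proof -
  have "Sobolev_H 2 = Sobolev_H (Suc (Suc 0))" by (simp only: numeral_2_eq_2)
  moreover have "g \<in> L2" if "has_weak_deriv v g" for v g using that by (simp add: has_weak_deriv_def)
  ultimately show ?thesis by (simp, blast)
qed

text \<open>Integrate twice. The constant \<open>g (-1)\<close> may be written as a value of \<open>g\<close> because \<open>g\<close> is
  taken to be the continuous representative of the weak derivative.\<close>
lemma H2_representation:
  assumes "v \<in> Sobolev_H 2"
  obtains r g c where "r \<in> L2" "v \<in> L2" "continuous_on {-1..1} g"
    "\<And>x. x \<in> {-1..1} \<Longrightarrow> g x = g (-1) + integral {-1..x} r"
    "AE x in IM. weak_deriv v x = g x"
    "AE x in IM. v x = c + integral {-1..x} g"
proof -
  obtain g r where gr: "has_weak_deriv v g" "has_weak_deriv g r"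
    using assms by (auto simp: Sobolev_H_2)
  then have L2s: "v \<in> L2" "g \<in> L2" "r \<in> L2" by (auto simp: has_weak_deriv_def)
  obtain c0 where c0: "AE x in IM. v x = c0 + integral {-1..x} g" using has_weak_derivD[OF gr(1)] ..
  obtain c1 where c1: "AE x in IM. g x = c1 + integral {-1..x} r" using has_weak_derivD[OF gr(2)] ..
  let ?g = "\<lambda>x. c1 + integral {-1..x} r"
  have cg: "continuous_on {-1..1} ?g"
    by (intro continuous_on_add continuous_on_const prim_continuous L2s)
  have "AE x in IM. weak_deriv v x = ?g x"
    using weak_deriv(2)[OF gr(1)] c1 by eventually_elim simp
  moreover have inI: "AE x in IM. x \<in> Iv" by (rule AE_I2) simp
  have "AE x in IM. v x = c0 + integral {-1..x} ?g"
    using c0 inI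
  proof eventually_elim
    case (elim x)
    have "integral {-1..x} g = integral {-1..x} ?g"
      by (rule integral_cong_AE_IM[OF L2s(2) L2_continuous[OF cg] c1]) (use elim in auto)
    then show ?case using elim by simp
  qed
  moreover have "?g x = ?g (-1) + integral {-1..x} r" for x by simp
  ultimately show ?thesis by (intro that[of r ?g c0] L2s cg)
qed

lemma V_space_state:
  assumes "y \<in> L2" "r \<in> L2" "AE x in IM. y x = state r x"
  shows "y \<in> V_space"
proof -
  note w = weak_deriv_state[OF assms(2,1,3)]
  have "y \<in> Sobolev_H 2" unfolding Sobolev_H_2 by (intro exI conjI) (rule w(1), rule w(2))
  then show ?thesis using w(6)[of 1] w(7)[of "-1"] by (simp add: V_space_def)
qed

text \<open>The two boundary conditions determine the two constants of integration.\<close>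
lemma V_space_representation:
  assumes "y \<in> V_space"
  obtains r where "r \<in> L2" "y \<in> L2" "AE x in IM. y x = state r x"
proof -
  have y: "y \<in> Sobolev_H 2" "cont_rep y (-1) = 0" "cont_rep (weak_deriv y) 1 = 0"
    using assms by (auto simp: V_space_def)
  obtain r g c where *: "r \<in> L2" "y \<in> L2" "continuous_on {-1..1} g"
    "\<And>x. x \<in> {-1..1} \<Longrightarrow> g x = g (-1) + integral {-1..x} r"
    "AE x in IM. weak_deriv y x = g x"
    "AE x in IM. y x = c + integral {-1..x} g"
    by (rule H2_representation[OF y(1)], rule that)
  have "g 1 = 0" using cont_rep_eq[OF *(3,5), of 1] y(3) by simp
  have gs: "g x = slope r x" if "x \<in> {-1..1}" for x
  proof -
    have "g 1 = g (-1) + integral {-1..1} r" by (rule *(4)) simp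
    then show ?thesis using *(4)[OF that] slope_eq[OF *(1) that] \<open>g 1 = 0\<close> by (simp add: slope_def)
  qed
  have "continuous_on {-1..1} (\<lambda>x. c + integral {-1..x} g)"
    by (intro continuous_on_add continuous_on_const prim_continuous L2_continuous *(3))
  from cont_rep_eq[OF this *(6), of "-1"] have "c = 0" using y(2) by simp
  have inI: "AE x in IM. x \<in> Iv" by (rule AE_I2) simp
  have "AE x in IM. y x = state r x" using *(6) inI
  proof eventually_elim
    case (elim x)
    then show ?case
      using state_eq_integral[OF L2_continuous[OF *(3)], of r x] gs \<open>c = 0\<close> by auto
  qed
  then show ?thesis by (rule that[OF *(1,2)])
qed

definition energy :: "(real \<Rightarrow> real) \<Rightarrow> real \<Rightarrow> (real \<Rightarrow> real) \<Rightarrow> (real \<Rightarrow> real) \<Rightarrow> real" where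
  "energy yd \<beta> f r = 1/2 * ((L2_norm (\<lambda>x. state r x - yd x))\<^sup>2 + \<beta> * (L2_norm (\<lambda>x. r x + f x))\<^sup>2)"

lemma cost_eq_energy:
  assumes "yd \<in> L2" "f \<in> L2" "r \<in> L2" "y \<in> L2" "AE x in IM. y x = state r x"
  shows "cost yd \<beta> f y = energy yd \<beta> f r"
proof -
  note w = weak_deriv_state[OF assms(3,4,5)]
  have "L2_norm (\<lambda>x. y x - yd x) = L2_norm (\<lambda>x. state r x - yd x)"
    by (rule L2_norm_cong_AE)
       (use assms(5) in \<open>eventually_elim, simp\<close>, intro L2_measurable L2_diff assms state_L2, intro L2_measurable L2_diff assms state_L2)
  moreover have "L2_norm (\<lambda>x. weak_deriv (weak_deriv y) x + f x) = L2_norm (\<lambda>x. r x + f x)"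
    by (rule L2_norm_cong_AE)
       (use w(5) in \<open>eventually_elim, simp\<close>, intro L2_measurable L2_add assms w(8), intro L2_measurable L2_add assms)
  ultimately show ?thesis by (simp add: cost_def energy_def)
qed

text \<open>The directional derivative of \<open>energy\<close> at \<open>r\<close> in the direction \<open>d\<close>.\<close>
definition energy_deriv :: "(real \<Rightarrow> real) \<Rightarrow> real \<Rightarrow> (real \<Rightarrow> real) \<Rightarrow> (real \<Rightarrow> real) \<Rightarrow> (real \<Rightarrow> real) \<Rightarrow> real" where
  "energy_deriv yd \<beta> f r d = ip (\<lambda>x. state r x - yd x) (state d) + \<beta> * ip (\<lambda>x. r x + f x) d"

lemma energy_along_line:
  assumes L2s: "yd \<in> L2" "f \<in> L2" "r \<in> L2" "d \<in> L2"
  shows "energy yd \<beta> f (\<lambda>x. r x + t * d x)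
    = energy yd \<beta> f r + t * energy_deriv yd \<beta> f r d
      + t\<^sup>2 * (1/2 * (ip (state d) (state d) + \<beta> * ip d d))"
proof -
  let ?a = "\<lambda>x. state r x - yd x" and ?b = "\<lambda>x. r x + f x"
  have expand: "(L2_norm (\<lambda>x. a x + t * b x))\<^sup>2 = ip a a + 2 * t * ip a b + t\<^sup>2 * ip b b"
    if "a \<in> L2" "b \<in> L2" for a b
    using that unfolding L2_norm_sq
    by (simp add: ip_linear L2_add L2_scale ip_commute[of b a] power2_eq_square algebra_simps)
  have "L2_norm (\<lambda>x. state (\<lambda>x. r x + t * d x) x - yd x) = L2_norm (\<lambda>x. ?a x + t * state d x)"
    unfolding L2_norm_def
    by (intro arg_cong[where f=sqrt] Bochner_Integration.integral_cong)
       (auto simp: state_add state_scale L2s L2_scale algebra_simps)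
  moreover have "(\<lambda>x. r x + t * d x + f x) = (\<lambda>x. ?b x + t * d x)" by (simp add: fun_eq_iff)
  moreover have "?a \<in> L2" "?b \<in> L2" "state d \<in> L2" using L2s by auto
  ultimately show ?thesis
    using expand[of ?a "state d"] expand[of ?b d] L2s
    by (simp add: energy_def energy_deriv_def) (simp add: L2_norm_sq algebra_simps)
qed

text \<open>For small \<open>t\<close> the linear term dominates; the explicit choice of \<open>t\<close> makes \<open>t * A\<close> at most
  half of \<open>- B\<close>.\<close>
lemma linear_coefficient_nonneg:
  fixes A B :: real
  assumes "\<And>t. 0 < t \<Longrightarrow> t \<le> 1 \<Longrightarrow> 0 \<le> t * B + t\<^sup>2 * A"
  shows "B \<ge> 0"
proof (rule ccontr)
  assume "\<not> B \<ge> 0"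
  then have B: "B < 0" by simp
  define t where "t = min 1 (- B / (2 * (\<bar>A\<bar> + 1)))"
  have "- B / (2 * (\<bar>A\<bar> + 1)) > 0" using B by (intro divide_pos_pos) auto
  then have t: "0 < t" "t \<le> 1" by (simp_all add: t_def)
  have "t \<le> - B / (2 * (\<bar>A\<bar> + 1))" by (simp add: t_def)
  then have "t * (2 * (\<bar>A\<bar> + 1)) \<le> - B" by (subst (asm) pos_le_divide_eq) auto
  then have "t * (\<bar>A\<bar> + 1) \<le> - B / 2" by (simp add: algebra_simps)
  moreover have "t * A \<le> t * (\<bar>A\<bar> + 1)" using t by (intro mult_left_mono) auto
  ultimately have "B + t * A < 0" using B by linarith
  then have "t * (B + t * A) < 0" using t by (simp add: mult_pos_neg)
  then show False using assms[OF t] by (simp add: power2_eq_square algebra_simps)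
qed

lemma variational_inequality:
  assumes L2s: "yd \<in> L2" "f \<in> L2" "r \<in> L2" "s \<in> L2"
    and min: "\<And>t. 0 < t \<Longrightarrow> t \<le> 1 \<Longrightarrow> energy yd \<beta> f r \<le> energy yd \<beta> f (\<lambda>x. r x + t * (s x - r x))"
  shows "energy_deriv yd \<beta> f r (\<lambda>x. s x - r x) \<ge> 0"
proof (rule linear_coefficient_nonneg)
  fix t :: real assume "0 < t" "t \<le> 1"
  from min[OF this] show "0 \<le> t * energy_deriv yd \<beta> f r (\<lambda>x. s x - r x) + t\<^sup>2 *
    (1/2 * (ip (state (\<lambda>x. s x - r x)) (state (\<lambda>x. s x - r x)) + \<beta> * ip (\<lambda>x. s x - r x) (\<lambda>x. s x - r x)))"
    using energy_along_line[OF L2s(1-3) L2_diff[OF L2s(4,3)]] by simp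
qed

section \<open>Functions with an H1 modulus of continuity\<close>

text \<open>Primitives of \<open>L2\<close> functions have this property, with \<open>M\<close> a primitive of the square of the
  derivative. Stating it through \<open>M\<close> avoids derivatives that exist only almost everywhere: it
  passes from the obstacle to the solution by enlarging the interval, and its bounds telescope
  over the cells of a mesh. Only the open interval is used for \<open>g\<close>, since the regularity argument
  gives no control at the end points.\<close>
definition H1_modulus :: "(real \<Rightarrow> real) \<Rightarrow> (real \<Rightarrow> real) \<Rightarrow> bool" where
  "H1_modulus g M \<longleftrightarrow> mono_on {-1..1} M \<and>
     (\<forall>x y. -1 < x \<longrightarrow> x \<le> y \<longrightarrow> y < 1 \<longrightarrow> (g y - g x)\<^sup>2 \<le> (y - x) * (M y - M x))"

lemma H1_modulusD:
  assumes "H1_modulus g M"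
  shows "-1 < x \<Longrightarrow> x \<le> y \<Longrightarrow> y < 1 \<Longrightarrow> (g y - g x)\<^sup>2 \<le> (y - x) * (M y - M x)"
    "-1 \<le> x \<Longrightarrow> x \<le> y \<Longrightarrow> y \<le> 1 \<Longrightarrow> M x \<le> M y"
  using assms mono_onD[of "{-1..1}" M x y] unfolding H1_modulus_def by auto

lemma H1_modulus_prim:
  assumes g: "g \<in> L2"
    and G: "\<And>x. x \<in> Iv \<Longrightarrow> G x = c + integral {-1..x} g"
  shows "H1_modulus G (\<lambda>x. integral {-1..x} (\<lambda>t. (g t)\<^sup>2))"
proof -
  have gi: "(\<lambda>t. (g t)\<^sup>2) integrable_on {a..b}" if "-1 \<le> a" "b \<le> 1" for a b
  proof -
    have "(\<lambda>t. (g t)\<^sup>2) absolutely_integrable_on {-1..1}"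
      by (intro integrable_IM_absolutely L2_sq_integrable g)
    then have "(\<lambda>t. (g t)\<^sup>2) integrable_on {-1..1}" by (rule set_lebesgue_integral_eq_integral(1))
    then show ?thesis by (rule integrable_subinterval_real) (use that in auto)
  qed
  have M: "integral {-1..y} (\<lambda>t. (g t)\<^sup>2) - integral {-1..x} (\<lambda>t. (g t)\<^sup>2) = integral {x..y} (\<lambda>t. (g t)\<^sup>2)"
    if "-1 \<le> x" "x \<le> y" "y \<le> 1" for x y
    using Henstock_Kurzweil_Integration.integral_combine[OF that(1,2) gi[OF _ that(3)]] by simp
  show ?thesis unfolding H1_modulus_def
  proof (intro conjI allI impI mono_onI)
    fix x y :: real assume "x \<in> {-1..1}" "y \<in> {-1..1}" "x \<le> y"
    moreover from this have "0 \<le> integral {x..y} (\<lambda>t. (g t)\<^sup>2)"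
      by (intro Henstock_Kurzweil_Integration.integral_nonneg gi) auto
    ultimately show "integral {-1..x} (\<lambda>t. (g t)\<^sup>2) \<le> integral {-1..y} (\<lambda>t. (g t)\<^sup>2)"
      using M[of x y] by simp
  next
    fix x y :: real assume xy: "-1 < x" "x \<le> y" "y < 1"
    have "G y - G x = integral {x..y} g"
      using integral_split[OF g, of "-1" x y] xy by (simp add: G)
    then show "(G y - G x)\<^sup>2 \<le> (y - x) * (integral {-1..y} (\<lambda>t. (g t)\<^sup>2) - integral {-1..x} (\<lambda>t. (g t)\<^sup>2))"
      using integral_Cauchy_Schwarz[OF g, of x y] xy by (simp add: M)
  qed
qed

lemma H1_modulus_add:
  assumes "H1_modulus g M" "H1_modulus h M'"
  shows "H1_modulus (\<lambda>x. g x + h x) (\<lambda>x. 2 * M x + 2 * M' x)"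
  unfolding H1_modulus_def
proof (intro conjI allI impI mono_onI)
  fix x y :: real assume "x \<in> {-1..1}" "y \<in> {-1..1}" "x \<le> y"
  then show "2 * M x + 2 * M' x \<le> 2 * M y + 2 * M' y"
    using H1_modulusD(2)[OF assms(1), of x y] H1_modulusD(2)[OF assms(2), of x y] by simp
next
  fix x y :: real assume "-1 < x" "x \<le> y" "y < 1"
  note b = H1_modulusD(1)[OF assms(1) this] H1_modulusD(1)[OF assms(2) this]
  have "(a + b)\<^sup>2 \<le> 2 * a\<^sup>2 + 2 * b\<^sup>2" for a b :: real
    using sum_squares_bound[of a b] by (simp add: power2_sum)
  from this[of "g y - g x" "h y - h x"] b
  have "(g y - g x + (h y - h x))\<^sup>2 \<le> 2 * ((y - x) * (M y - M x)) + 2 * ((y - x) * (M' y - M' x))" by linarith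
  then show "(g y + h y - (g x + h x))\<^sup>2 \<le> (y - x) * (2 * M y + 2 * M' y - (2 * M x + 2 * M' x))"
    by (simp add: algebra_simps)
qed

lemma H1_modulus_scale:
  assumes "H1_modulus g M"
  shows "H1_modulus (\<lambda>x. c * g x) (\<lambda>x. c\<^sup>2 * M x)"
  unfolding H1_modulus_def
proof (intro conjI allI impI mono_onI)
  fix x y :: real assume "x \<in> {-1..1}" "y \<in> {-1..1}" "x \<le> y"
  then show "c\<^sup>2 * M x \<le> c\<^sup>2 * M y"
    using H1_modulusD(2)[OF assms(1), of x y] by (intro mult_left_mono) auto
next
  fix x y :: real assume "-1 < x" "x \<le> y" "y < 1"
  from H1_modulusD(1)[OF assms(1) this]
  have "c\<^sup>2 * (g y - g x)\<^sup>2 \<le> c\<^sup>2 * ((y - x) * (M y - M x))" by (intro mult_left_mono) auto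
  then show "(c * g y - c * g x)\<^sup>2 \<le> (y - x) * (c\<^sup>2 * M y - c\<^sup>2 * M x)"
    by (simp only: power_mult_distrib mult.left_commute flip: right_diff_distrib)
qed

lemma H1_modulus_bound:
  assumes "H1_modulus g M" "x \<in> Iv" "y \<in> Iv"
  shows "(g y - g x)\<^sup>2 \<le> \<bar>y - x\<bar> * (M 1 - M (-1))"
proof -
  have *: "(g y - g x)\<^sup>2 \<le> (y - x) * (M 1 - M (-1))" if "x \<le> y" "x \<in> Iv" "y \<in> Iv" for x y
  proof -
    have "M y - M x \<le> M 1 - M (-1)"
      using H1_modulusD(2)[OF assms(1), of y 1] H1_modulusD(2)[OF assms(1), of "-1" x] that by auto
    then have "(y - x) * (M y - M x) \<le> (y - x) * (M 1 - M (-1))"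
      using that by (intro mult_left_mono) auto
    then show ?thesis using H1_modulusD(1)[OF assms(1), of x y] that by auto
  qed
  show ?thesis
    using *[of x y] *[of y x] assms(2,3) by (cases "x \<le> y") (auto simp: power2_commute abs_if)
qed

text \<open>The modulus makes \<open>g\<close> continuous and bounded in the open interval.\<close>
lemma H1_modulus_L2:
  assumes g: "H1_modulus g M" shows "g \<in> L2"
proof -
  let ?B = "M 1 - M (-1)"
  have B: "?B \<ge> 0" using H1_modulusD(2)[OF g, of "-1" 1] by simp
  have root: "\<bar>g y - g x\<bar> \<le> sqrt (\<bar>y - x\<bar> * ?B)" if "x \<in> Iv" "y \<in> Iv" for x y
    using H1_modulus_bound[OF g that] by (simp add: real_le_rsqrt)
  have "continuous_on Iv g"
  proof (unfold continuous_on, intro ballI)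
    fix x assume x: "x \<in> Iv"
    have "((\<lambda>y. sqrt (\<bar>y - x\<bar> * ?B)) \<longlongrightarrow> sqrt (\<bar>x - x\<bar> * ?B)) (at x within Iv)" by (intro tendsto_intros)
    then have "((\<lambda>y. sqrt (\<bar>y - x\<bar> * ?B)) \<longlongrightarrow> 0) (at x within Iv)" by simp
    then have "((\<lambda>y. g y - g x) \<longlongrightarrow> 0) (at x within Iv)"
      by (rule Lim_null_comparison[rotated])
         (auto simp: eventually_at_filter intro!: always_eventually root[OF x])
    then show "(g \<longlongrightarrow> g x) (at x within Iv)" by (simp add: LIM_zero_iff)
  qed
  then have m: "g \<in> borel_measurable IM" by (intro continuous_imp_measurable_on_sets_lebesgue) auto
  show ?thesis
  proof (rule L2_bounded[OF m])
    fix x assume x: "x \<in> Iv"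
    have "\<bar>x\<bar> * ?B \<le> 1 * ?B" using x B by (intro mult_right_mono) auto
    then have "sqrt (\<bar>x\<bar> * ?B) \<le> sqrt ?B" by simp
    moreover have "\<bar>g x - g 0\<bar> \<le> sqrt (\<bar>x\<bar> * ?B)" using root[of 0 x] x by simp
    ultimately show "\<bar>g x\<bar> \<le> \<bar>g 0\<bar> + sqrt ?B" by linarith
  qed
qed

section \<open>Regularity for the one-dimensional obstacle problem\<close>

text \<open>A derivative has no jumps: the mean value theorem turns all difference quotients into \<open>c\<close>.\<close>
lemma constant_derivative_endpoints:
  fixes N :: "real \<Rightarrow> real"
  assumes d: "\<And>x. x \<in> {a..b} \<Longrightarrow> (N has_real_derivative n x) (at x)"
    and c: "\<And>x. a < x \<Longrightarrow> x < b \<Longrightarrow> n x = c" and ab: "a < b"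
  shows "n a = c" "n b = c"
proof -
  have quot: "(N z - N y) / (z - y) = c" if yz: "a \<le> y" "y < z" "z \<le> b" for y z
  proof -
    obtain w where w: "y < w" "w < z" "N z - N y = (z - y) * n w"
      using MVT2[of y z N n] yz d by auto
    then show ?thesis using c[of w] yz by simp
  qed
  have "((\<lambda>y. (N y - N a) / (y - a)) \<longlongrightarrow> n a) (at_right a)"
    by (rule tendsto_within_subset[where S=UNIV])
       (use d[of a] ab in \<open>simp_all add: has_field_derivative_iff\<close>)
  moreover have "\<forall>\<^sub>F y in at_right a. (N y - N a) / (y - a) = c"
    using ab quot[of a] by (auto simp: eventually_at_right_field intro!: exI[of _ b])
  ultimately have "((\<lambda>y. c) \<longlongrightarrow> n a) (at_right a)" by (rule Lim_transform_eventually)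
  then show "n a = c" by (simp add: tendsto_const_iff)
  have "((\<lambda>y. (N y - N b) / (y - b)) \<longlongrightarrow> n b) (at_left b)"
    by (rule tendsto_within_subset[where S=UNIV])
       (use d[of b] ab in \<open>simp_all add: has_field_derivative_iff\<close>)
  moreover have "\<forall>\<^sub>F y in at_left b. (N y - N b) / (y - b) = c"
  proof -
    have "(N y - N b) / (y - b) = c" if "a < y" "y < b" for y
      using quot[of y b] that by (simp add: minus_divide_divide[of "N b - N y" "b - y", symmetric])
    then show ?thesis using ab by (auto simp: eventually_at_left_field intro!: exI[of _ a])
  qed
  ultimately have "((\<lambda>y. c) \<longlongrightarrow> n b) (at_left b)" by (rule Lim_transform_eventually)
  then show "n b = c" by (simp add: tendsto_const_iff)
qed

text \<open>At a contact point the difference quotients of \<open>N\<close> to the right lie below those of \<open>K\<close>,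
  those to the left lie above them, and convexity orders the left ones below the right ones. So
  all are squeezed to \<open>k\<close>.\<close>
lemma touching_derivative:
  fixes N K :: "real \<Rightarrow> real"
  assumes x: "x \<in> Iv" and touch: "N x = K x"
    and le: "\<And>x. x \<in> Iv \<Longrightarrow> N x \<le> K x"
    and convex: "\<And>a b c. -1 < a \<Longrightarrow> a < b \<Longrightarrow> b < c \<Longrightarrow> c < 1 \<Longrightarrow> (N b - N a) / (b - a) \<le> (N c - N b) / (c - b)"
    and dK: "(K has_real_derivative k) (at x)"
  shows "(N has_real_derivative k) (at x)"
  unfolding has_field_derivative_iff
proof (rule LIM_I)
  fix e :: real assume e: "e > 0"
  from dK have "((\<lambda>y. (K y - K x) / (y - x)) \<longlongrightarrow> k) (at x)" by (simp add: has_field_derivative_iff)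
  from LIM_D[OF this e] obtain s where s: "s > 0"
    "\<And>y. y \<noteq> x \<Longrightarrow> norm (y - x) < s \<Longrightarrow> norm ((K y - K x) / (y - x) - k) < e" by auto
  define \<delta> where "\<delta> = min s (min (x + 1) (1 - x))"
  have \<delta>: "\<delta> > 0" "\<delta> \<le> s" "\<delta> \<le> x + 1" "\<delta> \<le> 1 - x" using s(1) x by (auto simp: \<delta>_def)
  have up: "(N y - N x) / (y - x) < k + e" if "x < y" "y < x + \<delta>" for y
  proof -
    have "(N y - N x) / (y - x) \<le> (K y - K x) / (y - x)"
      using le[of y] that \<delta> x touch by (intro divide_right_mono) auto
    also have "\<dots> < k + e" using s(2)[of y] that \<delta> by (auto simp: abs_less_iff)
    finally show ?thesis .
  qed
  have low: "k - e < (N x - N z) / (x - z)" if "z < x" "x - \<delta> < z" for z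
  proof -
    have "(K z - K x) / (z - x) = (K x - K z) / (x - z)" by (simp add: minus_divide_divide[of "K x - K z" "x - z", symmetric])
    then have "k - e < (K x - K z) / (x - z)" using s(2)[of z] that \<delta> by (auto simp: abs_less_iff)
    also have "\<dots> \<le> (N x - N z) / (x - z)"
      using le[of z] that \<delta> x touch by (intro divide_right_mono) auto
    finally show ?thesis .
  qed
  have "norm ((N y - N x) / (y - x) - k) < e" if y: "y \<noteq> x" "norm (y - x) < \<delta>" for y
  proof (cases "x < y")
    case True
    \<comment> \<open>The point at distance \<open>\<delta>/2\<close> on the other side of \<open>x\<close> supplies the missing lower bound.\<close>
    have "(N x - N (x - \<delta>/2)) / (x - (x - \<delta>/2)) \<le> (N y - N x) / (y - x)"
      by (rule convex) (use True y \<delta> x in auto)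
    with low[of "x - \<delta>/2"] up[of y] True y \<delta> show ?thesis by auto
  next
    case False
    then have yx: "y < x" using y by simp
    have eq: "(N y - N x) / (y - x) = (N x - N y) / (x - y)" by (simp add: minus_divide_divide[of "N x - N y" "x - y", symmetric])
    have "(N x - N y) / (x - y) \<le> (N (x + \<delta>/2) - N x) / (x + \<delta>/2 - x)"
      by (rule convex) (use yx y \<delta> x in auto)
    with low[of y] up[of "x + \<delta>/2"] yx y \<delta> show ?thesis unfolding eq by auto
  qed
  then show "\<exists>s>0. \<forall>y. y \<noteq> x \<and> norm (y - x) < s \<longrightarrow> norm ((N y - N x) / (y - x) - k) < e"
    using \<delta>(1) by blast
qed

lemma affine_interval:
  fixes N :: "real \<Rightarrow> real"
  assumes eq: "\<And>b. a < b \<Longrightarrow> b < c \<Longrightarrow> (N b - N a) / (b - a) = (N c - N b) / (c - b)"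
    and b: "a < b" "b < c"
  shows "N b = N a + (N c - N a) / (c - a) * (b - a)"
proof -
  have "(N b - N a) * (c - b) = (N c - N b) * (b - a)"
    using eq[OF b] b by (simp add: frac_eq_eq)
  then have "(N b - N a) * (c - a) = (N c - N a) * (b - a)" by (simp add: algebra_simps)
  then show ?thesis using b by (simp add: field_simps)
qed

text \<open>On an interval without contact \<open>N\<close> is affine, and at a contact point its derivative is
  that of \<open>K\<close>. So the derivative \<open>n\<close> of \<open>N\<close> takes at \<open>x\<close> and \<open>y\<close> the values of \<open>k\<close> at the first
  and the last contact point between them, and passing from these points to \<open>x\<close> and \<open>y\<close> only
  enlarges the bound.\<close>
lemma obstacle_regularity:
  fixes N K k M :: "real \<Rightarrow> real"
  assumes le: "\<And>x. x \<in> Iv \<Longrightarrow> N x \<le> K x"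
    and cN: "continuous_on Iv N" and cK: "continuous_on Iv K"
    and convex: "\<And>a b c. -1 < a \<Longrightarrow> a < b \<Longrightarrow> b < c \<Longrightarrow> c < 1 \<Longrightarrow> (N b - N a) / (b - a) \<le> (N c - N b) / (c - b)"
    and affine: "\<And>a b c. -1 < a \<Longrightarrow> a < b \<Longrightarrow> b < c \<Longrightarrow> c < 1 \<Longrightarrow> (\<And>x. x \<in> {a..c} \<Longrightarrow> N x < K x) \<Longrightarrow>
       (N b - N a) / (b - a) = (N c - N b) / (c - b)"
    and dK: "\<And>x. x \<in> Iv \<Longrightarrow> (K has_real_derivative k x) (at x)"
    and k: "H1_modulus k M"
  shows "\<exists>n. (\<forall>x\<in>Iv. (N has_real_derivative n x) (at x)) \<and> H1_modulus n M"
proof -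
  \<comment> \<open>Around a point off the contact set the derivative exists and is constant.\<close>
  have free: "\<exists>\<delta> \<sigma>. \<delta> > 0 \<and> (\<forall>y. \<bar>y - x\<bar> < \<delta> \<longrightarrow> (N has_real_derivative \<sigma>) (at y))"
    if x: "x \<in> Iv" "N x < K x" for x
  proof -
    let ?O = "Iv \<inter> (\<lambda>y. K y - N y) -` {0<..}"
    have "open ?O" by (intro continuous_open_preimage continuous_on_diff cK cN) auto
    moreover have "x \<in> ?O" using x by simp
    ultimately obtain e where e: "e > 0" "ball x e \<subseteq> ?O" by (rule openE)
    define \<delta> where "\<delta> = e / 2"
    have \<delta>: "\<delta> > 0" "\<And>y. \<bar>y - x\<bar> \<le> \<delta> \<Longrightarrow> y \<in> Iv \<and> N y < K y"
      using e by (auto simp: \<delta>_def dist_real_def abs_minus_commute subset_iff)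
    let ?a = "x - \<delta>" and ?c = "x + \<delta>"
    define \<sigma> where "\<sigma> = (N ?c - N ?a) / (?c - ?a)"
    have ac: "-1 < ?a" "?c < 1" using \<delta>(2)[of ?a] \<delta>(2)[of ?c] \<delta>(1) by auto
    have lin: "N y = N ?a + \<sigma> * (y - ?a)" if "\<bar>y - x\<bar> < \<delta>" for y
      unfolding \<sigma>_def
    proof (rule affine_interval)
      fix b assume b: "?a < b" "b < ?c"
      show "(N b - N ?a) / (b - ?a) = (N ?c - N b) / (?c - b)"
        using b ac \<delta>(2) by (intro affine) (auto simp: abs_le_iff)
    qed (use that in auto)
    have "(N has_real_derivative \<sigma>) (at y)" if y: "\<bar>y - x\<bar> < \<delta>" for y
    proof (rule has_field_derivative_transform_within_open[where S="{?a<..<?c}"])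
      show "((\<lambda>y. N ?a + \<sigma> * (y - ?a)) has_real_derivative \<sigma>) (at y)"
        by (auto intro!: derivative_eq_intros)
      show "N ?a + \<sigma> * (z - ?a) = N z" if "z \<in> {?a<..<?c}" for z
        using lin[of z] that by (simp add: abs_less_iff)
    qed (use y in auto)
    with \<delta>(1) show ?thesis by blast
  qed
  have "\<exists>d. (N has_real_derivative d) (at x)" if x: "x \<in> Iv" for x
  proof (cases "N x = K x")
    case True
    show ?thesis by (rule exI, rule touching_derivative[OF x True le convex dK[OF x]])
  next
    case False
    then have "N x < K x" using le[OF x] by simp
    from free[OF x this] obtain \<delta> \<sigma> where "\<delta> > 0" "\<forall>y. \<bar>y - x\<bar> < \<delta> \<longrightarrow> (N has_real_derivative \<sigma>) (at y)"
      by (elim exE conjE)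
    then show ?thesis by (intro exI[of _ \<sigma>]) simp
  qed
  then have "\<exists>n. \<forall>x\<in>Iv. (N has_real_derivative n x) (at x)" by (intro bchoice ballI)
  then obtain n where n': "\<forall>x\<in>Iv. (N has_real_derivative n x) (at x)" by (elim exE)
  have n: "(N has_real_derivative n x) (at x)" if "x \<in> Iv" for x using n' that by (rule bspec)
  have contact: "n x = k x" if "x \<in> Iv" "N x = K x" for x
    by (rule DERIV_unique[OF n[OF that(1)] touching_derivative[OF that le convex dK[OF that(1)]]])
  have dn: "(n has_real_derivative 0) (at x)" if x: "x \<in> Iv" "N x < K x" for x
  proof -
    from free[OF x] obtain \<delta> \<sigma> where
      \<delta>: "\<delta> > 0" "\<forall>y. \<bar>y - x\<bar> < \<delta> \<longrightarrow> (N has_real_derivative \<sigma>) (at y)"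
      by (elim exE conjE)
    have "n y = \<sigma>" if "y \<in> {x - \<delta><..<x + \<delta>} \<inter> Iv" for y
    proof (rule DERIV_unique[OF n])
      show "(N has_real_derivative \<sigma>) (at y)" using that by (intro \<delta>(2)[rule_format]) (auto simp: abs_less_iff)
    qed (use that in simp)
    then show ?thesis
      using x \<delta>(1) by (intro has_field_derivative_transform_within_open[OF DERIV_const, where S="{x - \<delta><..<x + \<delta>} \<inter> Iv"]) auto
  qed
  have const: "n a = n b" if ab: "-1 < a" "a \<le> b" "b < 1" "\<And>x. a < x \<Longrightarrow> x < b \<Longrightarrow> N x < K x" for a b
  proof (cases "a = b")
    case False
    then have lt: "a < b" using ab by simp
    have "\<exists>c. \<forall>x\<in>{a<..<b}. n x = c"
    proof (rule has_field_derivative_zero_constant)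
      fix x assume "x \<in> {a<..<b}"
      then have "x \<in> Iv" "N x < K x" using ab by auto
      from dn[OF this] show "(n has_real_derivative 0) (at x within {a<..<b})"
        by (rule has_field_derivative_at_within)
    qed simp
    then obtain c where "\<And>x. a < x \<Longrightarrow> x < b \<Longrightarrow> n x = c" by auto
    moreover have "(N has_real_derivative n x) (at x)" if "x \<in> {a..b}" for x
      using that ab by (intro n) auto
    ultimately show ?thesis
      using constant_derivative_endpoints[of a b N n c] lt by auto
  qed simp
  have mod: "H1_modulus n M"
    unfolding H1_modulus_def
  proof (intro conjI allI impI)
    show "mono_on {-1..1} M" using k by (simp add: H1_modulus_def)
    fix x y :: real assume xy: "-1 < x" "x \<le> y" "y < 1"
    show "(n y - n x)\<^sup>2 \<le> (y - x) * (M y - M x)"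
    proof (cases "\<exists>z\<in>{x..y}. N z = K z")
      case False
      have "n x = n y"
      proof (rule const)
        fix z assume z: "x < z" "z < y"
        have "N z \<le> K z" using z xy by (intro le) auto
        moreover have "N z \<noteq> K z" using False z by auto
        ultimately show "N z < K z" by simp
      qed (use xy in auto)
      then show ?thesis using H1_modulusD(2)[OF k, of x y] xy by simp
    next
      case True
      \<comment> \<open>The contact set between \<open>x\<close> and \<open>y\<close> is compact, so it has a first and a last point.\<close>
      define Z where "Z = {z \<in> {x..y}. K z - N z = 0}"
      have "continuous_on {x..y} (\<lambda>z. K z - N z)"
        by (rule continuous_on_subset[OF continuous_on_diff[OF cK cN]]) (use xy in auto)
      then have "closed Z" unfolding Z_def by (intro continuous_closed_preimage_constant) auto
      moreover have "bounded Z" by (rule bounded_subset[of "{x..y}"]) (auto simp: Z_def)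
      ultimately have Z: "compact Z" "Z \<noteq> {}" using True by (auto simp: compact_eq_bounded_closed Z_def)
      obtain x1 where x1: "x1 \<in> Z" "\<And>z. z \<in> Z \<Longrightarrow> x1 \<le> z" using compact_attains_inf[OF Z] by blast
      obtain y1 where y1: "y1 \<in> Z" "\<And>z. z \<in> Z \<Longrightarrow> z \<le> y1" using compact_attains_sup[OF Z] by blast
      have b: "x \<le> x1" "x1 \<le> y1" "y1 \<le> y" using x1 y1 by (auto simp: Z_def)
      have off: "N z < K z" if "z \<in> {x..y}" "z \<notin> Z" for z
      proof -
        have "N z \<le> K z" using that xy by (intro le) auto
        then show ?thesis using that by (auto simp: Z_def)
      qed
      have "n x = n x1"
      proof (rule const)
        fix z assume "x < z" "z < x1"
        then show "N z < K z" using x1(2)[of z] b by (intro off) auto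
      qed (use xy b in auto)
      moreover have "n y1 = n y"
      proof (rule const)
        fix z assume "y1 < z" "z < y"
        then show "N z < K z" using y1(2)[of z] b by (intro off) auto
      qed (use xy b in auto)
      moreover have "n x1 = k x1" "n y1 = k y1"
        using x1(1) y1(1) xy by (auto simp: Z_def intro!: contact)
      ultimately have "(n y - n x)\<^sup>2 = (k y1 - k x1)\<^sup>2" by simp
      also have "\<dots> \<le> (y1 - x1) * (M y1 - M x1)" using b xy by (intro H1_modulusD(1)[OF k]) auto
      also have "\<dots> \<le> (y - x) * (M y - M x)"
        using H1_modulusD(2)[OF k, of x x1] H1_modulusD(2)[OF k, of y1 y] H1_modulusD(2)[OF k, of x1 y1] b xy
        by (intro mult_mono) auto
      finally show ?thesis .
    qed
  qed
  show ?thesis by (intro exI[of _ n] conjI n' mod)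
qed

section \<open>Regularity of the minimizer\<close>

text \<open>\<open>state\<close> inverts the second derivative with the boundary conditions of \<open>V\<close>, which are
  self-adjoint: both inner products equal \<open>- ip (slope u) (slope d)\<close>.\<close>
lemma state_self_adjoint:
  assumes u: "u \<in> L2" and d: "d \<in> L2"
  shows "ip u (state d) = ip (state u) d"
proof -
  have parts: "ip (slope u) (slope d) + ip u (state d) = 0" if "u \<in> L2" "d \<in> L2" for u d
  proof -
    have "ip (slope u) (slope d) + ip u (state d)
        = slope u 1 * state d 1 - slope u (-1) * state d (-1)"
      by (rule prim_by_parts[OF that(1)])
         (rule slope_eq[OF that(1)], assumption, rule state_derivative[OF that(2)], assumption,
          rule slope_continuous[OF that(2)])
    then show ?thesis by simp
  qed
  show ?thesis
    using parts[OF u d] parts[OF d u] by (simp add: ip_commute[of "slope d"] ip_commute[of d])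
qed

text \<open>The Riesz representative of the derivative. Besides \<open>\<beta> * r\<close> it contains only \<open>\<beta> * f\<close> and a
  term with square-integrable second derivative, so its regularity decides that of \<open>r\<close>.\<close>
lemma energy_deriv_eq_ip:
  assumes "yd \<in> L2" "f \<in> L2" "r \<in> L2" "d \<in> L2"
  shows "energy_deriv yd \<beta> f r d
    = ip (\<lambda>x. state (\<lambda>x. state r x - yd x) x + \<beta> * (r x + f x)) d"
  using assms by (simp add: energy_deriv_def ip_add_left ip_scale_left L2_scale L2_add L2_diff
    state_self_adjoint)

text \<open>Minimality is required only along the segment towards \<open>s\<close>, and \<open>S\<close> is the set of points at
  which the constraint is imposed. This covers both the continuous problem, with \<open>S\<close> the open
  interval, and the discrete one, with \<open>S\<close> the set of nodes.\<close>
lemma obstacle_variational_inequality: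
  assumes L2s: "yd \<in> L2" "f \<in> L2" "r \<in> L2" "s \<in> L2"
    and adm: "\<And>x. x \<in> S \<Longrightarrow> slope r x \<le> P x" "\<And>x. x \<in> S \<Longrightarrow> slope s x \<le> P x" "S \<subseteq> {-1..1}"
    and min: "\<And>t. 0 < t \<Longrightarrow> t \<le> 1 \<Longrightarrow> (\<And>x. x \<in> S \<Longrightarrow> slope (\<lambda>x. r x + t * (s x - r x)) x \<le> P x) \<Longrightarrow>
        energy yd \<beta> f r \<le> energy yd \<beta> f (\<lambda>x. r x + t * (s x - r x))"
  shows "energy_deriv yd \<beta> f r (\<lambda>x. s x - r x) \<ge> 0"
proof (rule variational_inequality[OF L2s])
  fix t :: real assume t: "0 < t" "t \<le> 1"
  show "energy yd \<beta> f r \<le> energy yd \<beta> f (\<lambda>x. r x + t * (s x - r x))"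
  proof (rule min[OF t])
    fix x assume x: "x \<in> S"
    have "x \<in> {-1..1}" using x adm(3) by blast
    then have "slope (\<lambda>x. r x + t * (s x - r x)) x = slope r x + t * (slope s x - slope r x)"
      using L2s by (simp add: slope_add slope_scale slope_diff L2_scale L2_diff)
    also have "\<dots> = (1 - t) * slope r x + t * slope s x" by (simp add: algebra_simps)
    also have "\<dots> \<le> (1 - t) * P x + t * P x"
      using t adm(1,2)[OF x] by (intro add_mono mult_left_mono) auto
    finally show "slope (\<lambda>x. r x + t * (s x - r x)) x \<le> P x" by (simp add: algebra_simps)
  qed
qed

lemma integral_indicator_tail:
  assumes "b \<le> (1::real)"
  shows "integral {x..1} (indicator {a..b} :: real \<Rightarrow> real) = max 0 (b - max a x)"
  using integral_indicator_interval[of x 1 a b] assms by (simp add: max.commute min_absorb2)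

text \<open>The slope is the piecewise linear hat function that rises from \<open>0\<close> at \<open>a\<close> to \<open>1\<close> at \<open>b\<close>
  and falls to \<open>0\<close> at \<open>c\<close>. Subtracting it keeps the constraint, and a small multiple of it may be
  added off the contact set.\<close>
lemma hat_slope:
  fixes a b c x :: real
  defines "d \<equiv> \<lambda>x. inverse (b - a) * indicator {a..b} x - inverse (c - b) * indicator {b..c} x"
  assumes abc: "-1 \<le> a" "a < b" "b < c" "c \<le> 1" and x: "-1 \<le> x"
  shows "0 \<le> slope d x" "slope d x \<le> 1" "x \<notin> {a..c} \<Longrightarrow> slope d x = 0"
proof -
  let ?u = "inverse (b - a) * max 0 (b - max a x)" and ?v = "inverse (c - b) * max 0 (c - max b x)"
  have i: "(indicator {p..q} :: real \<Rightarrow> real) integrable_on {x..1}" for p q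
    using x by (intro L2_integrable_on) auto
  have d: "slope d x = ?v - ?u"
    unfolding slope_def d_def
    using x abc by (subst Henstock_Kurzweil_Integration.integral_diff)
      (auto intro!: integrable_on_mult_right i simp: integral_indicator_tail)
  have u: "0 \<le> ?u" "?u \<le> 1" "x \<le> a \<Longrightarrow> ?u = 1" "b \<le> x \<Longrightarrow> ?u = 0"
  proof -
    have "?u \<le> inverse (b - a) * (b - a)" using abc by (intro mult_left_mono) auto
    then show "?u \<le> 1" using abc by simp
  qed (use abc in \<open>auto simp: max_def\<close>)
  have v: "0 \<le> ?v" "?v \<le> 1" "x \<le> b \<Longrightarrow> ?v = 1" "c \<le> x \<Longrightarrow> ?v = 0"
  proof -
    have "?v \<le> inverse (c - b) * (c - b)" using abc by (intro mult_left_mono) auto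
    then show "?v \<le> 1" using abc by simp
  qed (use abc in \<open>auto simp: max_def\<close>)
  have "0 \<le> slope d x \<and> slope d x \<le> 1 \<and> (x \<notin> {a..c} \<longrightarrow> slope d x = 0)"
  proof (cases "x \<le> b")
    case True
    then show ?thesis using u v(3) unfolding d by auto
  next
    case False
    then have "b \<le> x" "\<not> x \<le> a" using abc by auto
    then show ?thesis using u(4) v unfolding d by auto
  qed
  then show "0 \<le> slope d x" "slope d x \<le> 1" "x \<notin> {a..c} \<Longrightarrow> slope d x = 0" by auto
qed

text \<open>With \<open>m\<close> the representative of the derivative, \<open>N\<close> is its primitive and \<open>K\<close> is the
  obstacle for \<open>N\<close> obtained by subtracting from \<open>\<beta> * P\<close> the part of \<open>\<beta> * slope r\<close> that does not
  come from \<open>m\<close>. Then \<open>K - N = \<beta> * (P - slope r)\<close>, so both problems have the same contact set. The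
  derivative of \<open>K\<close> is a primitive of \<open>\<beta> * \<psi>2 + slope u + \<beta> * f1\<close>, where \<open>u = state r - yd\<close>.\<close>
lemma minimizer_regularity:
  assumes L2s: "yd \<in> L2" "f \<in> L2" "r \<in> L2" "f1 \<in> L2" "\<psi>2 \<in> L2" and \<beta>: "\<beta> > 0"
    and f0: "AE x in IM. f x = cf + integral {-1..x} f1"
    and P: "\<And>x. x \<in> {-1..1} \<Longrightarrow> P x = cP + integral {-1..x} \<psi>1"
    and \<psi>1: "\<And>x. x \<in> {-1..1} \<Longrightarrow> \<psi>1 x = c\<psi> + integral {-1..x} \<psi>2"
    and adm: "\<And>x. x \<in> Iv \<Longrightarrow> slope r x \<le> P x"
    and min: "\<And>s. s \<in> L2 \<Longrightarrow> (\<And>x. x \<in> Iv \<Longrightarrow> slope s x \<le> P x) \<Longrightarrow> energy yd \<beta> f r \<le> energy yd \<beta> f s"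
  obtains n Mn r' Mr where "H1_modulus n Mn" "\<And>d. d \<in> L2 \<Longrightarrow> energy_deriv yd \<beta> f r d = ip n d"
    "H1_modulus r' Mr" "AE x in IM. r x = r' x"
proof -
  define u where "u x = state r x - yd x" for x
  have uL2: "u \<in> L2" unfolding u_def[abs_def] using L2s by (intro L2_diff state_L2)
  define m where "m x = state u x + \<beta> * (r x + f x)" for x
  have mL2: "m \<in> L2" unfolding m_def[abs_def] using L2s uL2 by (intro L2_add L2_scale state_L2)
  have deriv_m: "energy_deriv yd \<beta> f r d = ip m d" if "d \<in> L2" for d
    using energy_deriv_eq_ip[OF L2s(1-3) that] by (simp add: m_def[abs_def] u_def[abs_def])
  have vi: "ip m (\<lambda>x. s x - r x) \<ge> 0" if s: "s \<in> L2" "\<And>x. x \<in> Iv \<Longrightarrow> slope s x \<le> P x" for s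
  proof -
    have "energy_deriv yd \<beta> f r (\<lambda>x. s x - r x) \<ge> 0"
      by (rule obstacle_variational_inequality[where S=Iv and P=P])
         (use L2s s adm in \<open>auto intro!: min L2_add L2_scale L2_diff\<close>)
    then show ?thesis using deriv_m s(1) L2s by (simp add: L2_diff)
  qed
  define f0' where "f0' x = cf + integral {-1..x} f1" for x
  have cf0': "continuous_on {-1..1} f0'"
    unfolding f0'_def[abs_def] using L2s by (intro continuous_on_add continuous_on_const prim_continuous)
  have f0'L2: "f0' \<in> L2" by (rule L2_continuous[OF cf0'])
  have ff0: "AE x in IM. f x = f0' x" using f0 by (simp add: f0'_def)
  have c\<psi>1: "continuous_on {-1..1} \<psi>1"
  proof -
    have "continuous_on {-1..1} (\<lambda>x. c\<psi> + integral {-1..x} \<psi>2)"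
      using L2s by (intro continuous_on_add continuous_on_const prim_continuous)
    then show ?thesis by (rule continuous_on_eq) (rule \<psi>1[symmetric])
  qed
  define N where "N x = integral {-1..x} m" for x
  define w where "w x = state u x + \<beta> * f0' x" for x
  have cw: "continuous_on {-1..1} w"
    unfolding w_def[abs_def] by (intro continuous_on_add continuous_on_mult continuous_on_const state_continuous uL2 cf0')
  define k where "k x = \<beta> * \<psi>1 x + w x" for x
  have ck: "continuous_on {-1..1} k"
    unfolding k_def[abs_def] by (intro continuous_on_add continuous_on_mult continuous_on_const c\<psi>1 cw)
  define K where "K x = \<beta> * (cP - slope r (-1)) + integral {-1..x} k" for x
  have N_eq: "N x = \<beta> * slope r x - \<beta> * slope r (-1) + integral {-1..x} w" if x: "x \<in> {-1..1}" for x
  proof -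
    have "N x = integral {-1..x} (\<lambda>t. \<beta> * r t + w t)"
      unfolding N_def
    proof (rule integral_cong_AE_IM[OF mL2])
      show "(\<lambda>t. \<beta> * r t + w t) \<in> L2" by (intro L2_add L2_scale L2s L2_continuous cw)
      show "AE x in IM. m x = \<beta> * r x + w x"
        using ff0 by eventually_elim (simp add: m_def w_def algebra_simps)
    qed (use x in auto)
    also have "\<dots> = \<beta> * integral {-1..x} r + integral {-1..x} w"
      using x by (subst Henstock_Kurzweil_Integration.integral_add)
        (auto intro!: integrable_on_mult_right L2_integrable_on L2s L2_continuous cw)
    finally show ?thesis using slope_eq[OF L2s(3) x] by (simp add: algebra_simps)
  qed
  have K_eq: "K x = \<beta> * P x - \<beta> * slope r (-1) + integral {-1..x} w" if x: "x \<in> {-1..1}" for x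
  proof -
    have "integral {-1..x} k = \<beta> * integral {-1..x} \<psi>1 + integral {-1..x} w"
      unfolding k_def[abs_def] using x by (subst Henstock_Kurzweil_Integration.integral_add)
        (auto intro!: integrable_on_mult_right L2_integrable_on L2_continuous c\<psi>1 cw)
    then show ?thesis using P[OF x] by (simp add: K_def algebra_simps)
  qed
  have NK: "K x - N x = \<beta> * (P x - slope r x)" if "x \<in> {-1..1}" for x
    using N_eq[OF that] K_eq[OF that] by (simp add: algebra_simps)
  define hat where "hat a b c x = inverse (b - a) * indicator {a..b} x - inverse (c - b) * indicator {b..c} x"
    for a b c x :: real
  have hatL2: "hat a b c \<in> L2" for a b c unfolding hat_def[abs_def] by (intro L2_diff L2_scale L2_indicator)
  have ip_hat: "ip m (hat a b c) = (N b - N a) / (b - a) - (N c - N b) / (c - b)"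
    if "-1 < a" "a < b" "b < c" "c < 1" for a b c
  proof -
    have "ip m (indicator {p..q}) = N q - N p" if "-1 \<le> p" "p \<le> q" "q \<le> 1" for p q
      using ip_indicator[OF mL2, of p q] integral_split[OF mL2, of "-1" p q] that by (simp add: N_def)
    then show ?thesis
      unfolding hat_def[abs_def] using that mL2
      by (subst ip_diff_right) (auto simp: ip_scale_right L2_scale divide_inverse mult.commute)
  qed
  have hat_slope': "0 \<le> slope (hat a b c) x" "slope (hat a b c) x \<le> 1" "x \<notin> {a..c} \<Longrightarrow> slope (hat a b c) x = 0"
    if "-1 < a" "a < b" "b < c" "c < 1" "x \<in> Iv" for a b c x
  proof -
    have eq: "hat a b c = (\<lambda>x. inverse (b - a) * indicator {a..b} x - inverse (c - b) * indicator {b..c} x)"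
      by (rule ext) (rule hat_def)
    have "-1 \<le> a" "c \<le> 1" "-1 \<le> x" using that by auto
    note h = hat_slope[OF this(1) that(2,3) this(2,3), folded eq]
    show "0 \<le> slope (hat a b c) x" by (rule h(1))
    show "slope (hat a b c) x \<le> 1" by (rule h(2))
    show "slope (hat a b c) x = 0" if "x \<notin> {a..c}" using that by (rule h(3))
  qed
  have convex: "(N b - N a) / (b - a) \<le> (N c - N b) / (c - b)" if abc: "-1 < a" "a < b" "b < c" "c < 1" for a b c
  proof -
    have "ip m (\<lambda>x. (r x - hat a b c x) - r x) \<ge> 0"
    proof (rule vi)
      show "(\<lambda>x. r x - hat a b c x) \<in> L2" by (intro L2_diff L2s hatL2)
      show "slope (\<lambda>x. r x - hat a b c x) x \<le> P x" if "x \<in> Iv" for x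
      proof -
        have "x \<in> {-1..1}" using that by auto
        then have "slope (\<lambda>x. r x - hat a b c x) x = slope r x - slope (hat a b c) x"
          by (intro slope_diff L2s hatL2)
        then show ?thesis using adm[OF that] hat_slope'(1)[OF abc that] by simp
      qed
    qed
    then have "- ip m (hat a b c) \<ge> 0" by (simp add: ip_minus_right)
    then show ?thesis using ip_hat[OF abc] by simp
  qed
  define Mn where "Mn x = integral {-1..x} (\<lambda>t. (\<beta> * \<psi>2 t + (slope u t + \<beta> * f1 t))\<^sup>2)" for x
  have "\<exists>n. (\<forall>x\<in>Iv. (N has_real_derivative n x) (at x)) \<and> H1_modulus n Mn"
  proof (rule obstacle_regularity)
    show "N x \<le> K x" if "x \<in> Iv" for x
    proof -
      have "0 \<le> \<beta> * (P x - slope r x)" using adm[OF that] \<beta> by (intro mult_nonneg_nonneg) auto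
      moreover have "K x - N x = \<beta> * (P x - slope r x)" using that by (intro NK) auto
      ultimately show ?thesis by linarith
    qed
    show "continuous_on Iv N" unfolding N_def[abs_def]
      by (rule continuous_on_subset[OF prim_continuous[OF mL2]]) auto
    show "(K has_real_derivative k x) (at x)" if x: "x \<in> Iv" for x
    proof -
      have "((\<lambda>x. integral {-1..x} k) has_real_derivative k x) (at x within {-1..1})"
        using x by (intro integral_has_real_derivative ck) auto
      then have "((\<lambda>x. integral {-1..x} k) has_real_derivative k x) (at x)"
        using x by (simp add: at_within_Icc_at)
      then show ?thesis unfolding K_def[abs_def] by (auto intro!: derivative_eq_intros)
    qed
    then show "continuous_on Iv K" by (intro DERIV_continuous_on[of Iv K k]) (rule has_field_derivative_at_within)
    show "H1_modulus k Mn" unfolding Mn_def[abs_def]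
    proof (rule H1_modulus_prim[where c="\<beta> * c\<psi> + \<beta> * cf"])
      show "(\<lambda>t. \<beta> * \<psi>2 t + (slope u t + \<beta> * f1 t)) \<in> L2"
        by (intro L2_add L2_scale L2s slope_L2 uL2)
      fix x assume x: "x \<in> Iv"
      have "integral {-1..x} (\<lambda>t. \<beta> * \<psi>2 t + (slope u t + \<beta> * f1 t))
        = \<beta> * integral {-1..x} \<psi>2 + (state u x + \<beta> * integral {-1..x} f1)"
        unfolding state_def using x
        by (subst Henstock_Kurzweil_Integration.integral_add,
            auto intro!: integrable_on_mult_right integrable_add L2_integrable_on L2s slope_L2 uL2)
           (subst Henstock_Kurzweil_Integration.integral_add,
            auto intro!: integrable_on_mult_right L2_integrable_on L2s slope_L2 uL2)
      moreover have "x \<in> {-1..1}" using x by auto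
      ultimately show "k x = \<beta> * c\<psi> + \<beta> * cf + integral {-1..x} (\<lambda>t. \<beta> * \<psi>2 t + (slope u t + \<beta> * f1 t))"
        by (simp add: k_def w_def f0'_def \<psi>1 algebra_simps)
    qed
    show "(N b - N a) / (b - a) \<le> (N c - N b) / (c - b)" if "-1 < a" "a < b" "b < c" "c < 1" for a b c
      using that by (rule convex)
    show "(N b - N a) / (b - a) = (N c - N b) / (c - b)"
      if abc: "-1 < a" "a < b" "b < c" "c < 1" and free: "\<And>x. x \<in> {a..c} \<Longrightarrow> N x < K x" for a b c
    proof -
      have conv: "(N b - N a) / (b - a) \<le> (N c - N b) / (c - b)" using abc by (rule convex)
      \<comment> \<open>The smallest gap on \<open>{a..c}\<close> tells how much of the hat function may be added.\<close>
      obtain z where z: "z \<in> {a..c}" "\<And>y. y \<in> {a..c} \<Longrightarrow> K z - N z \<le> K y - N y"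
      proof -
        have "continuous_on {-1..1} (\<lambda>y. K y - N y)"
          unfolding K_def[abs_def] N_def[abs_def]
          by (intro continuous_on_diff continuous_on_add continuous_on_const prim_continuous mL2 L2_continuous[OF ck])
        then have "continuous_on {a..c} (\<lambda>y. K y - N y)"
          by (rule continuous_on_subset) (use abc in auto)
        then show ?thesis using continuous_attains_inf[of "{a..c}" "\<lambda>y. K y - N y"] abc that by auto
      qed
      define \<epsilon> where "\<epsilon> = (K z - N z) / \<beta>"
      have \<epsilon>: "\<epsilon> > 0" using free[OF z(1)] \<beta> by (simp add: \<epsilon>_def)
      have "ip m (\<lambda>x. (r x + \<epsilon> * hat a b c x) - r x) \<ge> 0"
      proof (rule vi)
        show "(\<lambda>x. r x + \<epsilon> * hat a b c x) \<in> L2" by (intro L2_add L2_scale L2s hatL2)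
        show "slope (\<lambda>x. r x + \<epsilon> * hat a b c x) x \<le> P x" if x: "x \<in> Iv" for x
        proof -
          have xc: "x \<in> {-1..1}" using x by auto
          then have e: "slope (\<lambda>x. r x + \<epsilon> * hat a b c x) x = slope r x + \<epsilon> * slope (hat a b c) x"
            by (simp add: slope_add L2s hatL2 L2_scale slope_scale)
          show ?thesis
          proof (cases "x \<in> {a..c}")
            case True
            have "\<epsilon> * slope (hat a b c) x \<le> \<epsilon> * 1"
              using \<epsilon> hat_slope'(2)[OF abc x] by (intro mult_left_mono) auto
            moreover have "\<epsilon> \<le> P x - slope r x"
              using z(2)[OF True] NK[OF xc] \<beta> by (simp add: \<epsilon>_def pos_divide_le_eq mult.commute)
            ultimately show ?thesis using e by simp
          next
            case False
            then show ?thesis using e hat_slope'(3)[OF abc x] adm[OF x] by simp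
          qed
        qed
      qed
      then have "\<epsilon> * ip m (hat a b c) \<ge> 0" by (simp add: ip_scale_right)
      then have "ip m (hat a b c) \<ge> 0" using \<epsilon> by (simp add: zero_le_mult_iff)
      then show ?thesis using ip_hat[OF abc] conv by simp
    qed
  qed
  then obtain n where n': "\<forall>x\<in>Iv. (N has_real_derivative n x) (at x)" and nM: "H1_modulus n Mn"
    by (elim exE conjE)
  have n: "(N has_real_derivative n x) (at x)" if "x \<in> Iv" for x using n' that by (rule bspec)
  have nL2: "n \<in> L2" by (rule H1_modulus_L2[OF nM])
  \<comment> \<open>Both have the primitive \<open>N\<close> in the open interval.\<close>
  have mn: "AE x in IM. m x = n x"
  proof -
    have "AE x in IM. m x - n x = 0"
    proof (rule AE_zero_if_integrals_zero)
      show "(\<lambda>x. m x - n x) \<in> L2" by (intro L2_diff mL2 nL2)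
      fix a b :: real assume ab: "-1 < a" "a < b" "b < 1"
      have "(n has_integral (N b - N a)) {a..b}"
      proof (rule fundamental_theorem_of_calculus)
        fix x assume "x \<in> {a..b}"
        then have "(N has_real_derivative n x) (at x)" using ab by (intro n) auto
        then show "(N has_vector_derivative n x) (at x within {a..b})"
          by (simp add: has_real_derivative_iff_has_vector_derivative has_vector_derivative_at_within)
      qed (use ab in simp)
      then have "integral {a..b} n = integral {a..b} m"
        using integral_split[OF mL2, of "-1" a b] ab by (simp add: N_def integral_unique)
      then show "integral {a..b} (\<lambda>x. m x - n x) = 0"
        using ab by (subst Henstock_Kurzweil_Integration.integral_diff) (auto intro!: L2_integrable_on mL2 nL2)
    qed
    then show ?thesis by eventually_elim simp
  qed
  define r' where "r' x = inverse \<beta> * (n x + (- 1) * state u x) + (- 1) * f0' x" for x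
  have rr': "AE x in IM. r x = r' x"
    using mn ff0 by eventually_elim (use \<beta> in \<open>simp add: r'_def m_def field_simps\<close>)
  have su: "H1_modulus (state u) (\<lambda>x. integral {-1..x} (\<lambda>t. (slope u t)\<^sup>2))"
    by (rule H1_modulus_prim[where c=0]) (simp_all add: uL2 state_def)
  have sf: "H1_modulus f0' (\<lambda>x. integral {-1..x} (\<lambda>t. (f1 t)\<^sup>2))"
    by (rule H1_modulus_prim[where c=cf]) (simp_all add: L2s f0'_def)
  note mod_r = H1_modulus_add[OF H1_modulus_scale[OF H1_modulus_add[OF nM H1_modulus_scale[OF su]]] H1_modulus_scale[OF sf],
      of "inverse \<beta>" "-1" "-1", folded r'_def]
  show ?thesis
  proof (rule that[OF nM _ mod_r])
    fix d assume d: "d \<in> L2"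
    have "ip m d = ip n d"
      by (rule ip_cong_AE[OF mn]) (simp_all add: L2_measurable mL2 nL2 d)
    then show "energy_deriv yd \<beta> f r d = ip n d" using deriv_m[OF d] by simp
  next
    show "AE x in IM. r x = r' x" by (rule rr')
  qed
qed

section \<open>Cell averages and nodal interpolation\<close>

text \<open>The piecewise constant function with value \<open>a i\<close> on the \<open>i\<close>-th cell. Neighbouring closed
  cells overlap, so at inner nodes the values add up; these nodes form a null set.\<close>
definition cell_step :: "real list \<Rightarrow> (nat \<Rightarrow> real) \<Rightarrow> real \<Rightarrow> real" where
  "cell_step T a x = (\<Sum>i<length T - 1. a i * indicator {T ! i..T ! Suc i} x)"

definition cell_mean :: "real list \<Rightarrow> (real \<Rightarrow> real) \<Rightarrow> real \<Rightarrow> real" where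
  "cell_mean T v = cell_step T (\<lambda>i. integral {T ! i..T ! Suc i} v / (T ! Suc i - T ! i))"

text \<open>The piecewise linear interpolant of \<open>w\<close> at the nodes, written as one formula valid on the
  whole interval: each cell contributes its slope times the length of its part to the left of \<open>x\<close>.\<close>
definition broken_line :: "real list \<Rightarrow> (real \<Rightarrow> real) \<Rightarrow> real \<Rightarrow> real" where
  "broken_line T w x = w (-1) + (\<Sum>i<length T - 1.
     (w (T ! Suc i) - w (T ! i)) / (T ! Suc i - T ! i) * (max (T ! i) (min x (T ! Suc i)) - T ! i))"

lemma convex_form:
  fixes a b x y z :: real
  assumes "a < b"
  shows "y + (z - y) / (b - a) * (x - a) = ((b - x) * y + (x - a) * z) / (b - a)"
  using assms by (simp add: field_simps)

context
  fixes T :: "real list"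
  assumes mesh: "is_mesh T"
begin

lemma mesh_ends: "T ! 0 = -1" "T ! (length T - 1) = 1" "length T \<ge> 2"
proof -
  have ne: "T \<noteq> []" and hl: "hd T = -1" "last T = 1" using mesh by (auto simp: is_mesh_def)
  show 0: "T ! 0 = -1" using hl(1) ne by (simp add: hd_conv_nth)
  show 1: "T ! (length T - 1) = 1" using hl(2) ne by (simp add: last_conv_nth)
  have "length T \<noteq> 1" using 0 1 by auto
  moreover have "length T \<noteq> 0" using ne by simp
  ultimately show "length T \<ge> 2" by linarith
qed

lemma mesh_less: "i < j \<Longrightarrow> j < length T \<Longrightarrow> T ! i < T ! j"
  using mesh by (simp add: is_mesh_def sorted_wrt_iff_nth_less)

lemma mesh_le: "i \<le> j \<Longrightarrow> j < length T \<Longrightarrow> T ! i \<le> T ! j"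
  using mesh_less[of i j] by (cases "i = j") auto

lemma mesh_bounds: "i < length T \<Longrightarrow> T ! i \<in> {-1..1}"
  using mesh_le[of 0 i] mesh_le[of i "length T - 1"] mesh_ends by auto

lemma mesh_lengths_finite: "finite (mesh_lengths T)"
proof -
  have "mesh_lengths T \<subseteq> (\<lambda>i. T ! Suc i - T ! i) ` {..<length T}"
    by (auto simp: mesh_lengths_def)
  then show ?thesis by (rule finite_subset) simp
qed

lemma cell_length_le: "Suc i < length T \<Longrightarrow> T ! Suc i - T ! i \<le> mesh_size T"
  unfolding mesh_size_def by (rule Max_ge[OF mesh_lengths_finite]) (auto simp: mesh_lengths_def)

lemma mesh_size_pos: "mesh_size T > 0"
  using cell_length_le[of 0] mesh_less[of 0 "Suc 0"] mesh_ends(3) by fastforce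

lemma mesh_cell:
  assumes "x \<in> {-1..1}"
  obtains j where "Suc j < length T" "T ! j \<le> x" "x \<le> T ! Suc j"
proof -
  define j where "j = (GREATEST i. Suc i < length T \<and> T ! i \<le> x)"
  have ex: "Suc 0 < length T \<and> T ! 0 \<le> x" using assms mesh_ends by auto
  have bd: "\<And>i. Suc i < length T \<and> T ! i \<le> x \<Longrightarrow> i \<le> length T" by auto
  have j: "Suc j < length T" "T ! j \<le> x"
    using GreatestI_nat[of "\<lambda>i. Suc i < length T \<and> T ! i \<le> x" 0 "length T"] ex bd
    unfolding j_def by auto
  have "x \<le> T ! Suc j"
  proof (cases "Suc (Suc j) < length T")
    case True
    then have "\<not> T ! Suc j \<le> x"
      using Greatest_le_nat[of "\<lambda>i. Suc i < length T \<and> T ! i \<le> x" "Suc j" "length T"] bd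
      unfolding j_def[symmetric] by auto
    then show ?thesis by simp
  next
    case False
    then have "Suc j = length T - 1" using j by simp
    then show ?thesis using mesh_ends(2) assms by simp
  qed
  with j show ?thesis by (rule that)
qed

lemma cell_step_L2: "cell_step T a \<in> L2"
  unfolding cell_step_def[abs_def] by (intro L2_sum L2_scale L2_indicator)

lemma cell_mean_L2: "cell_mean T v \<in> L2"
  unfolding cell_mean_def by (rule cell_step_L2)

lemma cell_step_eq:
  assumes j: "Suc j < length T" and x: "T ! j < x" "x < T ! Suc j"
  shows "cell_step T a x = a j"
proof -
  have "(\<Sum>i<length T - 1. a i * indicator {T ! i..T ! Suc i} x) = (\<Sum>i<length T - 1. if i = j then a j else 0)"
  proof (rule sum.cong[OF refl])
    fix i assume "i \<in> {..<length T - 1}"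
    then have i: "Suc i < length T" by auto
    consider "i = j" | "i < j" | "j < i" by linarith
    then show "a i * indicator {T ! i..T ! Suc i} x = (if i = j then a j else 0)"
    proof cases
      case 1 then show ?thesis using x by simp
    next
      case 2
      then have "T ! Suc i \<le> T ! j" using j by (intro mesh_le) auto
      then show ?thesis using x 2 by (simp add: indicator_def)
    next
      case 3
      then have "T ! Suc j \<le> T ! i" using i by (intro mesh_le) auto
      then show ?thesis using x 3 by (simp add: indicator_def)
    qed
  qed
  also have "\<dots> = a j" using j by simp
  finally show ?thesis by (simp add: cell_step_def)
qed

lemma broken_line_cell:
  assumes j: "Suc j < length T" and x: "T ! j \<le> x" "x \<le> T ! Suc j"
  shows "broken_line T w x = w (T ! j) + (w (T ! Suc j) - w (T ! j)) / (T ! Suc j - T ! j) * (x - T ! j)"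
proof -
  let ?g = "\<lambda>i. (w (T ! Suc i) - w (T ! i)) / (T ! Suc i - T ! i) * (max (T ! i) (min x (T ! Suc i)) - T ! i)"
  have "(\<Sum>i<length T - 1. ?g i) = (\<Sum>i<Suc j. ?g i)"
  proof (rule sum.mono_neutral_right)
    show "\<forall>i\<in>{..<length T - 1} - {..<Suc j}. ?g i = 0"
    proof
      fix i assume i: "i \<in> {..<length T - 1} - {..<Suc j}"
      then have "T ! Suc j \<le> T ! i" by (intro mesh_le) auto
      then have "max (T ! i) (min x (T ! Suc i)) = T ! i" using x by auto
      then show "?g i = 0" by simp
    qed
  qed (use j in auto)
  also have "\<dots> = (\<Sum>i<j. ?g i) + ?g j" by simp
  also have "(\<Sum>i<j. ?g i) = (\<Sum>i<j. w (T ! Suc i) - w (T ! i))"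
  proof (rule sum.cong[OF refl])
    fix i assume "i \<in> {..<j}"
    then have "T ! i < T ! Suc i" "T ! Suc i \<le> T ! j" using j by (auto intro: mesh_less mesh_le)
    then show "?g i = w (T ! Suc i) - w (T ! i)" using x by simp
  qed
  also have "\<dots> = w (T ! j) - w (-1)" using sum_lessThan_telescope[of "\<lambda>i. w (T ! i)" j] mesh_ends(1) by simp
  also have "?g j = (w (T ! Suc j) - w (T ! j)) / (T ! Suc j - T ! j) * (x - T ! j)"
    using x by simp
  finally show ?thesis by (simp add: broken_line_def)
qed

lemma broken_line_node:
  assumes "i < length T" shows "broken_line T w (T ! i) = w (T ! i)"
proof (cases "Suc i < length T")
  case True
  then show ?thesis using broken_line_cell[OF True, of "T ! i" w] mesh_less[of i "Suc i"] by simp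
next
  case False
  then obtain j where j: "i = Suc j" using assms mesh_ends(3) by (cases i) auto
  then have "Suc j < length T" "T ! j < T ! Suc j" using assms by (auto intro: mesh_less)
  then show ?thesis using broken_line_cell[of j "T ! Suc j" w] j by simp
qed

lemma broken_line_mono:
  assumes "\<And>i. i < length T \<Longrightarrow> w (T ! i) \<le> v (T ! i)" "x \<in> {-1..1}"
  shows "broken_line T w x \<le> broken_line T v x"
proof -
  obtain j where j: "Suc j < length T" "T ! j \<le> x" "x \<le> T ! Suc j" using mesh_cell[OF assms(2)] .
  have lt: "T ! j < T ! Suc j" using j(1) by (intro mesh_less) auto
  have "(T ! Suc j - x) * w (T ! j) + (x - T ! j) * w (T ! Suc j)
    \<le> (T ! Suc j - x) * v (T ! j) + (x - T ! j) * v (T ! Suc j)"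
    using j assms(1)[of j] assms(1)[of "Suc j"] by (intro add_mono mult_left_mono) auto
  then show ?thesis
    unfolding broken_line_cell[OF j] convex_form[OF lt] using lt by (intro divide_right_mono) auto
qed

lemma broken_line_P1: "broken_line T w \<in> P1_space T"
proof -
  have "continuous_on {-1..1} (broken_line T w)"
    unfolding broken_line_def[abs_def] by (intro continuous_intros)
  moreover have "piecewise_poly 1 T (broken_line T w)"
    unfolding piecewise_poly_def
  proof (intro allI impI)
    fix j assume j: "Suc j < length T"
    define q where "q = (w (T ! Suc j) - w (T ! j)) / (T ! Suc j - T ! j)"
    let ?p = "[:w (T ! j) - q * T ! j, q:]"
    have "degree ?p \<le> 1" by simp
    moreover have "\<forall>x\<in>{T ! j..T ! Suc j}. broken_line T w x = poly ?p x"
    proof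
      fix x assume "x \<in> {T ! j..T ! Suc j}"
      then have "broken_line T w x = w (T ! j) + q * (x - T ! j)"
        unfolding q_def using j by (intro broken_line_cell) auto
      then show "broken_line T w x = poly ?p x" by (simp add: algebra_simps)
    qed
    ultimately show "\<exists>p. degree p \<le> 1 \<and> (\<forall>x\<in>{T ! j..T ! Suc j}. broken_line T w x = poly p x)" by blast
  qed
  ultimately show ?thesis by (simp add: P1_space_def)
qed

lemma P1_eq_broken_line:
  assumes p: "p \<in> P1_space T" and x: "x \<in> {-1..1}"
  shows "p x = broken_line T p x"
proof -
  obtain j where j: "Suc j < length T" "T ! j \<le> x" "x \<le> T ! Suc j" using mesh_cell[OF x] .
  have lt: "T ! j < T ! Suc j" using j(1) by (intro mesh_less) auto
  have "\<exists>q::real poly. degree q \<le> 1 \<and> (\<forall>x\<in>{T ! j..T ! Suc j}. p x = poly q x)"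
    using p j(1) by (simp add: P1_space_def piecewise_poly_def)
  then obtain q :: "real poly" where q: "degree q \<le> 1" "\<And>x. x \<in> {T ! j..T ! Suc j} \<Longrightarrow> p x = poly q x" by blast
  define a b where "a = coeff q 0" and "b = coeff q 1"
  have ab: "q = [:a, b:]"
    by (rule poly_eqI) (use q(1) in \<open>auto simp: a_def b_def coeff_pCons coeff_eq_0 split: nat.split\<close>)
  have "p x = a + b * x" "p (T ! j) = a + b * T ! j" "p (T ! Suc j) = a + b * T ! Suc j"
    using q(2) j lt ab by (auto simp: algebra_simps)
  moreover from this have "p (T ! Suc j) - p (T ! j) = b * (T ! Suc j - T ! j)" by (simp add: algebra_simps)
  then have "(p (T ! Suc j) - p (T ! j)) / (T ! Suc j - T ! j) = b" using lt by simp
  ultimately show ?thesis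
    unfolding broken_line_cell[OF j] by (simp add: algebra_simps)
qed

text \<open>\<open>P_h\<close> is some interpolant, and a continuous piecewise linear function is determined on the
  interval by its values at the nodes.\<close>
lemma P_h_eq_broken_line:
  assumes "x \<in> {-1..1}" shows "P_h T w x = broken_line T w x"
proof -
  have "\<exists>p. p \<in> P1_space T \<and> (\<forall>t\<in>set T. p t = w t)"
    by (intro exI[of _ "broken_line T w"]) (auto simp: broken_line_P1 broken_line_node in_set_conv_nth)
  then have *: "P_h T w \<in> P1_space T \<and> (\<forall>t\<in>set T. P_h T w t = w t)"
    unfolding P_h_def by (rule someI_ex)
  then have "P_h T w (T ! i) = w (T ! i)" if "i < length T" for i using that by simp
  then have "broken_line T (P_h T w) x = broken_line T w x"
    using assms by (intro antisym broken_line_mono) auto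
  then show ?thesis using P1_eq_broken_line[of "P_h T w" x] * assms by simp
qed

text \<open>Interpolating a primitive at the nodes is the same as averaging its derivative over the
  cells.\<close>
lemma broken_line_prim:
  assumes v: "v \<in> L2" and w: "\<And>x. x \<in> {-1..1} \<Longrightarrow> w x = c + integral {-1..x} v"
    and x: "x \<in> {-1..1}"
  shows "broken_line T w x = w (-1) + integral {-1..x} (cell_mean T v)"
proof -
  have "integral {-1..x} (cell_mean T v) = (\<Sum>i<length T - 1. integral {-1..x}
      (\<lambda>t. integral {T ! i..T ! Suc i} v / (T ! Suc i - T ! i) * indicator {T ! i..T ! Suc i} t))"
    unfolding cell_mean_def cell_step_def[abs_def] using x
    by (intro Henstock_Kurzweil_Integration.integral_sum L2_integrable_on L2_scale L2_indicator) auto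
  also have "\<dots> = (\<Sum>i<length T - 1.
     (w (T ! Suc i) - w (T ! i)) / (T ! Suc i - T ! i) * (max (T ! i) (min x (T ! Suc i)) - T ! i))"
  proof (rule sum.cong[OF refl])
    fix i assume "i \<in> {..<length T - 1}"
    then have i: "Suc i < length T" by auto
    have b: "-1 \<le> T ! i" "T ! i < T ! Suc i" "T ! Suc i \<le> 1"
      using mesh_bounds[of i] mesh_bounds[OF i] i by (auto intro: mesh_less)
    have "integral {T ! i..T ! Suc i} v = w (T ! Suc i) - w (T ! i)"
      using integral_split[OF v, of "-1" "T ! i" "T ! Suc i"] w[of "T ! i"] w[of "T ! Suc i"] b by auto
    moreover have "integral {-1..x} (indicator {T ! i..T ! Suc i}) = max (T ! i) (min x (T ! Suc i)) - T ! i"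
      using b x by (simp add: integral_indicator_interval max_def min_def)
    ultimately show "integral {-1..x} (\<lambda>t. integral {T ! i..T ! Suc i} v / (T ! Suc i - T ! i) * indicator {T ! i..T ! Suc i} t)
       = (w (T ! Suc i) - w (T ! i)) / (T ! Suc i - T ! i) * (max (T ! i) (min x (T ! Suc i)) - T ! i)"
      by (simp only: Henstock_Kurzweil_Integration.integral_mult_right)
  qed
  finally show ?thesis by (simp add: broken_line_def)
qed

lemma integral_cell_mean_cell:
  assumes v: "v \<in> L2" and i: "Suc i < length T"
  shows "integral {T ! i..T ! Suc i} (cell_mean T v) = integral {T ! i..T ! Suc i} v"
proof -
  have b: "-1 \<le> T ! i" "T ! i < T ! Suc i" "T ! Suc i \<le> 1"
    using mesh_bounds[of i] mesh_bounds[OF i] i by (auto intro: mesh_less)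
  have node: "integral {-1..T ! j} (cell_mean T v) = integral {-1..T ! j} v" if "j < length T" for j
    using broken_line_prim[OF v, of "\<lambda>x. integral {-1..x} v" 0 "T ! j"] mesh_bounds[OF that]
      broken_line_node[OF that, of "\<lambda>x. integral {-1..x} v"] by simp
  show ?thesis
    using integral_split[OF v, of "-1" "T ! i" "T ! Suc i"]
      integral_split[OF cell_mean_L2, of "-1" "T ! i" "T ! Suc i" v] node[of i] node[OF i] i b by simp
qed

lemma ip_cell_step:
  assumes "u \<in> L2"
  shows "ip (cell_step T a) u = (\<Sum>i<length T - 1. a i * integral {T ! i..T ! Suc i} u)"
proof -
  have "ip (cell_step T a) u = (\<Sum>i<length T - 1. ip (\<lambda>x. a i * indicator {T ! i..T ! Suc i} x) u)"
    unfolding cell_step_def[abs_def] by (rule ip_sum_left[OF assms]) (auto intro: L2_scale)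
  also have "\<dots> = (\<Sum>i<length T - 1. a i * integral {T ! i..T ! Suc i} u)"
  proof (rule sum.cong[OF refl])
    fix i assume "i \<in> {..<length T - 1}"
    then have "-1 \<le> T ! i" "T ! Suc i \<le> 1" using mesh_bounds[of i] mesh_bounds[of "Suc i"] by auto
    then show "ip (\<lambda>x. a i * indicator {T ! i..T ! Suc i} x) u = a i * integral {T ! i..T ! Suc i} u"
      using ip_indicator[OF assms] by (simp add: ip_scale_left ip_commute[of "indicator _"])
  qed
  finally show ?thesis .
qed

text \<open>\<open>cell_mean\<close> preserves the integral over each cell.\<close>
lemma cell_step_orthogonal:
  assumes v: "v \<in> L2" shows "ip (cell_step T a) (\<lambda>x. v x - cell_mean T v x) = 0"
proof -
  have "(\<lambda>x. v x - cell_mean T v x) \<in> L2" by (intro L2_diff v cell_mean_L2)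
  then have "ip (cell_step T a) (\<lambda>x. v x - cell_mean T v x)
    = (\<Sum>i<length T - 1. a i * integral {T ! i..T ! Suc i} (\<lambda>x. v x - cell_mean T v x))"
    by (rule ip_cell_step)
  also have "\<dots> = 0"
  proof (rule sum.neutral, rule ballI)
    fix i assume "i \<in> {..<length T - 1}"
    then have i: "Suc i < length T" by auto
    have "integral {T ! i..T ! Suc i} (\<lambda>x. v x - cell_mean T v x)
      = integral {T ! i..T ! Suc i} v - integral {T ! i..T ! Suc i} (cell_mean T v)"
      using mesh_bounds[of i] mesh_bounds[OF i] i
      by (intro Henstock_Kurzweil_Integration.integral_diff L2_integrable_on v cell_mean_L2) auto
    then show "a i * integral {T ! i..T ! Suc i} (\<lambda>x. v x - cell_mean T v x) = 0"
      using integral_cell_mean_cell[OF v i] by simp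
  qed
  finally show ?thesis .
qed

text \<open>Pythagoras, since \<open>v - cell_mean T v\<close> is orthogonal to the piecewise constant function
  \<open>cell_mean T v - cell_step T a\<close>.\<close>
lemma cell_mean_best:
  assumes v: "v \<in> L2"
  shows "L2_norm (\<lambda>x. v x - cell_mean T v x) \<le> L2_norm (\<lambda>x. v x - cell_step T a x)"
proof (rule power2_le_imp_le)
  let ?d = "\<lambda>x. v x - cell_mean T v x"
  have dL2: "?d \<in> L2" by (intro L2_diff v cell_mean_L2)
  define e where "e = cell_step T (\<lambda>i. integral {T ! i..T ! Suc i} v / (T ! Suc i - T ! i) - a i)"
  have eL2: "e \<in> L2" unfolding e_def by (rule cell_step_L2)
  have e_eq: "e x = cell_mean T v x - cell_step T a x" for x
    by (simp add: e_def cell_mean_def cell_step_def left_diff_distrib sum_subtractf)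
  have orth: "ip e ?d = 0" unfolding e_def by (rule cell_step_orthogonal[OF v])
  have "(\<lambda>x. v x - cell_step T a x) = (\<lambda>x. ?d x + e x)" by (simp add: e_eq)
  then have "(L2_norm (\<lambda>x. v x - cell_step T a x))\<^sup>2 = (L2_norm ?d)\<^sup>2 + (L2_norm e)\<^sup>2"
    using orth dL2 eL2 unfolding L2_norm_sq
    by (simp only: ip_add_left ip_add_right L2_add ip_commute[of ?d e])
  then show "(L2_norm ?d)\<^sup>2 \<le> (L2_norm (\<lambda>x. v x - cell_step T a x))\<^sup>2" by simp
qed simp

lemma cell_mean_norm_le:
  assumes v: "v \<in> L2"
  shows "L2_norm (\<lambda>x. v x - cell_mean T v x) \<le> L2_norm v"
  using cell_mean_best[OF v, of "\<lambda>_. 0"] by (simp add: cell_step_def)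

lemma AE_not_node: "AE x in IM. x \<notin> set T"
proof -
  have "set T \<in> null_sets lebesgue" by (simp add: negligible_iff_null_sets[symmetric] negligible_finite)
  then have "AE x in lebesgue. x \<notin> set T" by (rule AE_not_in)
  then show ?thesis by (subst AE_restrict_space_iff) auto
qed

text \<open>Compare with the values at the cell midpoints. On the \<open>i\<close>-th cell the squared error is at
  most \<open>h * (M (T ! Suc i) - M (T ! i))\<close>; integration adds a factor \<open>h\<close> and the differences
  telescope.\<close>
lemma cell_mean_error:
  assumes v: "v \<in> L2" and ae: "AE x in IM. v x = v' x" and mod: "H1_modulus v' M"
  shows "L2_norm (\<lambda>x. v x - cell_mean T v x) \<le> mesh_size T * sqrt (M 1 - M (-1))"
proof -
  let ?h = "mesh_size T"
  define mid where "mid i = (T ! i + T ! Suc i) / 2" for i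
  define a where "a i = v' (mid i)" for i
  define b where "b i = ?h * (M (T ! Suc i) - M (T ! i))" for i
  have h: "?h > 0" by (rule mesh_size_pos)
  have dM: "0 \<le> M (T ! Suc i) - M (T ! i)" if "Suc i < length T" for i
    using H1_modulusD(2)[OF mod, of "T ! i" "T ! Suc i"] mesh_bounds[of i] mesh_bounds[OF that] mesh_le[of i "Suc i"] that by auto
  have inI: "AE x in IM. x \<in> Iv" by (rule AE_I2) simp
  have ptw: "AE x in IM. (v x - cell_step T a x)\<^sup>2 \<le> cell_step T b x"
    using ae AE_not_node inI
  proof eventually_elim
    case (elim x)
    then have "x \<in> {-1..1}" by auto
    then obtain j where j: "Suc j < length T" "T ! j \<le> x" "x \<le> T ! Suc j" using mesh_cell by blast
    have "T ! j \<noteq> x" "T ! Suc j \<noteq> x" using elim j(1) by auto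
    then have x: "T ! j < x" "x < T ! Suc j" using j by auto
    have B: "-1 \<le> T ! j" "T ! Suc j \<le> 1" using mesh_bounds[of j] mesh_bounds[OF j(1)] j(1) by auto
    have m: "T ! j < mid j" "mid j < T ! Suc j" using x by (auto simp: mid_def)
    have *: "(v' q - v' p)\<^sup>2 \<le> b j" if "T ! j < p" "p \<le> q" "q < T ! Suc j" for p q
    proof -
      have "(v' q - v' p)\<^sup>2 \<le> (q - p) * (M q - M p)"
        using that B by (intro H1_modulusD(1)[OF mod]) auto
      also have "\<dots> \<le> ?h * (M (T ! Suc j) - M (T ! j))"
        using that B cell_length_le[OF j(1)] h H1_modulusD(2)[OF mod, of "T ! j" p]
          H1_modulusD(2)[OF mod, of q "T ! Suc j"] H1_modulusD(2)[OF mod, of p q]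
        by (intro mult_mono) auto
      finally show ?thesis by (simp add: b_def)
    qed
    have "(v' x - v' (mid j))\<^sup>2 \<le> b j"
      using *[of x "mid j"] *[of "mid j" x] x m by (cases "x \<le> mid j") (auto simp: power2_commute)
    then show ?case using elim cell_step_eq[OF j(1) x] by (simp add: a_def)
  qed
  have L2d: "(\<lambda>x. v x - cell_step T a x) \<in> L2" by (intro L2_diff v cell_step_L2)
  have "(L2_norm (\<lambda>x. v x - cell_step T a x))\<^sup>2 = (LINT x|IM. (v x - cell_step T a x)\<^sup>2)"
    unfolding L2_norm_sq ip_def by (simp add: power2_eq_square)
  also have "\<dots> \<le> (LINT x|IM. cell_step T b x)"
    by (rule integral_mono_AE[OF L2_sq_integrable[OF L2d] L2_integrable[OF cell_step_L2] ptw])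
  also have "\<dots> = ip (cell_step T b) (\<lambda>x. 1)" by (simp add: ip_def)
  also have "\<dots> = (\<Sum>i<length T - 1. b i * (T ! Suc i - T ! i))"
    by (subst ip_cell_step) (auto intro!: sum.cong simp: mesh_le)
  also have "\<dots> \<le> (\<Sum>i<length T - 1. ?h\<^sup>2 * (M (T ! Suc i) - M (T ! i)))"
  proof (rule sum_mono)
    fix i assume "i \<in> {..<length T - 1}"
    then have i: "Suc i < length T" by auto
    have "b i * (T ! Suc i - T ! i) \<le> b i * ?h"
      using dM[OF i] h cell_length_le[OF i] by (intro mult_left_mono) (auto simp: b_def)
    then show "b i * (T ! Suc i - T ! i) \<le> ?h\<^sup>2 * (M (T ! Suc i) - M (T ! i))"
      by (simp add: b_def power2_eq_square ac_simps)
  qed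
  also have "\<dots> = ?h\<^sup>2 * (M 1 - M (-1))"
    using sum_lessThan_telescope[of "\<lambda>i. M (T ! i)" "length T - 1"] mesh_ends by (simp flip: sum_distrib_left)
  finally have "(L2_norm (\<lambda>x. v x - cell_step T a x))\<^sup>2 \<le> ?h\<^sup>2 * (M 1 - M (-1))" .
  then have "L2_norm (\<lambda>x. v x - cell_step T a x) \<le> sqrt (?h\<^sup>2 * (M 1 - M (-1)))" by (rule real_le_rsqrt)
  also have "\<dots> = ?h * sqrt (M 1 - M (-1))" using h by (simp add: real_sqrt_mult)
  finally show ?thesis using cell_mean_best[OF v, of a] by linarith
qed

end

lemma cell_mean_add:
  assumes "is_mesh T" "u \<in> L2" "v \<in> L2"
  shows "cell_mean T (\<lambda>x. u x + v x) x = cell_mean T u x + cell_mean T v x"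
proof -
  have "(\<Sum>i<length T - 1. integral {T ! i..T ! Suc i} (\<lambda>x. u x + v x) / (T ! Suc i - T ! i) * indicator {T ! i..T ! Suc i} x)
    = (\<Sum>i<length T - 1. integral {T ! i..T ! Suc i} u / (T ! Suc i - T ! i) * indicator {T ! i..T ! Suc i} x
        + integral {T ! i..T ! Suc i} v / (T ! Suc i - T ! i) * indicator {T ! i..T ! Suc i} x)"
  proof (rule sum.cong[OF refl])
    fix i assume "i \<in> {..<length T - 1}"
    then have "-1 \<le> T ! i" "T ! Suc i \<le> 1"
      using mesh_bounds[OF assms(1), of i] mesh_bounds[OF assms(1), of "Suc i"] by auto
    then have "integral {T ! i..T ! Suc i} (\<lambda>x. u x + v x) = integral {T ! i..T ! Suc i} u + integral {T ! i..T ! Suc i} v"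
      using assms by (intro Henstock_Kurzweil_Integration.integral_add L2_integrable_on)
    then show "integral {T ! i..T ! Suc i} (\<lambda>x. u x + v x) / (T ! Suc i - T ! i) * indicator {T ! i..T ! Suc i} x
     = integral {T ! i..T ! Suc i} u / (T ! Suc i - T ! i) * indicator {T ! i..T ! Suc i} x
        + integral {T ! i..T ! Suc i} v / (T ! Suc i - T ! i) * indicator {T ! i..T ! Suc i} x"
      by (simp add: add_divide_distrib distrib_right)
  qed
  then show ?thesis by (simp add: cell_mean_def cell_step_def sum.distrib)
qed

section \<open>The discrete problem\<close>

text \<open>Averaging \<open>r\<close> interpolates \<open>slope r\<close>, so \<open>cell_mean T r\<close> is admissible for the discrete
  problem whenever \<open>r\<close> is admissible for the continuous one. Since the slope vanishes at the node
  \<open>1\<close>, the boundary condition survives.\<close>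
lemma slope_cell_mean:
  assumes "is_mesh T" "r \<in> L2" "x \<in> {-1..1}"
  shows "slope (cell_mean T r) x = broken_line T (slope r) x"
proof -
  have bl: "broken_line T (slope r) x = slope r (-1) + integral {-1..x} (cell_mean T r)" if "x \<in> {-1..1}" for x
    by (rule broken_line_prim[OF assms(1,2) slope_eq[OF assms(2)] that])
  have "broken_line T (slope r) 1 = slope r 1"
    using broken_line_node[OF assms(1), of "length T - 1" "slope r"] mesh_ends[OF assms(1)] by simp
  then have "slope (cell_mean T r) (-1) = slope r (-1)"
    using bl[of 1] by (simp add: slope_def)
  then show ?thesis
    using bl[OF assms(3)] slope_eq[OF cell_mean_L2[OF assms(1)] assms(3)] by simp
qed

lemma state_C1: "s \<in> L2 \<Longrightarrow> C1_closed (state s)"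
  unfolding C1_closed_def by (intro exI[of _ "slope s"] conjI ballI slope_continuous state_derivative)

lemma state_piecewise_poly:
  assumes mesh: "is_mesh T" and s: "s \<in> L2" and lin: "\<And>x. x \<in> {-1..1} \<Longrightarrow> slope s x = broken_line T w x"
  shows "piecewise_poly 3 T (state s)"
  unfolding piecewise_poly_def
proof (intro allI impI)
  fix j assume j: "Suc j < length T"
  define t where "t = T ! j"
  define A where "A = w t"
  define B where "B = (w (T ! Suc j) - w t) / (T ! Suc j - t)"
  define S where "S = state s t"
  have b: "-1 \<le> t" "T ! Suc j \<le> 1" using mesh_bounds[OF mesh, of j] mesh_bounds[OF mesh j] j by (auto simp: t_def)
  let ?p = "[:S - A * t + B / 2 * t\<^sup>2, A - B * t, B / 2:]"
  have "degree ?p \<le> 3" by (simp add: degree_pCons_eq_if)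
  moreover have "\<forall>x\<in>{t..T ! Suc j}. state s x = poly ?p x"
  proof
    fix x assume x: "x \<in> {t..T ! Suc j}"
    have "(slope s has_integral (A * (x - t) + B / 2 * (x - t)\<^sup>2) - (A * (t - t) + B / 2 * (t - t)\<^sup>2)) {t..x}"
    proof (rule fundamental_theorem_of_calculus)
      fix y assume y: "y \<in> {t..x}"
      have "slope s y = A + B * (y - t)"
        using lin[of y] broken_line_cell[OF mesh j, of y w] y x b by (simp add: A_def B_def t_def)
      moreover have "((\<lambda>x. A * (x - t) + B / 2 * (x - t)\<^sup>2) has_real_derivative A + B * (y - t)) (at y within {t..x})"
        by (auto intro!: derivative_eq_intros)
      ultimately show "((\<lambda>x. A * (x - t) + B / 2 * (x - t)\<^sup>2) has_vector_derivative slope s y) (at y within {t..x})"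
        by (simp add: has_real_derivative_iff_has_vector_derivative)
    qed (use x in simp)
    then have "integral {t..x} (slope s) = A * (x - t) + B / 2 * (x - t)\<^sup>2" by (simp add: integral_unique)
    then have "state s x = S + (A * (x - t) + B / 2 * (x - t)\<^sup>2)"
      using integral_split[OF slope_L2[OF s], of "-1" t x] x b by (simp add: state_def S_def)
    then show "state s x = poly ?p x" by (simp add: power2_eq_square algebra_simps)
  qed
  ultimately show "\<exists>p. degree p \<le> 3 \<and> (\<forall>x\<in>{T ! j..T ! Suc j}. state s x = poly p x)"
    unfolding t_def by blast
qed

lemma piecewise_poly_combination:
  assumes mesh: "is_mesh T" and "piecewise_poly k T u" "piecewise_poly k T v"
    and eq: "\<And>x. x \<in> {-1..1} \<Longrightarrow> z x = a * u x + b * v x"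
  shows "piecewise_poly k T z"
  unfolding piecewise_poly_def
proof (intro allI impI)
  fix i assume i: "Suc i < length T"
  obtain p q where p: "degree p \<le> k" "\<forall>x\<in>{T ! i..T ! Suc i}. u x = poly p x"
    and q: "degree q \<le> k" "\<forall>x\<in>{T ! i..T ! Suc i}. v x = poly q x"
    using assms(2,3) i unfolding piecewise_poly_def by meson
  have "degree (smult a p + smult b q) \<le> k"
    using p(1) q(1) by (intro degree_add_le) (auto intro: order_trans[OF degree_smult_le])
  moreover have "\<forall>x\<in>{T ! i..T ! Suc i}. z x = poly (smult a p + smult b q) x"
  proof
    fix x assume x: "x \<in> {T ! i..T ! Suc i}"
    then have "x \<in> {-1..1}" using mesh_bounds[OF mesh, of i] mesh_bounds[OF mesh i] i by auto
    then show "z x = poly (smult a p + smult b q) x" using eq p(2) q(2) x by simp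
  qed
  ultimately show "\<exists>p. degree p \<le> k \<and> (\<forall>x\<in>{T ! i..T ! Suc i}. z x = poly p x)" by blast
qed

lemma P_h_node: "is_mesh T \<Longrightarrow> i < length T \<Longrightarrow> P_h T w (T ! i) = w (T ! i)"
  using P_h_eq_broken_line mesh_bounds broken_line_node by simp

lemma state_in_K_h:
  assumes mesh: "is_mesh T" and s: "s \<in> L2" and pp: "piecewise_poly 3 T (state s)"
    and nodes: "\<And>i. i < length T \<Longrightarrow> slope s (T ! i) \<le> cont_rep \<psi> (T ! i)"
  shows "state s \<in> K_h T \<psi>"
proof -
  note w = weak_deriv_state[OF s state_L2[OF s] AE_I2, OF refl]
  have "state s \<in> V_space" by (rule V_space_state[OF state_L2[OF s] s]) simp
  then have "state s \<in> V_h T" using state_C1[OF s] pp by (simp add: V_h_def)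
  moreover have "P_h T (cont_rep (weak_deriv (state s))) x \<le> P_h T (cont_rep \<psi>) x" if x: "x \<in> {-1..1}" for x
    unfolding P_h_eq_broken_line[OF mesh x]
    by (rule broken_line_mono[OF mesh _ x]) (use w(6) mesh_bounds[OF mesh] nodes in simp)
  ultimately show ?thesis by (simp add: K_h_def)
qed

text \<open>A function in \<open>K_h\<close> is continuous on the closed interval, so it equals its representation
  everywhere there and not only almost everywhere; this is needed to see that the latter is
  piecewise polynomial.\<close>
lemma K_h_representation:
  assumes mesh: "is_mesh T" and y: "y \<in> K_h T \<psi>"
  obtains s where "s \<in> L2" "y \<in> L2" "AE x in IM. y x = state s x" "piecewise_poly 3 T (state s)"
    "\<And>i. i < length T \<Longrightarrow> slope s (T ! i) \<le> cont_rep \<psi> (T ! i)"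
proof -
  have yV: "y \<in> V_space" and yC: "C1_closed y" and yp: "piecewise_poly 3 T y"
    and yK: "\<And>x. x \<in> {-1..1} \<Longrightarrow> P_h T (cont_rep (weak_deriv y)) x \<le> P_h T (cont_rep \<psi>) x"
    using y by (auto simp: K_h_def V_h_def)
  obtain s where s: "s \<in> L2" "y \<in> L2" "AE x in IM. y x = state s x"
    using V_space_representation[OF yV] .
  note w = weak_deriv_state[OF s]
  obtain v' where "\<And>x. x \<in> {-1..1} \<Longrightarrow> (y has_real_derivative v' x) (at x within {-1..1})"
    using yC unfolding C1_closed_def by blast
  then have cy: "continuous_on {-1..1} y" by (rule DERIV_continuous_on)
  have ys: "y x = state s x" if "x \<in> {-1..1}" for x
    using cont_rep_eq[OF cy _ that, of y] w(7)[OF that] by simp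
  have "piecewise_poly 3 T (state s)"
    by (rule piecewise_poly_combination[OF mesh yp yp, where a=1 and b=0]) (simp add: ys)
  moreover have "slope s (T ! i) \<le> cont_rep \<psi> (T ! i)" if i: "i < length T" for i
    using yK[OF mesh_bounds[OF mesh i]] w(6)[OF mesh_bounds[OF mesh i]] by (simp add: P_h_node[OF mesh i])
  ultimately show ?thesis using s that by blast
qed

section \<open>The error estimate\<close>

text \<open>The interval has length \<open>2\<close>.\<close>
lemma L2_norm_le_of_bounded:
  assumes v: "v \<in> L2" and K: "K \<ge> 0" "\<And>x. x \<in> Iv \<Longrightarrow> (v x)\<^sup>2 \<le> 2 * K\<^sup>2"
  shows "L2_norm v \<le> 2 * K"
proof (rule power2_le_imp_le)
  have "(L2_norm v)\<^sup>2 = (LINT x|IM. (v x)\<^sup>2)"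
    unfolding L2_norm_sq ip_def by (simp add: power2_eq_square)
  also have "\<dots> \<le> (LINT x|IM. 2 * K\<^sup>2)"
    by (rule integral_mono[OF L2_sq_integrable[OF v] L2_integrable[OF L2_const]]) (use K in simp)
  also have "\<dots> = integral {-1..1::real} (\<lambda>x. 2 * K\<^sup>2)" by (rule integral_IM_eq[OF L2_const])
  also have "\<dots> = (2 * K)\<^sup>2" by (simp add: power_mult_distrib)
  finally show "(L2_norm v)\<^sup>2 \<le> (2 * K)\<^sup>2" .
qed (use K in simp)

lemma integral_bound_L2_norm:
  assumes v: "v \<in> L2" and "-1 \<le> a" "a \<le> b" "b \<le> 1"
  shows "(integral {a..b} v)\<^sup>2 \<le> 2 * (L2_norm v)\<^sup>2"
proof -
  let ?i = "indicator {a..b} :: real \<Rightarrow> real"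
  have "(L2_norm ?i)\<^sup>2 = b - a"
    using assms by (simp add: L2_norm_sq ip_indicator integral_indicator_interval)
  then have i: "(L2_norm ?i)\<^sup>2 \<le> 2" using assms by simp
  have "\<bar>integral {a..b} v\<bar> \<le> L2_norm v * L2_norm ?i"
    using ip_Cauchy_Schwarz[OF v L2_indicator[of a b]] ip_indicator[OF v assms(2,4)] by simp
  then have "(integral {a..b} v)\<^sup>2 \<le> (L2_norm v * L2_norm ?i)\<^sup>2"
    by (metis abs_ge_zero power2_abs power_mono)
  also have "\<dots> = (L2_norm v)\<^sup>2 * (L2_norm ?i)\<^sup>2" by (simp add: power_mult_distrib)
  also have "\<dots> \<le> (L2_norm v)\<^sup>2 * 2" using i by (intro mult_left_mono) auto
  finally show ?thesis by simp
qed

lemma slope_norm_le: "d \<in> L2 \<Longrightarrow> L2_norm (slope d) \<le> 2 * L2_norm d"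
  by (rule L2_norm_le_of_bounded) (auto simp: slope_def intro: integral_bound_L2_norm)

lemma state_norm_le:
  assumes "d \<in> L2" shows "L2_norm (state d) \<le> 4 * L2_norm d"
proof -
  have "L2_norm (state d) \<le> 2 * L2_norm (slope d)"
    by (rule L2_norm_le_of_bounded) (use assms in \<open>auto simp: state_def intro: integral_bound_L2_norm\<close>)
  then show ?thesis using slope_norm_le[OF assms] by simp
qed

text \<open>If \<open>h < E\<close>, then \<open>h\<^sup>2\<close> may be replaced by \<open>h * E\<close> and one factor \<open>E\<close> cancels.\<close>
lemma quadratic_inequality_bound:
  fixes E h A B \<beta> :: real
  assumes "\<beta> * E\<^sup>2 \<le> A * h * E + B * h\<^sup>2" "\<beta> > 0" "h > 0" "A \<ge> 0" "B \<ge> 0" "E \<ge> 0"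
  shows "E \<le> (1 + (A + B) / \<beta>) * h"
proof (cases "E \<le> h")
  case True
  have "1 * h \<le> (1 + (A + B) / \<beta>) * h" using assms by (intro mult_right_mono) auto
  with True show ?thesis by simp
next
  case False
  have "B * h * h \<le> B * h * E" using False assms by (intro mult_left_mono) auto
  then have "\<beta> * E * E \<le> (A + B) * h * E"
    using assms(1) by (simp add: power2_eq_square algebra_simps)
  then have "\<beta> * E \<le> (A + B) * h" using False assms by (simp add: mult_le_cancel_right)
  then have "E \<le> (A + B) / \<beta> * h" using assms by (simp add: field_simps)
  also have "\<dots> \<le> (1 + (A + B) / \<beta>) * h" using assms by (intro mult_right_mono) auto
  finally show ?thesis .
qed

lemma energy_deriv_diff:
  assumes "yd \<in> L2" "f \<in> L2" "r \<in> L2" "rh \<in> L2" "d \<in> L2"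
  shows "energy_deriv yd \<beta> f r d - energy_deriv yd \<beta> f rh d
    = ip (state (\<lambda>x. r x - rh x)) (state d) + \<beta> * ip (\<lambda>x. r x - rh x) d"
proof -
  have "ip (state (\<lambda>x. r x - rh x)) (state d) = ip (\<lambda>x. state r x - state rh x) (state d)"
    by (rule ip_cong) (use assms in \<open>auto simp: state_diff L2_diff\<close>)
  then show ?thesis
    using assms by (simp add: energy_deriv_def ip_diff_left ip_add_left L2_add L2_diff algebra_simps)
qed

text \<open>With \<open>osc v = v - Q v\<close> and \<open>e = r - rh\<close>, the two variational inequalities give \<open>\<beta> E\<^sup>2 \<le> ip
  n (osc (\<psi>1 - rh)) - ip n (osc r) + a e (osc r)\<close>, where \<open>a\<close> is the bilinear form of the cost. In
  the first two terms \<open>n\<close> may be replaced by \<open>osc n\<close>. The function \<open>rh\<close> has no modulus that is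
  uniform in the mesh, so \<open>\<psi>1 - rh\<close> is split as \<open>\<psi>1 - r + e\<close> and the oscillation of \<open>e\<close> is
  absorbed. The factor \<open>16\<close> comes from applying \<open>state_norm_le\<close> to both arguments of \<open>a\<close>.\<close>
lemma error_estimate:
  assumes mesh: "is_mesh T" and \<beta>: "\<beta> > 0"
    and L2s: "yd \<in> L2" "f \<in> L2" "r \<in> L2" "rh \<in> L2"
    and P: "\<And>x. x \<in> {-1..1} \<Longrightarrow> P x = cP + integral {-1..x} \<psi>1"
    and vi: "\<And>s. s \<in> L2 \<Longrightarrow> (\<And>x. x \<in> Iv \<Longrightarrow> slope s x \<le> P x) \<Longrightarrow> energy_deriv yd \<beta> f r (\<lambda>x. s x - r x) \<ge> 0"
    and vih: "energy_deriv yd \<beta> f rh (\<lambda>x. cell_mean T r x - rh x) \<ge> 0"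
    and nodes: "\<And>i. i < length T \<Longrightarrow> slope rh (T ! i) \<le> P (T ! i)"
    and n: "\<And>d. d \<in> L2 \<Longrightarrow> energy_deriv yd \<beta> f r d = ip n d" "H1_modulus n Mn"
    and r': "AE x in IM. r x = r' x" "H1_modulus r' Mr"
    and \<psi>1: "H1_modulus \<psi>1 M\<psi>"
    and \<kappa>: "\<kappa>n = sqrt (Mn 1 - Mn (-1))" "\<kappa>r = sqrt (Mr 1 - Mr (-1))" "\<kappa>\<psi> = sqrt (M\<psi> 1 - M\<psi> (-1))"
  shows "L2_norm (\<lambda>x. r x - rh x)
    \<le> (1 + (\<kappa>n + (16 + \<beta>) * \<kappa>r + \<kappa>n * (\<kappa>\<psi> + 2 * \<kappa>r)) / \<beta>) * mesh_size T"
proof -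
  let ?h = "mesh_size T" and ?G = "energy_deriv yd \<beta> f r" and ?Gh = "energy_deriv yd \<beta> f rh"
  define Q where "Q = cell_mean T"
  have QL2 [simp]: "Q v \<in> L2" for v unfolding Q_def by (rule cell_mean_L2[OF mesh])
  have nL2: "n \<in> L2" and \<psi>L2: "\<psi>1 \<in> L2" using n(2) \<psi>1 by (auto intro: H1_modulus_L2)
  note [simp] = L2s nL2 \<psi>L2 L2_add L2_diff
  have \<kappa>0: "\<kappa>n \<ge> 0" "\<kappa>r \<ge> 0" "\<kappa>\<psi> \<ge> 0"
    using H1_modulusD(2)[OF n(2), of "-1" 1] H1_modulusD(2)[OF r'(2), of "-1" 1] H1_modulusD(2)[OF \<psi>1, of "-1" 1]
    by (simp_all add: \<kappa>)
  have h: "?h > 0" by (rule mesh_size_pos[OF mesh])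
  define e where "e x = r x - rh x" for x
  define osc where "osc v = (\<lambda>x. v x - Q v x)" for v
  have eL2 [simp]: "e \<in> L2" unfolding e_def[abs_def] by simp
  have oscL2 [simp]: "osc v \<in> L2" if "v \<in> L2" for v unfolding osc_def using that by simp
  let ?E = "L2_norm e"
  have osc_n: "L2_norm (osc n) \<le> \<kappa>n * ?h"
    using cell_mean_error[OF mesh nL2 AE_I2[OF refl] n(2)] by (simp add: osc_def Q_def \<kappa> mult.commute)
  have osc_r: "L2_norm (osc r) \<le> \<kappa>r * ?h"
    using cell_mean_error[OF mesh L2s(3) r'] by (simp add: osc_def Q_def \<kappa> mult.commute)
  have osc_\<psi>: "L2_norm (osc \<psi>1) \<le> \<kappa>\<psi> * ?h"
    using cell_mean_error[OF mesh \<psi>L2 AE_I2[OF refl] \<psi>1] by (simp add: osc_def Q_def \<kappa> mult.commute)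
  have osc_e: "L2_norm (osc e) \<le> ?E"
    using cell_mean_norm_le[OF mesh eL2] by (simp add: osc_def Q_def)
  have G_osc: "\<bar>ip n (osc v)\<bar> \<le> \<kappa>n * ?h * L2_norm (osc v)" if v: "v \<in> L2" for v
  proof -
    have "ip (Q n) (osc v) = 0"
      using cell_step_orthogonal[OF mesh v] by (simp add: osc_def Q_def cell_mean_def)
    then have "ip n (osc v) = ip (osc n) (osc v)"
      using v unfolding osc_def[of n] by (simp add: ip_diff_left)
    then have "\<bar>ip n (osc v)\<bar> \<le> L2_norm (osc n) * L2_norm (osc v)" using ip_Cauchy_Schwarz v by simp
    also have "\<dots> \<le> \<kappa>n * ?h * L2_norm (osc v)" using osc_n by (intro mult_right_mono) auto
    finally show ?thesis .
  qed
  define d where "d x = \<psi>1 x - rh x" for x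
  have dL2 [simp]: "d \<in> L2" unfolding d_def[abs_def] by simp
  \<comment> \<open>The test function: its slope is \<open>P\<close> minus the interpolant of \<open>P - slope rh\<close>.\<close>
  define s where "s x = \<psi>1 x - Q d x" for x
  have sL2 [simp]: "s \<in> L2" unfolding s_def[abs_def] by simp
  have s_slope: "slope s x = P x - broken_line T (\<lambda>x. P x - slope rh x) x" if x: "x \<in> {-1..1}" for x
  proof -
    let ?w = "\<lambda>x. P x - slope rh x"
    have w: "?w x = (cP - slope rh (-1)) + integral {-1..x} d" if "x \<in> {-1..1}" for x
    proof -
      have "integral {-1..x} d = integral {-1..x} \<psi>1 - integral {-1..x} rh"
        unfolding d_def[abs_def] using that by (intro Henstock_Kurzweil_Integration.integral_diff L2_integrable_on) auto
      then show ?thesis using P[OF that] slope_eq[OF L2s(4) that] by simp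
    qed
    have bl: "broken_line T ?w x = ?w (-1) + integral {-1..x} (Q d)" if "x \<in> {-1..1}" for x
      unfolding Q_def by (rule broken_line_prim[OF mesh dL2 w that])
    have ints: "integral {-1..x} s = P x - P (-1) - (broken_line T ?w x - ?w (-1))" if "x \<in> {-1..1}" for x
    proof -
      have "integral {-1..x} s = integral {-1..x} \<psi>1 - integral {-1..x} (Q d)"
        unfolding s_def[abs_def] using that by (intro Henstock_Kurzweil_Integration.integral_diff L2_integrable_on) auto
      then show ?thesis using P[OF that] P[of "-1"] bl[OF that] by simp
    qed
    have "broken_line T ?w 1 = P 1"
      using broken_line_node[OF mesh, of "length T - 1" ?w] mesh_ends[OF mesh] by simp
    then have "slope s (-1) = P (-1) - ?w (-1)"
      using ints[of 1] by (simp add: slope_def)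
    then show ?thesis using slope_eq[OF sL2 x] ints[OF x] by simp
  qed
  have "slope s x \<le> P x" if "x \<in> Iv" for x
  proof -
    have x: "x \<in> {-1..1}" using that by auto
    have "broken_line T (\<lambda>x. 0) x \<le> broken_line T (\<lambda>x. P x - slope rh x) x"
      by (rule broken_line_mono[OF mesh _ x]) (use nodes in simp)
    then show ?thesis using s_slope[OF x] by (simp add: broken_line_def)
  qed
  then have vi_s: "ip n (\<lambda>x. s x - r x) \<ge> 0" using vi[OF sL2] n(1) by simp
  have s_rh: "(\<lambda>x. s x - rh x) = osc d" by (simp add: fun_eq_iff s_def osc_def d_def)
  have "?G e = ip n e" by (rule n(1)) simp
  also have "\<dots> = ip n (\<lambda>x. s x - rh x) - ip n (\<lambda>x. s x - r x)"
    unfolding e_def[abs_def] by (simp add: ip_diff_right)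
  also have "\<dots> \<le> ip n (osc d)" using vi_s unfolding s_rh by simp
  finally have G_e: "?G e \<le> ip n (osc d)" .
  have lin: "?Gh (\<lambda>x. u x + v x) = ?Gh u + ?Gh v" if "u \<in> L2" "v \<in> L2" for u v
    using that energy_deriv_eq_ip[OF L2s(1,2,4)] by (simp add: ip_add_right L2_scale)
  have "e = (\<lambda>x. osc r x + (Q r x - rh x))" by (simp add: fun_eq_iff e_def osc_def)
  then have "?Gh e = ?Gh (osc r) + ?Gh (\<lambda>x. Q r x - rh x)" using lin[of "osc r" "\<lambda>x. Q r x - rh x"] by simp
  then have Gh_e: "?Gh e \<ge> ?Gh (osc r)" using vih by (simp add: Q_def)
  have bil: "?G v - ?Gh v = ip (state e) (state v) + \<beta> * ip e v" if "v \<in> L2" for v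
    using energy_deriv_diff[OF L2s that] by (simp add: e_def[abs_def])
  have "\<beta> * ?E\<^sup>2 \<le> ip (state e) (state e) + \<beta> * ip e e" by (simp add: L2_norm_sq)
  also have "\<dots> = ?G e - ?Gh e" using bil[OF eL2] by simp
  also have "\<dots> \<le> ip n (osc d) - ip n (osc r) + (?G (osc r) - ?Gh (osc r))"
    using G_e Gh_e n(1)[of "osc r"] by simp
  also have "\<dots> = ip n (osc d) - ip n (osc r) + ip (state e) (state (osc r)) + \<beta> * ip e (osc r)"
    using bil[of "osc r"] by simp
  also have "\<dots> \<le> \<kappa>n * ?h * (\<kappa>\<psi> * ?h + \<kappa>r * ?h + ?E) + \<kappa>n * ?h * (\<kappa>r * ?h)
      + 16 * (?E * (\<kappa>r * ?h)) + \<beta> * (?E * (\<kappa>r * ?h))"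
  proof -
    have "L2_norm (osc d) \<le> L2_norm (osc \<psi>1) + L2_norm (osc r) + L2_norm (osc e)"
    proof -
      have Q_add: "Q (\<lambda>x. u x + v x) x = Q u x + Q v x" if "u \<in> L2" "v \<in> L2" for u v x
        unfolding Q_def by (rule cell_mean_add[OF mesh that])
      have "(\<lambda>x. d x + r x) = (\<lambda>x. \<psi>1 x + e x)" by (simp add: fun_eq_iff d_def e_def)
      then have "Q d x + Q r x = Q \<psi>1 x + Q e x" for x
        using Q_add[of d r x] Q_add[of \<psi>1 e x] by simp
      then have "osc d = (\<lambda>x. (osc \<psi>1 x - osc r x) + osc e x)"
        by (simp add: fun_eq_iff osc_def d_def e_def algebra_simps)
      then have "L2_norm (osc d) \<le> L2_norm (\<lambda>x. osc \<psi>1 x - osc r x) + L2_norm (osc e)"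
        using L2_norm_triangle[of "\<lambda>x. osc \<psi>1 x - osc r x" "osc e"] by simp
      also have "\<dots> \<le> L2_norm (osc \<psi>1) + L2_norm (osc r) + L2_norm (osc e)"
        using L2_norm_triangle_diff[of "osc \<psi>1" "osc r"] by simp
      finally show ?thesis .
    qed
    then have "L2_norm (osc d) \<le> \<kappa>\<psi> * ?h + \<kappa>r * ?h + ?E" using osc_\<psi> osc_r osc_e by linarith
    then have "\<kappa>n * ?h * L2_norm (osc d) \<le> \<kappa>n * ?h * (\<kappa>\<psi> * ?h + \<kappa>r * ?h + ?E)"
      using \<kappa>0 h by (intro mult_left_mono) auto
    then have 1: "ip n (osc d) \<le> \<kappa>n * ?h * (\<kappa>\<psi> * ?h + \<kappa>r * ?h + ?E)" using G_osc[OF dL2] by linarith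
    have "\<kappa>n * ?h * L2_norm (osc r) \<le> \<kappa>n * ?h * (\<kappa>r * ?h)"
      using osc_r \<kappa>0 h by (intro mult_left_mono) auto
    then have 2: "- ip n (osc r) \<le> \<kappa>n * ?h * (\<kappa>r * ?h)" using G_osc[OF L2s(3)] by linarith
    have er: "?E * L2_norm (osc r) \<le> ?E * (\<kappa>r * ?h)" using osc_r by (intro mult_left_mono) auto
    have "ip (state e) (state (osc r)) \<le> L2_norm (state e) * L2_norm (state (osc r))"
      using ip_Cauchy_Schwarz[of "state e" "state (osc r)"] by simp
    also have "\<dots> \<le> (4 * ?E) * (4 * L2_norm (osc r))"
      by (intro mult_mono state_norm_le) auto
    finally have 3: "ip (state e) (state (osc r)) \<le> 16 * (?E * (\<kappa>r * ?h))" using er by simp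
    have "ip e (osc r) \<le> ?E * (\<kappa>r * ?h)" using ip_Cauchy_Schwarz[of e "osc r"] er by simp
    then have 4: "\<beta> * ip e (osc r) \<le> \<beta> * (?E * (\<kappa>r * ?h))" using \<beta> by (intro mult_left_mono) auto
    show ?thesis using 1 2 3 4 by linarith
  qed
  also have "\<dots> = (\<kappa>n + (16 + \<beta>) * \<kappa>r) * ?h * ?E + \<kappa>n * (\<kappa>\<psi> + 2 * \<kappa>r) * ?h\<^sup>2"
    by (simp add: power2_eq_square algebra_simps)
  finally have "?E \<le> (1 + ((\<kappa>n + (16 + \<beta>) * \<kappa>r) + \<kappa>n * (\<kappa>\<psi> + 2 * \<kappa>r)) / \<beta>) * ?h"
    by (rule quadratic_inequality_bound) (use \<beta> h \<kappa>0 in auto)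
  then show ?thesis by (simp add: e_def[abs_def])
qed

lemma K_set_iff_slope:
  assumes "y \<in> L2" "r \<in> L2" "AE x in IM. y x = state r x"
  shows "y \<in> K_set \<psi> \<longleftrightarrow> (\<forall>x\<in>Iv. slope r x \<le> cont_rep \<psi> x)"
proof -
  have "cont_rep (weak_deriv y) x = slope r x" if "x \<in> Iv" for x
    using weak_deriv_state(6)[OF assms(2,1,3), of x] that by auto
  then show ?thesis using V_space_state[OF assms] by (simp add: K_set_def)
qed

theorem theorem3p3:
  fixes y\<^sub>d f \<psi> ybar :: "real \<Rightarrow> real" and \<beta> \<rho> :: real
  assumes "y\<^sub>d \<in> L2"
    and "\<beta> > 0"
    and "f \<in> Sobolev_H 1"
    and "\<psi> \<in> Sobolev_H 2"
    and "cont_rep \<psi> 1 \<ge> 0"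
    and "continuous_solution y\<^sub>d \<beta> f \<psi> ybar"
  shows "\<exists>C>0. \<forall>F. quasi_uniform_family \<rho> F \<longrightarrow>
           (\<forall>T\<in>F. \<forall>yh. discrete_solution y\<^sub>d \<beta> f \<psi> T yh \<longrightarrow>
              H1_seminorm (\<lambda>x. ybar x - yh x)
                + L2_norm (\<lambda>x. control f ybar x - control f yh x) \<le> C * mesh_size T)"
proof -
  have "f \<in> Sobolev_H (Suc 0)" using assms(3) by simp
  then obtain f1 where f1: "has_weak_deriv f f1" by auto
  then have fL2: "f \<in> L2" and f1L2: "f1 \<in> L2" by (auto simp: has_weak_deriv_def)
  obtain cf where cf: "AE x in IM. f x = cf + integral {-1..x} f1" using has_weak_derivD[OF f1] ..
  obtain \<psi>2 \<psi>1 cP where \<psi>: "\<psi>2 \<in> L2" "\<psi> \<in> L2" "continuous_on {-1..1} \<psi>1"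
    "\<And>x. x \<in> {-1..1} \<Longrightarrow> \<psi>1 x = \<psi>1 (-1) + integral {-1..x} \<psi>2"
    "AE x in IM. weak_deriv \<psi> x = \<psi>1 x"
    "AE x in IM. \<psi> x = cP + integral {-1..x} \<psi>1"
    by (rule H2_representation[OF assms(4)], rule that)
  define P where "P = cont_rep \<psi>"
  have P: "P x = cP + integral {-1..x} \<psi>1" if "x \<in> {-1..1}" for x
    unfolding P_def
    by (rule cont_rep_eq[OF _ \<psi>(6) that])
       (intro continuous_on_add continuous_on_const prim_continuous L2_continuous \<psi>(3))
  have yK: "ybar \<in> K_set \<psi>" and ymin: "\<And>z. z \<in> K_set \<psi> \<Longrightarrow> cost y\<^sub>d \<beta> f ybar \<le> cost y\<^sub>d \<beta> f z"
    using assms(6) by (auto simp: continuous_solution_def is_arg_min_def not_less)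
  have "ybar \<in> V_space" using yK by (simp add: K_set_def)
  then obtain r where r: "r \<in> L2" "ybar \<in> L2" "AE x in IM. ybar x = state r x"
    by (rule V_space_representation)
  have adm: "slope r x \<le> P x" if "x \<in> Iv" for x
    using yK K_set_iff_slope[OF r(2,1,3)] that by (simp add: P_def)
  have min: "energy y\<^sub>d \<beta> f r \<le> energy y\<^sub>d \<beta> f s" if s: "s \<in> L2" "\<And>x. x \<in> Iv \<Longrightarrow> slope s x \<le> P x" for s
  proof -
    have ae: "AE x in IM. state s x = state s x" by simp
    have "state s \<in> K_set \<psi>" using K_set_iff_slope[OF state_L2[OF s(1)] s(1) ae] s(2) by (simp add: P_def)
    then have "cost y\<^sub>d \<beta> f ybar \<le> cost y\<^sub>d \<beta> f (state s)" by (rule ymin)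
    then show ?thesis
      using cost_eq_energy[OF assms(1) fL2 r(1,2,3), of \<beta>] cost_eq_energy[OF assms(1) fL2 s(1) state_L2[OF s(1)] ae, of \<beta>]
      by simp
  qed
  have vi: "energy_deriv y\<^sub>d \<beta> f r (\<lambda>x. s x - r x) \<ge> 0"
    if s: "s \<in> L2" "\<And>x. x \<in> Iv \<Longrightarrow> slope s x \<le> P x" for s
  proof (rule obstacle_variational_inequality[where S=Iv and P=P, OF assms(1) fL2 r(1) s(1) adm s(2)])
    fix t :: real
    assume "\<And>x. x \<in> Iv \<Longrightarrow> slope (\<lambda>x. r x + t * (s x - r x)) x \<le> P x"
    then show "energy y\<^sub>d \<beta> f r \<le> energy y\<^sub>d \<beta> f (\<lambda>x. r x + t * (s x - r x))"
      by (intro min L2_add L2_scale L2_diff r(1) s(1))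
  qed auto
  obtain n Mn r' Mr where n: "H1_modulus n Mn" "\<And>d. d \<in> L2 \<Longrightarrow> energy_deriv y\<^sub>d \<beta> f r d = ip n d"
    and r': "H1_modulus r' Mr" "AE x in IM. r x = r' x"
  proof (rule minimizer_regularity[OF assms(1) fL2 r(1) f1L2 \<psi>(1) assms(2) cf])
    show "P x = cP + integral {-1..x} \<psi>1" if "x \<in> {-1..1}" for x using that by (rule P)
    show "\<psi>1 x = \<psi>1 (-1) + integral {-1..x} \<psi>2" if "x \<in> {-1..1}" for x using that by (rule \<psi>(4))
    show "slope r x \<le> P x" if "x \<in> Iv" for x using that by (rule adm)
    show "energy y\<^sub>d \<beta> f r \<le> energy y\<^sub>d \<beta> f s" if "s \<in> L2" "\<And>x. x \<in> Iv \<Longrightarrow> slope s x \<le> P x" for s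
      using that by (rule min)
  qed (rule that)
  have \<psi>1: "H1_modulus \<psi>1 (\<lambda>x. integral {-1..x} (\<lambda>t. (\<psi>2 t)\<^sup>2))"
    by (rule H1_modulus_prim[OF \<psi>(1) \<psi>(4)]) auto
  define \<kappa>n where "\<kappa>n = sqrt (Mn 1 - Mn (-1))"
  define \<kappa>r where "\<kappa>r = sqrt (Mr 1 - Mr (-1))"
  define \<kappa>\<psi> where "\<kappa>\<psi> = sqrt (integral {-1..1} (\<lambda>t. (\<psi>2 t)\<^sup>2) - integral {-1..-1} (\<lambda>t. (\<psi>2 t)\<^sup>2))"
  define C where "C = 1 + (\<kappa>n + (16 + \<beta>) * \<kappa>r + \<kappa>n * (\<kappa>\<psi> + 2 * \<kappa>r)) / \<beta>"
  have "\<kappa>n \<ge> 0" "\<kappa>r \<ge> 0" "\<kappa>\<psi> \<ge> 0"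
    using H1_modulusD(2)[OF n(1), of "-1" 1] H1_modulusD(2)[OF r'(1), of "-1" 1] H1_modulusD(2)[OF \<psi>1, of "-1" 1]
    by (simp_all add: \<kappa>n_def \<kappa>r_def \<kappa>\<psi>_def)
  then have C: "C > 0" using assms(2) by (simp add: C_def add_pos_nonneg)
  have bound: "H1_seminorm (\<lambda>x. ybar x - yh x) + L2_norm (\<lambda>x. control f ybar x - control f yh x)
      \<le> 3 * C * mesh_size T"
    if mesh: "is_mesh T" and dis: "discrete_solution y\<^sub>d \<beta> f \<psi> T yh" for T yh
  proof -
    have yhK: "yh \<in> K_h T \<psi>" and yhmin: "\<And>z. z \<in> K_h T \<psi> \<Longrightarrow> cost y\<^sub>d \<beta> f yh \<le> cost y\<^sub>d \<beta> f z"
      using dis by (auto simp: discrete_solution_def is_arg_min_def not_less)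
    obtain rh where rh: "rh \<in> L2" "yh \<in> L2" "AE x in IM. yh x = state rh x" "piecewise_poly 3 T (state rh)"
      "\<And>i. i < length T \<Longrightarrow> slope rh (T ! i) \<le> cont_rep \<psi> (T ! i)"
      by (rule K_h_representation[OF mesh yhK], rule that)
    note rh_nodes = rh(5)[folded P_def]
    let ?Q = "cell_mean T r"
    have QL2: "?Q \<in> L2" by (rule cell_mean_L2[OF mesh])
    \<comment> \<open>The end points are nodes, so the constraint is needed there too.\<close>
    have sl: "slope r x \<le> P x" if "x \<in> {-1..1}" for x
    proof -
      have "continuous_on {-1..1} (\<lambda>x. P x - slope r x)"
      proof (intro continuous_on_diff slope_continuous r(1))
        have "continuous_on {-1..1} (\<lambda>x. cP + integral {-1..x} \<psi>1)"
          by (intro continuous_on_add continuous_on_const prim_continuous L2_continuous \<psi>(3))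
        then show "continuous_on {-1..1} P" by (rule continuous_on_eq) (rule P[symmetric])
      qed
      then have "0 \<le> P x - slope r x"
        using continuous_ge_on_closure[of Iv "\<lambda>x. P x - slope r x" x 0] adm that by simp
      then show ?thesis by simp
    qed
    have Q_nodes: "slope ?Q (T ! i) \<le> P (T ! i)" if i: "i < length T" for i
      using slope_cell_mean[OF mesh r(1) mesh_bounds[OF mesh i]] broken_line_node[OF mesh i] sl[OF mesh_bounds[OF mesh i]]
      by simp
    have Q_poly: "piecewise_poly 3 T (state ?Q)"
      by (rule state_piecewise_poly[OF mesh QL2 slope_cell_mean[OF mesh r(1)]])
    have vih: "energy_deriv y\<^sub>d \<beta> f rh (\<lambda>x. ?Q x - rh x) \<ge> 0"
    proof (rule obstacle_variational_inequality[where S="set T" and P=P, OF assms(1) fL2 rh(1) QL2])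
      show "slope rh x \<le> P x" "slope ?Q x \<le> P x" if "x \<in> set T" for x
        using that rh_nodes Q_nodes by (auto simp: in_set_conv_nth)
      show "set T \<subseteq> {-1..1}" using mesh_bounds[OF mesh] by (fastforce simp: in_set_conv_nth)
      fix t :: real
      let ?s = "\<lambda>x. rh x + t * (?Q x - rh x)"
      assume nodes: "\<And>x. x \<in> set T \<Longrightarrow> slope ?s x \<le> P x"
      have sL2: "?s \<in> L2" by (intro L2_add L2_scale L2_diff rh(1) QL2)
      have "piecewise_poly 3 T (state ?s)"
      proof (rule piecewise_poly_combination[OF mesh rh(4) Q_poly, where a="1 - t" and b=t])
        fix x :: real assume "x \<in> {-1..1}"
        then show "state ?s x = (1 - t) * state rh x + t * state ?Q x"
          using rh(1) QL2 by (simp add: state_add state_scale state_diff L2_scale L2_diff) (simp add: algebra_simps)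
      qed
      then have "state ?s \<in> K_h T \<psi>"
        by (rule state_in_K_h[OF mesh sL2]) (use nodes in \<open>simp add: P_def\<close>)
      then have "cost y\<^sub>d \<beta> f yh \<le> cost y\<^sub>d \<beta> f (state ?s)" by (rule yhmin)
      moreover have "AE x in IM. state ?s x = state ?s x" by simp
      ultimately show "energy y\<^sub>d \<beta> f rh \<le> energy y\<^sub>d \<beta> f ?s"
        using cost_eq_energy[OF assms(1) fL2 rh(1,2,3), of \<beta>] cost_eq_energy[OF assms(1) fL2 sL2 state_L2[OF sL2], of \<beta>]
        by simp
    qed
    define e where "e x = r x - rh x" for x
    have eL2: "e \<in> L2" unfolding e_def[abs_def] by (intro L2_diff r(1) rh(1))
    have E: "L2_norm e \<le> C * mesh_size T"
      unfolding e_def[abs_def] C_def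
      by (rule error_estimate[OF mesh assms(2) assms(1) fL2 r(1) rh(1) P vi vih rh_nodes n(2,1) r'(2,1) \<psi>1])
         (simp_all add: \<kappa>n_def \<kappa>r_def \<kappa>\<psi>_def)
    have dL2: "(\<lambda>x. ybar x - yh x) \<in> L2" by (intro L2_diff r(2) rh(2))
    have inI: "AE x in IM. x \<in> Iv" by (rule AE_I2) simp
    have "AE x in IM. ybar x - yh x = state e x"
      using r(3) rh(3) inI
    proof eventually_elim
      case (elim x)
      then have "x \<in> {-1..1}" by auto
      then show ?case using elim state_diff[OF r(1) rh(1)] by (simp add: e_def[abs_def])
    qed
    note w = weak_deriv_state[OF eL2 dL2 this]
    have "H1_seminorm (\<lambda>x. ybar x - yh x) = L2_norm (slope e)"
      unfolding H1_seminorm_def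
      by (rule L2_norm_cong_AE[OF w(3)])
         (use w(4) eL2 in \<open>simp_all add: L2_measurable has_weak_deriv_def\<close>)
    moreover have "L2_norm (\<lambda>x. control f ybar x - control f yh x) = L2_norm (\<lambda>x. - e x)"
    proof (rule L2_norm_cong_AE)
      note wr = weak_deriv_state[OF r] and wrh = weak_deriv_state[OF rh(1-3)]
      show "AE x in IM. control f ybar x - control f yh x = - e x"
        using wr(5) wrh(5) by eventually_elim (simp add: control_def e_def)
      show "(\<lambda>x. control f ybar x - control f yh x) \<in> borel_measurable IM"
        unfolding control_def by (intro L2_measurable L2_diff L2_minus wr(8) wrh(8) fL2)
      show "(\<lambda>x. - e x) \<in> borel_measurable IM" by (intro L2_measurable L2_minus eL2)
    qed
    ultimately show ?thesis using slope_norm_le[OF eL2] E by (simp add: L2_norm_minus)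
  qed
  show ?thesis
  proof (intro exI[of _ "3 * C"] conjI allI impI ballI)
    show "3 * C > 0" using C by simp
    fix F T yh assume "quasi_uniform_family \<rho> F" "T \<in> F" "discrete_solution y\<^sub>d \<beta> f \<psi> T yh"
    then show "H1_seminorm (\<lambda>x. ybar x - yh x) + L2_norm (\<lambda>x. control f ybar x - control f yh x)
      \<le> 3 * C * mesh_size T"
      by (intro bound) (auto simp: quasi_uniform_family_def)
  qed
qed

end
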